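(* Let $n\ge 2$, let $\Omega\subset\mathbb{R}^n$ be open and bounded, let $0<s\le t<1$, $1<p\le q<\infty$, $\Lambda\ge 1$, and let the kernels $K_{sp},K_{tq}$ and the coefficient $a$ be as in the context. Assume moreover that there are $\alpha\in(0,1]$ and $[a]_\alpha\ge 0$ with $$|a(x_1,y_1)-a(x_2,y_2)|\le [a]_\alpha(|x_1-x_2|+|y_1-y_2|)^\alpha\quad\text{for all }(x_1,y_1),(x_2,y_2)\in\mathbb{R}^n\times\mathbb{R}^n,$$ and that $tq\le sp+\alpha$. Let $B_r(x_0)\subset\Omega$ with $0<r\le 1$ and let $u\in\mathcal{A}(\Omega)\cap L^{p-1}_{sp}(\mathbb{R}^n)\cap L^{q-1}_{a,tq}(\Omega,\mathbb{R}^n)$ be a locally bounded minimizer of $\mathcal{F}(\cdot;\Omega)$. Then for any $\delta\in(0,1]$, $$\sup_{B_{\frac r2}(x_0)}u\le C_\delta H_r^{-1}\left(\frac{1}{|B_r(x_0)|}\int_{B_r(x_0)}H_r(u_+)\,dx\right)+\delta\,h_r^{-1}\left(T\left(u_+;x_0,\frac r2\right)\right),$$ where the positive constant $C_\delta$ depends only on $\mathbf{data}(B_r(x_0))$ and $\delta$, and $$T\Big(u_+;x_0,\frac r2\Big):=\int_{\mathbb{R}^n\setminus B_{\frac r2}(x_0)}\frac{u_+^{p-1}(x)}{|x-x_0|^{n+sp}}\,dx+\sup_{y\in B_r(x_0)}\int_{\mathbb{R}^n\setminus B_{\frac r2}(x_0)}a(x,y)\frac{u_+^{q-1}(x)}{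|x-x_0|^{n+tq}}\,dx.$$
   Context: Setting. $B_r(x_0)=\{x\in\mathbb{R}^n:|x-x_0|<r\}$. The kernels $K_{sp},K_{tq}:\mathbb{R}^n\times\mathbb{R}^n\to[0,\infty)$ are measurable and satisfy $$\frac{\Lambda^{-1}}{|x-y|^{n+sp}}\le K_{sp}(x,y)\le\frac{\Lambda}{|x-y|^{n+sp}},\qquad \frac{\Lambda^{-1}}{|x-y|^{n+tq}}\le K_{tq}(x,y)\le\frac{\Lambda}{|x-y|^{n+tq}}.$$ The coefficient $a:\mathbb{R}^n\times\mathbb{R}^n\to\mathbb{R}$ is measurable with $0\le a(x,y)=a(y,x)$. Put $\mathcal{C}_\Omega=(\mathbb{R}^n\times\mathbb{R}^n)\setminus((\mathbb{R}^n\setminus\Omega)\times(\mathbb{R}^n\setminus\Omega))$ and $$\mathcal{F}(u;\Omega)=\iint_{\mathcal{C}_\Omega}\big[|u(x)-u(y)|^pK_{sp}(x,y)+a(x,y)|u(x)-u(y)|^qK_{tq}(x,y)\big]\,dx\,dy.$$ Function spaces and minimizers (all functions measurable). $\mathcal{A}(\Omega)$ is the set of $u:\mathbb{R}^n\to\mathbb{R}$ with $u|_\Omega\in L^p(\Omega)$ and $$\iint_{\mathcal{C}_\Omega}\frac{|u(x)-u(y)|^p}{|x-y|^{n+sp}}+a(x,y)\frac{|u(x)-u(y)|^q}{|x-y|^{n+tq}}\,dx\,dy<\infty.$$ $L^{p-1}_{sp}(\mathbb{R}^n)$ is the set of $u$ with $\int_{\mathbb{R}^n}\frac{|u(x)|^{p-1}}{(1+|x|)^{n+sp}}\,dx<\infty$;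 $L^{q-1}_{a,tq}(\Omega,\mathbb{R}^n)$ is the set of $u$ with $\sup_{x\in\Omega}\int_{\mathbb{R}^n}a(x,y)\frac{|u(y)|^{q-1}}{(1+|y|)^{n+tq}}\,dy<\infty$. A function $u\in\mathcal{A}(\Omega)$ is a minimizer of $\mathcal{F}(\cdot;\Omega)$ if $\mathcal{F}(u;\Omega)\le\mathcal{F}(v;\Omega)$ for every $v\in\mathcal{A}(\Omega)$ with $v=u$ a.e. in $\mathbb{R}^n\setminus\Omega$. Locally bounded means locally bounded in $\Omega$. Suprema of $u$ are essential suprema; $u_+=\max\{u,0\}$. Further notation. $a_r^-=\inf_{B_r(x_0)\times B_r(x_0)}a(x,y)$; for $k\ge 0$, $$h_r(k)=\frac{k^{p-1}}{r^{sp}}+a_r^-\frac{k^{q-1}}{r^{tq}},\qquad H_r(k)=\frac{k^p}{r^{sp}}+a_r^-\frac{k^q}{r^{tq}},$$ and $h_r^{-1},H_r^{-1}$ are their inverses on $[0,\infty)$. For $D\subset\Omega$, $\mathbf{data}(D)$ is the list $n,p,q,s,t,\Lambda,\alpha,[a]_\alpha,\|u\|_{L^\infty(D)}$ if $sp\le n$, and $n,p,q,s,t,\Lambda,\alpha,[a]_\alpha,[u]_{W^{s,p}(D)}$ if $sp>n$, where $[u]_{W^{s,p}(D)}=\big(\int_D\int_D\frac{|u(x)-u(y)|^p}{|x-y|^{n+sp}}dxdy\big)^{1/p}$. Dependence on $\mathbf{data}(D)$ presupposes that the listed quantities are finite (in particular $u$ is bounded in $D$). *)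

theory Defs
  imports "HOL-Probability.Essential_Supremum"
begin

text \<open>
  Measurability, null sets and integrals are with respect to Lebesgue measure, on \<open>real ^ 'n\<close> or on
  the product \<open>(real ^ 'n) \<times> (real ^ 'n)\<close>.  Integrals of nonnegative functions are
  \<open>ennreal\<close>-valued, so that finiteness is always an explicit condition.
  Since \<open>0 powr c = 0\<close> and \<open>z / 0 = 0\<close>, the integrands with denominator
  \<open>norm (x - y) powr c\<close> vanish on the diagonal, which is a null set.
\<close>

definition cross_domain :: "(real ^ 'n) set \<Rightarrow> ((real ^ 'n) \<times> (real ^ 'n)) set" where
  "cross_domain \<Omega> = UNIV - (- \<Omega>) \<times> (- \<Omega>)"

text \<open>The two-sided kernel bound is imposed off the diagonal only: on the diagonal
  \<open>norm (x - y) powr (n + \<sigma>)\<close> is zero and the bound has no meaning.\<close>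

definition comparable_kernel :: "real \<Rightarrow> real \<Rightarrow> (real ^ 'n \<Rightarrow> real ^ 'n \<Rightarrow> real) \<Rightarrow> bool" where
  "comparable_kernel \<Lambda> \<sigma> K \<longleftrightarrow>
     (\<lambda>(x, y). K x y) \<in> borel_measurable lebesgue \<and>
     (\<forall>x y. 0 \<le> K x y) \<and>
     (\<forall>x y. x \<noteq> y \<longrightarrow>
        inverse \<Lambda> / norm (x - y) powr (real CARD('n) + \<sigma>) \<le> K x y \<and>
        K x y \<le> \<Lambda> / norm (x - y) powr (real CARD('n) + \<sigma>))"

definition coefficient :: "(real ^ 'n \<Rightarrow> real ^ 'n \<Rightarrow> real) \<Rightarrow> bool" where
  "coefficient a \<longleftrightarrow>
     (\<lambda>(x, y). a x y) \<in> borel_measurable lebesgue \<and>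
     (\<forall>x y. 0 \<le> a x y \<and> a x y = a y x)"

definition hoelder_coefficient ::
    "real \<Rightarrow> real \<Rightarrow> (real ^ 'n \<Rightarrow> real ^ 'n \<Rightarrow> real) \<Rightarrow> bool" where
  "hoelder_coefficient \<alpha> A a \<longleftrightarrow>
     (\<forall>x1 y1 x2 y2. \<bar>a x1 y1 - a x2 y2\<bar> \<le> A * (norm (x1 - x2) + norm (y1 - y2)) powr \<alpha>)"

definition energy :: "real \<Rightarrow> real \<Rightarrow> (real ^ 'n \<Rightarrow> real ^ 'n \<Rightarrow> real) \<Rightarrow>
    (real ^ 'n \<Rightarrow> real ^ 'n \<Rightarrow> real) \<Rightarrow> (real ^ 'n \<Rightarrow> real ^ 'n \<Rightarrow> real) \<Rightarrow>
    (real ^ 'n) set \<Rightarrow> (real ^ 'n \<Rightarrow> real) \<Rightarrow> ennreal" where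
  "energy p q a Ksp Ktq \<Omega> u =
     (\<integral>\<^sup>+ (x, y). ennreal (\<bar>u x - u y\<bar> powr p * Ksp x y + a x y * \<bar>u x - u y\<bar> powr q * Ktq x y)
        \<partial>lebesgue_on (cross_domain \<Omega>))"

definition admissible :: "real \<Rightarrow> real \<Rightarrow> real \<Rightarrow> real \<Rightarrow>
    (real ^ 'n \<Rightarrow> real ^ 'n \<Rightarrow> real) \<Rightarrow> (real ^ 'n) set \<Rightarrow> (real ^ 'n \<Rightarrow> real) set" where
  "admissible p q s t a \<Omega> = {u \<in> borel_measurable lebesgue.
     (\<integral>\<^sup>+ x. ennreal (\<bar>u x\<bar> powr p) \<partial>lebesgue_on \<Omega>) < \<infinity> \<and>
     (\<integral>\<^sup>+ (x, y). ennreal (\<bar>u x - u y\<bar> powr p / norm (x - y) powr (real CARD('n) + s * p)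
          + a x y * (\<bar>u x - u y\<bar> powr q / norm (x - y) powr (real CARD('n) + t * q)))
        \<partial>lebesgue_on (cross_domain \<Omega>)) < \<infinity>}"

definition tail_space :: "real \<Rightarrow> real \<Rightarrow> (real ^ 'n \<Rightarrow> real) set" where
  "tail_space p s = {u \<in> borel_measurable lebesgue.
     (\<integral>\<^sup>+ x. ennreal (\<bar>u x\<bar> powr (p - 1) / (1 + norm x) powr (real CARD('n) + s * p)) \<partial>lebesgue) < \<infinity>}"

definition weighted_tail_space :: "real \<Rightarrow> real \<Rightarrow> (real ^ 'n \<Rightarrow> real ^ 'n \<Rightarrow> real) \<Rightarrow>
    (real ^ 'n) set \<Rightarrow> (real ^ 'n \<Rightarrow> real) set" where
  "weighted_tail_space q t a \<Omega> = {u \<in> borel_measurable lebesgue.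
     (SUP x\<in>\<Omega>. \<integral>\<^sup>+ y. ennreal (a x y * (\<bar>u y\<bar> powr (q - 1)
         / (1 + norm y) powr (real CARD('n) + t * q))) \<partial>lebesgue) < \<infinity>}"

definition minimizer :: "real \<Rightarrow> real \<Rightarrow> real \<Rightarrow> real \<Rightarrow> (real ^ 'n \<Rightarrow> real ^ 'n \<Rightarrow> real) \<Rightarrow>
    (real ^ 'n \<Rightarrow> real ^ 'n \<Rightarrow> real) \<Rightarrow> (real ^ 'n \<Rightarrow> real ^ 'n \<Rightarrow> real) \<Rightarrow>
    (real ^ 'n) set \<Rightarrow> (real ^ 'n \<Rightarrow> real) \<Rightarrow> bool" where
  "minimizer p q s t a Ksp Ktq \<Omega> u \<longleftrightarrow>
     u \<in> admissible p q s t a \<Omega> \<and>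
     (\<forall>v \<in> admissible p q s t a \<Omega>. (AE x in lebesgue. x \<notin> \<Omega> \<longrightarrow> v x = u x) \<longrightarrow>
        energy p q a Ksp Ktq \<Omega> u \<le> energy p q a Ksp Ktq \<Omega> v)"

definition locally_bounded_in :: "(real ^ 'n) set \<Rightarrow> (real ^ 'n \<Rightarrow> real) \<Rightarrow> bool" where
  "locally_bounded_in \<Omega> u \<longleftrightarrow>
     (\<forall>S. compact S \<and> S \<subseteq> \<Omega> \<longrightarrow> (\<exists>b. AE x in lebesgue_on S. \<bar>u x\<bar> \<le> b))"

definition a_minus :: "(real ^ 'n \<Rightarrow> real ^ 'n \<Rightarrow> real) \<Rightarrow> real ^ 'n \<Rightarrow> real \<Rightarrow> real" where
  "a_minus a x0 r = (INF (x, y) \<in> ball x0 r \<times> ball x0 r. a x y)"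

text \<open>In the next two definitions \<open>m\<close> is the number \<open>a_minus a x0 r\<close>.\<close>

definition h_fun :: "real \<Rightarrow> real \<Rightarrow> real \<Rightarrow> real \<Rightarrow> real \<Rightarrow> real \<Rightarrow> real \<Rightarrow> real" where
  "h_fun p q s t m r k = k powr (p - 1) / r powr (s * p) + m * (k powr (q - 1) / r powr (t * q))"

definition H_fun :: "real \<Rightarrow> real \<Rightarrow> real \<Rightarrow> real \<Rightarrow> real \<Rightarrow> real \<Rightarrow> real \<Rightarrow> real" where
  "H_fun p q s t m r k = k powr p / r powr (s * p) + m * (k powr q / r powr (t * q))"

text \<open>The tail \<open>T(w; x0, \<rho>)\<close> of a nonnegative function \<open>w\<close>; the supremum in the second term is
  over the ball of radius \<open>r\<close>.\<close>

definition nonlocal_tail :: "real \<Rightarrow> real \<Rightarrow> real \<Rightarrow> real \<Rightarrow> (real ^ 'n \<Rightarrow> real ^ 'n \<Rightarrow> real) \<Rightarrow>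
    (real ^ 'n \<Rightarrow> real) \<Rightarrow> real ^ 'n \<Rightarrow> real \<Rightarrow> real \<Rightarrow> ennreal" where
  "nonlocal_tail p q s t a w x0 r \<rho> =
     (\<integral>\<^sup>+ x. ennreal (w x powr (p - 1) / norm (x - x0) powr (real CARD('n) + s * p))
        \<partial>lebesgue_on (- ball x0 \<rho>)) +
     (SUP y\<in>ball x0 r.
        \<integral>\<^sup>+ x. ennreal (a x y * (w x powr (q - 1) / norm (x - x0) powr (real CARD('n) + t * q)))
          \<partial>lebesgue_on (- ball x0 \<rho>))"

text \<open>\<open>gagliardo_power p s D u\<close> is the \<open>p\<close>-th power of the seminorm of \<open>u\<close> in \<open>W\<^sup>s\<^sup>,\<^sup>p(D)\<close>.\<close>

definition gagliardo_power ::
    "real \<Rightarrow> real \<Rightarrow> (real ^ 'n) set \<Rightarrow> (real ^ 'n \<Rightarrow> real) \<Rightarrow> ennreal" where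
  "gagliardo_power p s D u =
     (\<integral>\<^sup>+ (x, y). ennreal (\<bar>u x - u y\<bar> powr p / norm (x - y) powr (real CARD('n) + s * p))
        \<partial>lebesgue_on (D \<times> D))"

text \<open>\<open>has_data_norm p s D u M\<close>: the entry of \<open>data(D)\<close> that depends on \<open>u\<close> is finite and equals
  the real number \<open>M\<close>.\<close>

definition has_data_norm ::
    "real \<Rightarrow> real \<Rightarrow> (real ^ 'n) set \<Rightarrow> (real ^ 'n \<Rightarrow> real) \<Rightarrow> real \<Rightarrow> bool" where
  "has_data_norm p s D u M \<longleftrightarrow>
     (if s * p \<le> real CARD('n)
      then esssup (lebesgue_on D) (\<lambda>x. ereal \<bar>u x\<bar>) = ereal M
      else gagliardo_power p s D u < \<infinity> \<and> M = enn2real (gagliardo_power p s D u) powr (1 / p))"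

end

theory Submission
  imports Defs
begin

text \<open>
  The bound is De Giorgi's iteration of the truncations \<open>w = (u - k)\<^sub>+\<close>, run directly on the
  minimality inequality.

  \<^item> \<^bold>\<open>Caccioppoli inequality.\<close>  The minimizer is compared with \<open>v = u - \<phi> w\<close>, where
  \<open>\<phi> = \<psi> powr q\<close> and \<open>\<psi>\<close> is a radial cutoff.  For two points near the ball, convexity of
  \<open>z powr p\<close> gains the whole \<open>\<bar>w x - w y\<bar> powr p\<close> on the set where \<open>\<phi> = 1\<close> and costs
  \<open>w powr p\<close> times \<open>\<bar>\<psi> x - \<psi> y\<bar> powr p\<close>, with constant one in front of the energy of \<open>u\<close>, so that
  the two energies cancel by minimality (\<open>cutoff_competitor_local\<close>).  For a near and a far point the
  cost is only \<open>w x\<close> times \<open>u\<^sub>+ y powr (p - 1)\<close>, which integrates to the tail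
  (\<open>cutoff_competitor_nonlocal\<close>).  Both powers \<open>p\<close> and \<open>q\<close> obey the same inequalities, hence so
  does the double phase integrand.  The result is \<open>minimizer_caccioppoli\<close>.

  \<^item> \<^bold>\<open>One growth function.\<close>  On the ball the coefficient exceeds its infimum by at most
  \<open>A (4 r) powr \<alpha>\<close>.  Since \<open>t q \<le> s p + \<alpha>\<close> and \<open>r \<le> 1\<close>, this excess is absorbed by the
  \<open>p\<close>-phase as long as \<open>u\<close> is bounded above by the data (\<open>coefficient_oscillation_absorbed\<close>).
  What remains involves \<open>u\<close> only through \<open>H\<close>, the tail and two seminorms
  (\<open>de_giorgi_class\<close>).

  \<^item> \<^bold>\<open>Gain of smallness.\<close>  If the set \<open>{w > 0}\<close> fills at most
  half of a ball of radius \<open>\<epsilon>\<close>, then at every point \<open>w x\<close> can be averaged against the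
  zeros of \<open>w\<close> within distance \<open>\<epsilon>\<close>, and the integral of \<open>w powr p\<close> is at most a constant
  times \<open>\<epsilon> powr (s p)\<close> times the seminorm (\<open>fractional_faber_krahn\<close>).  With \<open>\<epsilon>\<close> chosen from the
  measure of \<open>{w > 0}\<close>, and that measure controlled by Chebyshev's inequality, the integrals of
  \<open>H w\<close> along increasing levels and shrinking balls satisfy a superlinear recursion
  (\<open>de_giorgi_step\<close>).  The tail \<open>T\<close> is harmless because the final level \<open>k0\<close> is at least
  \<open>\<delta>\<close> times the inverse of \<open>h\<close> at \<open>T\<close>, so that \<open>T\<close> is at most \<open>\<delta> powr (1 - q)\<close> times \<open>h k0\<close>;
  this is where the constant deteriorates as \<open>\<delta>\<close> tends to zero.

  \<^item> \<^bold>\<open>Use of the data.\<close>  In both cases of the data norm there are a number \<open>c\<close>, depending on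
  \<open>u\<close>, and a bound \<open>N\<close>, depending on the data alone, with \<open>\<bar>u - c\<bar> \<le> N\<close> on the ball: for
  \<open>s p \<le> n\<close> trivially, and for \<open>s p > n\<close> by Morrey's argument (\<open>morrey_oscillation_bound\<close>).  If
  \<open>c \<le> 2 N\<close>, then \<open>u \<le> 3 N\<close> and the iteration applies.  Otherwise \<open>u\<close> lies between \<open>c / 2\<close> and
  \<open>3 c / 2\<close>, and its supremum is at most three times its \<open>H\<close>-mean.
\<close>

section \<open>Pointwise effect of cutting off a truncation\<close>

text \<open>
  The end point zero is included because the truncations below vanish on large sets.
\<close>

lemma powr_convex_combination:
  fixes X Y \<theta> p :: real
  assumes "1 \<le> p" "0 \<le> X" "0 \<le> Y" "0 \<le> \<theta>" "\<theta> \<le> 1"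
  shows "((1 - \<theta>) * X + \<theta> * Y) powr p \<le> (1 - \<theta>) * X powr p + \<theta> * Y powr p"
proof -
  have shrink: "(c * Z) powr p \<le> c * Z powr p" if "0 \<le> c" "c \<le> 1" for c Z :: real
  proof -
    have "c powr p \<le> c powr 1"
      using that assms(1) by (intro powr_mono') auto
    then show ?thesis
      using that by (simp add: powr_mult mult_right_mono)
  qed
  consider "X = 0" | "Y = 0" | "0 < X" "0 < Y"
    using assms by fastforce
  then show ?thesis
  proof cases
    case 3
    then have "((1 - \<theta>) *\<^sub>R X + \<theta> *\<^sub>R Y) powr p \<le> (1 - \<theta>) * X powr p + \<theta> * Y powr p"
      using assms by (intro convex_onD[OF powr_convex[OF assms(1)]]) auto
    then show ?thesis by simp
  qed (use shrink[of \<theta> Y] shrink[of "1 - \<theta>" X] assms in auto)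
qed

lemma powr_superadditive:
  fixes X Y p :: real
  assumes "1 \<le> p" "0 \<le> X" "0 \<le> Y"
  shows "X powr p + Y powr p \<le> (X + Y) powr p"
proof -
  have split: "Z powr p = Z * Z powr (p - 1)" if "0 \<le> Z" for Z :: real
    using that powr_mult_base[of Z "p - 1"] by simp
  have "X * X powr (p - 1) + Y * Y powr (p - 1)
      \<le> X * (X + Y) powr (p - 1) + Y * (X + Y) powr (p - 1)"
    using assms by (intro add_mono mult_left_mono powr_mono2) auto
  also have "\<dots> = (X + Y) powr p"
    using assms by (simp add: split algebra_simps)
  finally show ?thesis
    using assms by (simp add: split)
qed

text \<open>
  The mean slope of a convex function on an interval is at most its derivative at the right end
  point.
\<close>

lemma powr_add_le_tangent:
  fixes X Y p :: real
  assumes "1 \<le> p" "0 \<le> X" "0 \<le> Y"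
  shows "(X + Y) powr p \<le> X powr p + p * (X + Y) powr (p - 1) * Y"
proof (cases "X = 0 \<or> Y = 0")
  case True
  have "Y powr p \<le> p * (Y powr (p - 1) * Y)"
    using assms powr_mult_base[of Y "p - 1"] mult_right_mono[of 1 p "Y powr p"]
    by (simp add: mult.commute)
  with True show ?thesis
    using assms by (auto simp: mult.assoc)
next
  case False
  then have pos: "0 < X" "0 < Y" using assms by auto
  obtain z where z: "X < z" "z < X + Y"
      and eq: "(X + Y) powr p - X powr p = (X + Y - X) * (p * z powr (p - 1))"
    using pos by (atomize_elim, intro MVT2) (auto intro!: derivative_eq_intros)
  have "z powr (p - 1) \<le> (X + Y) powr (p - 1)"
    using z pos assms by (intro powr_mono2) auto
  then have "p * z powr (p - 1) * Y \<le> p * (X + Y) powr (p - 1) * Y"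
    using assms by (intro mult_right_mono mult_left_mono) auto
  with eq show ?thesis
    by (simp add: mult_ac)
qed

text \<open>
  The pointwise value of \<open>u - \<phi> (u - k)\<^sub>+\<close>: above the level
  \<open>k\<close> it is the convex combination of \<open>z\<close> and \<open>k\<close> with
  weight \<open>\<phi>\<close> on \<open>k\<close>.
\<close>

definition cutoff_competitor :: "real \<Rightarrow> real \<Rightarrow> real \<Rightarrow> real" where
  "cutoff_competitor k \<phi> z = z - \<phi> * max (z - k) 0"

text \<open>
  If the smaller of the two values is below \<open>k\<close>, the competitor difference is a
  convex combination of \<open>\<bar>ux - uy\<bar>\<close> and the part below \<open>k\<close>,
  and superadditivity of powers gives the gain without any error.  If both are above
  \<open>k\<close>, write the difference as \<open>1 - \<phi>\<close> times the old one plus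
  \<open>\<phi>\<close> times a remainder, with \<open>\<phi>\<close> the larger of the two
  cutoff values.  The remainder contains the difference of the cutoff values divided by
  \<open>\<phi>\<close>; taking \<open>\<phi>\<close> to be an \<open>m\<close>-th power with
  \<open>m \<ge> p\<close> keeps its \<open>p\<close>-th power times \<open>\<phi>\<close>
  bounded.
\<close>

lemma cutoff_competitor_local:
  fixes p m k ux uy \<psi>x \<psi>y :: real
  assumes p: "1 \<le> p" "p \<le> m" and \<psi>: "0 \<le> \<psi>x" "\<psi>x \<le> 1" "0 \<le> \<psi>y" "\<psi>y \<le> 1"
  shows "\<bar>cutoff_competitor k (\<psi>x powr m) ux - cutoff_competitor k (\<psi>y powr m) uy\<bar> powr p
      + min (\<psi>x powr m) (\<psi>y powr m) * \<bar>max (ux - k) 0 - max (uy - k) 0\<bar> powr p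
    \<le> \<bar>ux - uy\<bar> powr p
      + m powr p * ((max (ux - k) 0 powr p + max (uy - k) 0 powr p) * \<bar>\<psi>x - \<psi>y\<bar> powr p)"
  using \<psi>
proof (induction ux uy arbitrary: \<psi>x \<psi>y rule: linorder_wlog)
  case (sym ux uy)
  from sym(1)[of \<psi>y \<psi>x] sym(2-) show ?case
    by (simp add: abs_minus_commute min.commute add.commute)
next
  case (le ux uy)
  define \<phi>x \<phi>y where "\<phi>x = \<psi>x powr m" and "\<phi>y = \<psi>y powr m"
  have \<phi>: "0 \<le> \<phi>x" "\<phi>x \<le> 1" "0 \<le> \<phi>y" "\<phi>y \<le> 1"
    using le p by (auto simp: \<phi>x_def \<phi>y_def powr_le1)
  define E where "E = m powr p * ((max (ux - k) 0 powr p + max (uy - k) 0 powr p) * \<bar>\<psi>x - \<psi>y\<bar> powr p)"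
  have E0: "0 \<le> E" by (simp add: E_def)
  consider "uy \<le> k" | "ux \<le> k" "k < uy" | "k < ux" using le by linarith
  then show ?case
  proof cases
    case 1
    then show ?thesis using le E0 by (simp add: cutoff_competitor_def E_def)
  next
    case 2
    have "\<bar>ux - (uy - \<phi>y * (uy - k))\<bar> = (1 - \<phi>y) * (uy - ux) + \<phi>y * (k - ux)"
    proof -
      have "(1 - \<phi>y) * (uy - ux) + \<phi>y * (k - ux) = uy - \<phi>y * (uy - k) - ux"
        by (simp add: algebra_simps)
      moreover have "0 \<le> (1 - \<phi>y) * (uy - ux) + \<phi>y * (k - ux)"
        using 2 \<phi> by (intro add_nonneg_nonneg mult_nonneg_nonneg) auto
      ultimately show ?thesis by linarith
    qed
    then have 1: "\<bar>ux - (uy - \<phi>y * (uy - k))\<bar> powr p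
        \<le> (1 - \<phi>y) * (uy - ux) powr p + \<phi>y * (k - ux) powr p"
      using 2 \<phi> p powr_convex_combination[of p "uy - ux" "k - ux" \<phi>y] by simp
    have "(k - ux) powr p + (uy - k) powr p \<le> (uy - ux) powr p"
      using powr_superadditive[of p "k - ux" "uy - k"] 2 p by simp
    then have 2: "\<phi>y * (k - ux) powr p + \<phi>y * (uy - k) powr p \<le> \<phi>y * (uy - ux) powr p"
      using \<phi> mult_left_mono by (fastforce simp: distrib_left[symmetric])
    have 3: "min \<phi>x \<phi>y * (uy - k) powr p \<le> \<phi>y * (uy - k) powr p"
      by (intro mult_right_mono) auto
    have "cutoff_competitor k \<phi>x ux - cutoff_competitor k \<phi>y uy = ux - (uy - \<phi>y * (uy - k))"
      "\<bar>max (ux - k) 0 - max (uy - k) 0\<bar> = uy - k" "\<bar>ux - uy\<bar> = uy - ux"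
      using \<open>ux \<le> k\<close> \<open>k < uy\<close> by (auto simp: cutoff_competitor_def)
    moreover have "(1 - \<phi>y) * (uy - ux) powr p = (uy - ux) powr p - \<phi>y * (uy - ux) powr p"
      by (simp add: algebra_simps)
    ultimately show ?thesis
      using 1 2 3 E0 unfolding E_def[symmetric] \<phi>x_def[symmetric] \<phi>y_def[symmetric]
      by simp
  next
    case 3
    have main: "\<bar>(1 - f) * X - (1 - g) * Y\<bar> powr p + g * \<bar>X - Y\<bar> powr p
        \<le> \<bar>X - Y\<bar> powr p + m powr p * (Y powr p * \<bar>a - b\<bar> powr p)"
      if fg: "f = a powr m" "g = b powr m" "0 \<le> b" "b \<le> a" "a \<le> 1" "0 < X" "0 < Y"
      for X Y f g a b :: real
    proof (cases "a = 0")
      case True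
      then show ?thesis using that by simp
    next
      case False
      then have a: "0 < a" "0 < f" using fg by auto
      have f1: "f \<le> 1" "g \<le> f" using fg p by (auto intro: powr_le1 powr_mono2)
      have g0: "0 \<le> g" using fg by simp
      define Z where "Z = Y * (f - g) / f"
      have Z0: "0 \<le> Z" using a f1 that by (simp add: Z_def)
      \<comment> \<open>Convexity is applied with weight \<open>f\<close>, the larger cutoff value, and \<open>Z\<close> is what remains.\<close>
      have eq: "(1 - f) * X - (1 - g) * Y = (1 - f) * (X - Y) - f * Z"
        using a by (simp add: Z_def field_simps)
      have "\<bar>(1 - f) * X - (1 - g) * Y\<bar> \<le> (1 - f) * \<bar>X - Y\<bar> + f * Z"
        unfolding eq using a f1 Z0 abs_triangle_ineq4[of "(1 - f) * (X - Y)" "f * Z"]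
        by (simp add: abs_mult)
      then have "\<bar>(1 - f) * X - (1 - g) * Y\<bar> powr p \<le> ((1 - f) * \<bar>X - Y\<bar> + f * Z) powr p"
        using p by (intro powr_mono2) auto
      also have "\<dots> \<le> (1 - f) * \<bar>X - Y\<bar> powr p + f * Z powr p"
        using p a f1 Z0 by (intro powr_convex_combination) auto
      finally have 1: "\<bar>(1 - f) * X - (1 - g) * Y\<bar> powr p \<le> (1 - f) * \<bar>X - Y\<bar> powr p + f * Z powr p" .
      have "f \<le> g + m * a powr (m - 1) * (a - b)"
        using powr_add_le_tangent[of m b "a - b"] fg p by simp
      then have "(f - g) / f \<le> m * a powr (m - 1) * (a - b) / f"
        using a by (intro divide_right_mono) auto
      also have "\<dots> = m * (a - b) / a"
        using a fg by (simp add: powr_diff field_simps)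
      finally have "Z \<le> Y * (m * (a - b) / a)"
        unfolding Z_def times_divide_eq_right[symmetric] using that by (intro mult_left_mono) auto
      then have "f * Z powr p \<le> f * (Y * (m * (a - b) / a)) powr p"
        using Z0 a p by (intro mult_left_mono powr_mono2) auto
      also have "\<dots> = a powr (m - p) * (m powr p * (Y powr p * \<bar>a - b\<bar> powr p))"
        using that a p by (simp add: powr_mult powr_divide powr_diff)
      also have "\<dots> \<le> 1 * (m powr p * (Y powr p * \<bar>a - b\<bar> powr p))"
        using that a p by (intro mult_right_mono powr_le1) auto
      finally have 2: "f * Z powr p \<le> m powr p * (Y powr p * \<bar>a - b\<bar> powr p)" by simp
      have "g * \<bar>X - Y\<bar> powr p \<le> f * \<bar>X - Y\<bar> powr p"
        using f1 by (intro mult_right_mono) auto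
      with 1 2 show ?thesis by (simp add: algebra_simps)
    qed
    define X Y where "X = ux - k" and "Y = uy - k"
    have XY: "0 < X" "0 < Y" using 3 le by (auto simp: X_def Y_def)
    have id: "cutoff_competitor k \<phi>x ux - cutoff_competitor k \<phi>y uy = (1 - \<phi>x) * X - (1 - \<phi>y) * Y"
      "max (ux - k) 0 = X" "max (uy - k) 0 = Y" "ux - uy = X - Y"
      using XY by (auto simp: cutoff_competitor_def X_def Y_def max_def algebra_simps)
    have ge: "m powr p * (Y powr p * \<bar>\<psi>x - \<psi>y\<bar> powr p) \<le> m powr p * ((X powr p + Y powr p) * \<bar>\<psi>x - \<psi>y\<bar> powr p)"
      "m powr p * (X powr p * \<bar>\<psi>x - \<psi>y\<bar> powr p) \<le> m powr p * ((X powr p + Y powr p) * \<bar>\<psi>x - \<psi>y\<bar> powr p)"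
      by (auto intro!: mult_left_mono mult_right_mono)
    show ?thesis
    proof (cases "\<psi>y \<le> \<psi>x")
      case True
      then have "min \<phi>x \<phi>y = \<phi>y"
        using le p by (simp add: \<phi>x_def \<phi>y_def powr_mono2)
      then show ?thesis
        using main[OF \<phi>x_def \<phi>y_def, of X Y] True XY ge le
        unfolding \<phi>x_def[symmetric] \<phi>y_def[symmetric] id by simp
    next
      case False
      then have "min \<phi>x \<phi>y = \<phi>x"
        using le p by (simp add: \<phi>x_def \<phi>y_def powr_mono2)
      then show ?thesis
        using main[OF \<phi>y_def \<phi>x_def, of Y X] False XY ge le
        unfolding \<phi>x_def[symmetric] \<phi>y_def[symmetric] id
        by (simp add: abs_minus_commute)
    qed
  qed
qed

text \<open>
  The far point carries no cutoff and \<open>uy\<close> may be huge, with only its power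
  \<open>p - 1\<close> integrable.  The increase is therefore estimated to first order in the
  amount \<open>\<phi> (ux - k)\<^sub>+\<close> by which \<open>ux\<close> is lowered; lowering
  \<open>ux\<close> costs something only if \<open>uy\<close> exceeds the lowered value.
\<close>

lemma cutoff_competitor_nonlocal:
  fixes p k ux uy \<phi> :: real
  assumes p: "1 \<le> p" and \<phi>: "0 \<le> \<phi>" "\<phi> \<le> 1"
  shows "\<bar>cutoff_competitor k \<phi> ux - uy\<bar> powr p
    \<le> \<bar>ux - uy\<bar> powr p + p * (max (uy - k) 0 powr (p - 1) * (\<phi> * max (ux - k) 0))"
proof -
  define b where "b = \<phi> * max (ux - k) 0"
  have b0: "0 \<le> b" using \<phi> by (simp add: b_def)
  have bX: "b \<le> max (ux - k) 0" using \<phi> mult_right_mono[of \<phi> 1 "max (ux - k) 0"] by (simp add: b_def)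
  have err0: "0 \<le> p * (max (uy - k) 0 powr (p - 1) * b)" using p b0 by simp
  have mono: ?thesis if "\<bar>ux - b - uy\<bar> \<le> \<bar>ux - uy\<bar>"
  proof -
    have "\<bar>ux - b - uy\<bar> powr p \<le> \<bar>ux - uy\<bar> powr p" using that p by (intro powr_mono2) auto
    with err0 show ?thesis unfolding cutoff_competitor_def b_def[symmetric] by simp
  qed
  consider "ux \<le> k" | "k < ux" "uy \<le> ux - b" | "k < ux" "ux - b < uy" "uy \<le> ux" | "k < ux" "ux < uy"
    by linarith
  then show ?thesis
  proof cases
    case 1
    then show ?thesis by (simp add: cutoff_competitor_def)
  next
    case 2
    then show ?thesis using b0 by (intro mono) auto
  next
    case 3
    have d: "\<bar>ux - b - uy\<bar> = uy - (ux - b)" using 3 by simp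
    have "(uy - (ux - b)) powr p = (uy - (ux - b)) powr (p - 1) * (uy - (ux - b))"
      using 3 powr_mult_base[of "uy - (ux - b)" "p - 1"] by (simp add: mult.commute)
    also have "\<dots> \<le> max (uy - k) 0 powr (p - 1) * b"
      using 3 bX b0 p by (intro mult_mono powr_mono2) auto
    also have "\<dots> \<le> p * (max (uy - k) 0 powr (p - 1) * b)"
      using p b0 mult_right_mono[of 1 p "max (uy - k) 0 powr (p - 1) * b"] by simp
    finally show ?thesis
      unfolding cutoff_competitor_def b_def[symmetric] d
      by (simp add: add_increasing)
  next
    case 4
    have d: "\<bar>ux - b - uy\<bar> = (uy - ux) + b" using 4 b0 by simp
    have "((uy - ux) + b) powr p \<le> (uy - ux) powr p + p * ((uy - ux) + b) powr (p - 1) * b"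
      using 4 p b0 by (intro powr_add_le_tangent) auto
    also have "\<dots> \<le> (uy - ux) powr p + p * max (uy - k) 0 powr (p - 1) * b"
      using 4 p b0 bX by (intro add_left_mono mult_right_mono mult_left_mono powr_mono2) auto
    finally show ?thesis
      unfolding cutoff_competitor_def b_def[symmetric] d using 4 by (simp add: mult_ac)
  qed
qed

section \<open>Integration tools and a Faber--Krahn inequality\<close>

lemma nn_integral_lborel_iterated:
  fixes f :: "'a::euclidean_space \<times> 'b::euclidean_space \<Rightarrow> ennreal"
  assumes "f \<in> borel_measurable borel"
  shows "(\<integral>\<^sup>+ z. f z \<partial>lborel) = (\<integral>\<^sup>+ x. \<integral>\<^sup>+ y. f (x, y) \<partial>lborel \<partial>lborel)"
proof -
  have "f \<in> borel_measurable (lborel \<Otimes>\<^sub>M lborel)"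
    using assms by (simp add: lborel_prod)
  from lborel.nn_integral_fst[OF this] show ?thesis
    by (simp add: lborel_prod)
qed

lemma nn_integral_lborel_swap:
  fixes f :: "'a::euclidean_space \<Rightarrow> 'b::euclidean_space \<Rightarrow> ennreal"
  assumes "case_prod f \<in> borel_measurable borel"
  shows "(\<integral>\<^sup>+ x. \<integral>\<^sup>+ y. f x y \<partial>lborel \<partial>lborel) = (\<integral>\<^sup>+ y. \<integral>\<^sup>+ x. f x y \<partial>lborel \<partial>lborel)"
proof -
  have "case_prod f \<in> borel_measurable (lborel \<Otimes>\<^sub>M lborel)"
    using assms by (simp add: lborel_prod)
  from lborel_pair.Fubini'[OF this] show ?thesis by simp
qed

lemma nn_integral_lebesgue_on:
  assumes "S \<in> sets lebesgue"
  shows "(\<integral>\<^sup>+ x. f x \<partial>lebesgue_on S) = (\<integral>\<^sup>+ x\<in>S. f x \<partial>lborel)"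
  using assms by (subst nn_integral_restrict_space) (auto simp: nn_integral_completion)

lemma emeasure_lborel_ball_cart:
  fixes x :: "real ^ 'n"
  assumes "0 \<le> r"
  shows "emeasure lborel (ball x r) = ennreal (unit_ball_vol (real CARD('n)) * r ^ CARD('n))"
  using emeasure_ball[OF assms, of x] by simp

lemma gagliardo_power_iterated:
  fixes u :: "real ^ 'n \<Rightarrow> real"
  assumes [measurable]: "u \<in> borel_measurable borel" "D \<in> sets borel"
  shows "gagliardo_power p s D u =
    (\<integral>\<^sup>+ x\<in>D. (\<integral>\<^sup>+ y\<in>D. ennreal (\<bar>u x - u y\<bar> powr p / norm (x - y) powr (real CARD('n) + s * p))
       \<partial>lborel) \<partial>lborel)"
proof -
  have [measurable]: "D \<times> D \<in> sets borel"
    by (simp add: borel_prod[symmetric])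
  have "gagliardo_power p s D u =
      (\<integral>\<^sup>+ (x, y). ennreal (\<bar>u x - u y\<bar> powr p / norm (x - y) powr (real CARD('n) + s * p))
         * indicator D y * indicator D x \<partial>lborel)"
    unfolding gagliardo_power_def
    by (subst nn_integral_lebesgue_on)
       (auto simp: split_beta indicator_times mult_ac intro!: nn_integral_cong)
  also have "\<dots> = (\<integral>\<^sup>+ x. \<integral>\<^sup>+ y. ennreal (\<bar>u x - u y\<bar> powr p / norm (x - y) powr (real CARD('n) + s * p))
         * indicator D y * indicator D x \<partial>lborel \<partial>lborel)"
    by (subst nn_integral_lborel_iterated) (auto simp: borel_prod[symmetric] split_beta)
  also have "\<dots> = (\<integral>\<^sup>+ x\<in>D. (\<integral>\<^sup>+ y\<in>D. ennreal (\<bar>u x - u y\<bar> powr p / norm (x - y) powr (real CARD('n) + s * p))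
       \<partial>lborel) \<partial>lborel)"
    by (intro nn_integral_cong nn_integral_multc) measurable
  finally show ?thesis .
qed

lemma dyadic_shell:
  fixes d R :: real
  assumes "0 < d" "d < R"
  obtains i where "R * (1/2) ^ Suc i \<le> d" "d < R * (1/2) ^ i"
proof -
  have "\<exists>i. R * (1/2) ^ Suc i \<le> d"
  proof -
    obtain i where "(1/2::real) ^ i < d / R"
      using real_arch_pow_inv[of "d / R" "1/2"] assms by auto
    then have "(1/2::real) ^ Suc i < d / R" using assms
      by (smt (verit) power_Suc zero_less_power mult_less_cancel_right1 divide_pos_pos field_sum_of_halves half_gt_zero)
    then show ?thesis using assms by (intro exI[of _ i]) (simp add: field_simps)
  qed
  define i where "i = (LEAST i. R * (1/2) ^ Suc i \<le> d)"
  have 1: "R * (1/2) ^ Suc i \<le> d"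
    unfolding i_def by (rule LeastI_ex) fact
  have "d < R * (1/2) ^ i"
  proof (cases i)
    case (Suc j)
    then have "\<not> R * (1/2) ^ Suc j \<le> d"
      unfolding i_def by (metis lessI not_less_Least)
    then show ?thesis using Suc by simp
  qed (use assms in auto)
  with 1 show thesis by (rule that)
qed

text \<open>
  Sum over dyadic shells: on the shell of radius \<open>R / 2 ^ i\<close> the kernel is
  comparable to the power of that radius, and multiplied by the volume this gives a geometric
  series of ratio \<open>(1 / 2) powr \<gamma>\<close>.
\<close>

lemma riesz_kernel_ball_bound:
  fixes \<gamma> :: real
  assumes \<gamma>: "0 < \<gamma>"
  shows "\<exists>C>0. \<forall>(x :: real ^ 'n) R. 0 < R \<longrightarrow>
    (\<integral>\<^sup>+ y\<in>ball x R. ennreal (norm (x - y) powr (\<gamma> - real CARD('n))) \<partial>lborel) \<le> ennreal (C * R powr \<gamma>)"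
proof -
  define \<omega> where "\<omega> = unit_ball_vol (real CARD('n))"
  define c :: real where "c = 2 powr \<bar>\<gamma> - real CARD('n)\<bar>"
  define \<theta> :: real where "\<theta> = (1/2) powr \<gamma>"
  have \<omega>: "0 < \<omega>" by (simp add: \<omega>_def)
  have \<theta>: "0 < \<theta>" "\<theta> < 1"
    using \<gamma> powr_less_mono2[of \<gamma> "1/2" 1] by (auto simp: \<theta>_def)
  have c: "0 < c" by (simp add: c_def)
  show ?thesis
  proof (intro exI conjI allI impI)
    show "0 < c * \<omega> / (1 - \<theta>)" using c \<omega> \<theta> by simp
    fix x :: "real ^ 'n" and R :: real
    assume R: "0 < R"
    define \<rho> where "\<rho> i = R * (1/2) ^ i" for i :: nat
    have \<rho>: "0 < \<rho> i" for i using R by (simp add: \<rho>_def)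
    \<comment> \<open>The factor \<open>c\<close> makes \<open>b i\<close> an upper bound of the kernel on the shell for either sign of the exponent.\<close>
    define b where "b i = c * \<rho> i powr (\<gamma> - real CARD('n))" for i
    have b: "0 \<le> b i" for i using c by (simp add: b_def)
    have pw: "ennreal (norm (x - y) powr (\<gamma> - real CARD('n))) * indicator (ball x R) y
        \<le> (\<Sum>i. ennreal (b i) * indicator (ball x (\<rho> i)) y)" for y
    proof (cases "y = x \<or> y \<notin> ball x R")
      case False
      then have d: "0 < dist x y" "dist x y < R" by auto
      obtain i where i: "R * (1/2) ^ Suc i \<le> dist x y" "dist x y < R * (1/2) ^ i"
        using dyadic_shell[OF d] by blast
      then have i: "\<rho> i / 2 \<le> dist x y" "dist x y < \<rho> i" by (auto simp: \<rho>_def)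
      have "dist x y powr (\<gamma> - real CARD('n)) \<le> b i"
      proof (cases "0 \<le> \<gamma> - real CARD('n)")
        case True
        then have "dist x y powr (\<gamma> - real CARD('n)) \<le> \<rho> i powr (\<gamma> - real CARD('n))"
          using i by (intro powr_mono2) auto
        also have "\<dots> \<le> b i"
          unfolding b_def c_def
          using mult_right_mono[of 1 "2 powr \<bar>\<gamma> - real CARD('n)\<bar>" "\<rho> i powr (\<gamma> - real CARD('n))"]
          by (simp add: ge_one_powr_ge_zero)
        finally show ?thesis .
      next
        case False
        then have "dist x y powr (\<gamma> - real CARD('n)) \<le> (\<rho> i / 2) powr (\<gamma> - real CARD('n))"
          using i \<rho>[of i] by (intro powr_mono2') auto
        also have "\<dots> = b i"
          using False \<rho>[of i] by (simp add: b_def c_def powr_divide powr_diff)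
        finally show ?thesis .
      qed
      then have "ennreal (norm (x - y) powr (\<gamma> - real CARD('n))) * indicator (ball x R) y
          \<le> ennreal (b i) * indicator (ball x (\<rho> i)) y"
        using d i by (simp add: dist_norm ennreal_leI)
      also have "\<dots> \<le> (\<Sum>i. ennreal (b i) * indicator (ball x (\<rho> i)) y)"
      proof -
        define f where "f j = ennreal (b j) * indicator (ball x (\<rho> j)) y" for j
        have "sum f {i} \<le> suminf f" by (rule sum_le_suminf) auto
        then show ?thesis unfolding f_def[symmetric] by simp
      qed
      finally show ?thesis .
    qed auto
    have shell: "b i * (\<omega> * \<rho> i ^ CARD('n)) = c * \<omega> * R powr \<gamma> * \<theta> ^ i" for i
    proof -
      have "\<rho> i powr (\<gamma> - real CARD('n)) * \<rho> i ^ CARD('n) = \<rho> i powr \<gamma>"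
        using \<rho>[of i] by (simp add: powr_diff powr_realpow)
      also have "\<dots> = R powr \<gamma> * \<theta> ^ i"
        using R by (simp add: \<rho>_def \<theta>_def powr_mult powr_realpow[symmetric] powr_powr mult.commute)
      finally show ?thesis by (simp add: b_def mult_ac)
    qed
    have "(\<integral>\<^sup>+ y\<in>ball x R. ennreal (norm (x - y) powr (\<gamma> - real CARD('n))) \<partial>lborel)
        \<le> (\<integral>\<^sup>+ y. (\<Sum>i. ennreal (b i) * indicator (ball x (\<rho> i)) y) \<partial>lborel)"
      by (intro nn_integral_mono pw)
    also have "\<dots> = (\<Sum>i. \<integral>\<^sup>+ y. ennreal (b i) * indicator (ball x (\<rho> i)) y \<partial>lborel)"
      by (intro nn_integral_suminf borel_measurable_times_ennreal borel_measurable_indicator) auto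
    also have "\<dots> = (\<Sum>i. ennreal (c * \<omega> * R powr \<gamma> * \<theta> ^ i))"
    proof (intro suminf_cong)
      fix i
      have "(\<integral>\<^sup>+ y. ennreal (b i) * indicator (ball x (\<rho> i)) y \<partial>lborel)
          = ennreal (b i) * ennreal (\<omega> * \<rho> i ^ CARD('n))"
        using \<rho>[of i] unfolding \<omega>_def
        by (subst nn_integral_cmult_indicator) (simp_all add: emeasure_lborel_ball_cart)
      also have "\<dots> = ennreal (b i * (\<omega> * \<rho> i ^ CARD('n)))"
        using b \<omega> \<rho>[of i] by (intro ennreal_mult[symmetric]) auto
      finally show "(\<integral>\<^sup>+ y. ennreal (b i) * indicator (ball x (\<rho> i)) y \<partial>lborel)
          = ennreal (c * \<omega> * R powr \<gamma> * \<theta> ^ i)"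
        unfolding shell .
    qed
    also have "\<dots> = ennreal (c * \<omega> * R powr \<gamma> * (1 / (1 - \<theta>)))"
      using \<theta> c \<omega> by (intro suminf_ennreal_eq sums_mult geometric_sums) auto
    finally show "(\<integral>\<^sup>+ y\<in>ball x R. ennreal (norm (x - y) powr (\<gamma> - real CARD('n))) \<partial>lborel)
        \<le> ennreal (c * \<omega> / (1 - \<theta>) * R powr \<gamma>)"
      by (simp add: field_simps)
  qed
qed

text \<open>
  For \<open>x\<close> in the inner ball, at least half of \<open>ball x \<epsilon>\<close>
  consists of zeros \<open>y\<close> of \<open>w\<close>, where \<open>w x = \<bar>w x - w
  y\<bar>\<close> and \<open>norm (x - y) \<le> \<epsilon>\<close>.  Averaging over these
  \<open>y\<close> bounds \<open>w x powr p\<close> by the inner integral of the seminorm.  In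
  the iteration this estimate plays the part of a Sobolev inequality.
\<close>

lemma fractional_faber_krahn:
  fixes w :: "real ^ 'n \<Rightarrow> real"
  assumes [measurable]: "w \<in> borel_measurable borel"
    and w0: "\<And>x. 0 \<le> w x" and p: "0 < p" and s: "0 < s" and \<epsilon>: "0 < \<epsilon>"
    and small: "2 * emeasure lborel {y \<in> ball x0 (\<rho> + \<epsilon>). 0 < w y}
      \<le> ennreal (unit_ball_vol (real CARD('n)) * \<epsilon> ^ CARD('n))"
  shows "(\<integral>\<^sup>+ x\<in>ball x0 \<rho>. ennreal (w x powr p) \<partial>lborel)
    \<le> ennreal (2 / unit_ball_vol (real CARD('n)) * \<epsilon> powr (s * p)) * gagliardo_power p s (ball x0 (\<rho> + \<epsilon>)) w"
proof -
  define \<omega> where "\<omega> = unit_ball_vol (real CARD('n))"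
  have \<omega>: "0 < \<omega>" by (simp add: \<omega>_def)
  define B where "B = ball x0 (\<rho> + \<epsilon>)"
  have [measurable]: "B \<in> sets borel" by (simp add: B_def)
  define k where "k x y = \<bar>w x - w y\<bar> powr p / norm (x - y) powr (real CARD('n) + s * p)" for x y
  have [measurable]: "(\<lambda>z. k (fst z) (snd z)) \<in> borel_measurable (borel \<Otimes>\<^sub>M borel)"
    unfolding k_def by measurable
  have [measurable]: "(\<lambda>y. k x y) \<in> borel_measurable borel" for x
    unfolding k_def by measurable
  have k0: "0 \<le> k x y" for x y by (simp add: k_def)
  have pw: "ennreal (w x powr p) \<le> ennreal (2 / \<omega> * \<epsilon> powr (s * p)) * (\<integral>\<^sup>+ y\<in>B. ennreal (k x y) \<partial>lborel)"
    if x: "x \<in> ball x0 \<rho>" for x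
  proof -
    define A where "A = {y \<in> ball x \<epsilon>. w y = 0}"
    have [measurable]: "A \<in> sets borel" by (simp add: A_def)
    have sub: "ball x \<epsilon> \<subseteq> B"
      using x unfolding B_def by (intro subsetI) (smt (verit) dist_triangle mem_ball)
    define mA where "mA = measure lborel A"
    have finA: "emeasure lborel A = ennreal mA"
    proof -
      have "emeasure lborel A \<le> emeasure lborel (ball x \<epsilon>)"
        by (intro emeasure_mono) (auto simp: A_def)
      then show ?thesis
        unfolding mA_def
        by (intro emeasure_eq_ennreal_measure) (auto simp: emeasure_lborel_ball_cart less_imp_le[OF \<epsilon>] top_unique)
    qed
    have finP: "emeasure lborel {y \<in> B. 0 < w y} \<noteq> \<infinity>"
      using small by (auto simp: B_def top_unique ennreal_mult_eq_top_iff)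
    then have eP: "emeasure lborel {y \<in> B. 0 < w y} = ennreal (measure lborel {y \<in> B. 0 < w y})"
      by (intro emeasure_eq_ennreal_measure) auto
    have smallP: "2 * measure lborel {y \<in> B. 0 < w y} \<le> \<omega> * \<epsilon> ^ CARD('n)"
    proof -
      have "ennreal (2 * measure lborel {y \<in> B. 0 < w y}) \<le> ennreal (\<omega> * \<epsilon> ^ CARD('n))"
        using small unfolding B_def[symmetric] eP by (simp add: ennreal_mult \<omega>_def)
      then show ?thesis using \<omega> \<epsilon> by (simp add: ennreal_le_iff)
    qed
    have "emeasure lborel (ball x \<epsilon>) \<le> emeasure lborel (A \<union> {y \<in> B. 0 < w y})"
      using sub w0 by (intro emeasure_mono) (auto simp: A_def less_le)
    also have "\<dots> \<le> emeasure lborel A + emeasure lborel {y \<in> B. 0 < w y}"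
      by (intro emeasure_subadditive) auto
    finally have "ennreal (\<omega> * \<epsilon> ^ CARD('n)) \<le> ennreal (mA + measure lborel {y \<in> B. 0 < w y})"
      unfolding finA eP using \<epsilon> by (simp add: emeasure_lborel_ball_cart ennreal_plus mA_def \<omega>_def)
    then have "\<omega> * \<epsilon> ^ CARD('n) \<le> mA + measure lborel {y \<in> B. 0 < w y}"
      by (subst (asm) ennreal_le_iff) (auto simp: mA_def)
    with smallP have mA: "\<omega> * \<epsilon> ^ CARD('n) / 2 \<le> mA" by simp
    have "ennreal (w x powr p) * ennreal mA = (\<integral>\<^sup>+ y. ennreal (w x powr p) * indicator A y \<partial>lborel)"
      by (simp add: nn_integral_cmult_indicator finA)
    also have "\<dots> \<le> (\<integral>\<^sup>+ y. ennreal (\<epsilon> powr (real CARD('n) + s * p)) * (ennreal (k x y) * indicator B y) \<partial>lborel)"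
    proof (intro nn_integral_mono)
      fix y
      show "ennreal (w x powr p) * indicator A y
          \<le> ennreal (\<epsilon> powr (real CARD('n) + s * p)) * (ennreal (k x y) * indicator B y)"
      proof (cases "y \<in> A \<and> y \<noteq> x")
        case True
        then have y: "y \<in> B" "w y = 0" "dist x y \<le> \<epsilon>" "0 < norm (x - y)" using sub by (auto simp: A_def)
        have "norm (x - y) powr (real CARD('n) + s * p) \<le> \<epsilon> powr (real CARD('n) + s * p)"
          using y s p by (intro powr_mono2) (auto simp: dist_norm)
        then have "w x powr p * norm (x - y) powr (real CARD('n) + s * p)
            \<le> w x powr p * \<epsilon> powr (real CARD('n) + s * p)"
          by (intro mult_left_mono) auto
        then have "w x powr p \<le> \<epsilon> powr (real CARD('n) + s * p) * k x y"
          using y w0[of x] by (simp add: k_def field_simps)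
        then show ?thesis
          using True y by (simp add: ennreal_mult[symmetric] k0 ennreal_leI)
      next
        case False
        then show ?thesis using p by (cases "y \<in> A") (auto simp: A_def)
      qed
    qed
    also have "\<dots> = ennreal (\<epsilon> powr (real CARD('n) + s * p)) * (\<integral>\<^sup>+ y\<in>B. ennreal (k x y) \<partial>lborel)"
      by (intro nn_integral_cmult) measurable
    finally have 1: "ennreal (w x powr p) * ennreal mA
        \<le> ennreal (\<epsilon> powr (real CARD('n) + s * p)) * (\<integral>\<^sup>+ y\<in>B. ennreal (k x y) \<partial>lborel)" .
    have "2 / (\<omega> * \<epsilon> ^ CARD('n)) * mA \<ge> 1"
      using mA \<omega> \<epsilon> by (simp add: field_simps)
    then have "ennreal (w x powr p) \<le> ennreal (2 / (\<omega> * \<epsilon> ^ CARD('n)) * mA * w x powr p)"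
      using mult_right_mono[of 1 "2 / (\<omega> * \<epsilon> ^ CARD('n)) * mA" "w x powr p"] by (intro ennreal_leI) simp
    also have "\<dots> = ennreal (2 / (\<omega> * \<epsilon> ^ CARD('n))) * (ennreal (w x powr p) * ennreal mA)"
      using \<omega> \<epsilon> by (simp add: ennreal_mult[symmetric] mA_def mult_ac)
    also have "\<dots> \<le> ennreal (2 / (\<omega> * \<epsilon> ^ CARD('n))) *
        (ennreal (\<epsilon> powr (real CARD('n) + s * p)) * (\<integral>\<^sup>+ y\<in>B. ennreal (k x y) \<partial>lborel))"
      by (intro mult_left_mono 1) auto
    also have "\<dots> = ennreal (2 / (\<omega> * \<epsilon> ^ CARD('n)) * \<epsilon> powr (real CARD('n) + s * p)) * (\<integral>\<^sup>+ y\<in>B. ennreal (k x y) \<partial>lborel)"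
      using \<omega> \<epsilon> by (subst ennreal_mult) (auto simp: mult_ac)
    also have "2 / (\<omega> * \<epsilon> ^ CARD('n)) * \<epsilon> powr (real CARD('n) + s * p) = 2 / \<omega> * \<epsilon> powr (s * p)"
      using \<omega> \<epsilon> by (simp add: powr_add powr_realpow field_simps)
    finally show ?thesis .
  qed
  have "(\<integral>\<^sup>+ x\<in>ball x0 \<rho>. ennreal (w x powr p) \<partial>lborel)
      \<le> (\<integral>\<^sup>+ x. ennreal (2 / \<omega> * \<epsilon> powr (s * p)) * ((\<integral>\<^sup>+ y\<in>B. ennreal (k x y) \<partial>lborel) * indicator B x) \<partial>lborel)"
  proof (intro nn_integral_mono)
    fix x
    show "ennreal (w x powr p) * indicator (ball x0 \<rho>) x
      \<le> ennreal (2 / \<omega> * \<epsilon> powr (s * p)) * ((\<integral>\<^sup>+ y\<in>B. ennreal (k x y) \<partial>lborel) * indicator B x)"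
      using pw[of x] \<epsilon> by (auto simp: B_def indicator_def)
  qed
  also have "\<dots> = ennreal (2 / \<omega> * \<epsilon> powr (s * p)) * gagliardo_power p s B w"
    unfolding gagliardo_power_iterated[OF \<open>w \<in> _\<close> \<open>B \<in> _\<close>]
    by (simp add: k_def nn_integral_cmult)
  finally show ?thesis by (simp add: B_def \<omega>_def)
qed

section \<open>Oscillation in the supercritical case\<close>

text \<open>
  The oscillation is split at the threshold \<open>\<epsilon>\<close>: either \<open>\<bar>u z -
  u y\<bar> \<le> \<epsilon>\<close>, or it is at most \<open>\<epsilon> powr (1 - p)\<close>
  times its \<open>p\<close>-th power.
\<close>

lemma ball_oscillation_integral:
  fixes u :: "real ^ 'n \<Rightarrow> real"
  assumes [measurable]: "u \<in> borel_measurable borel" "D \<in> sets borel" "D' \<in> sets borel" "B \<in> sets borel"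
    and sub: "D \<subseteq> B" "D' \<subseteq> B"
    and meas: "emeasure lborel D = ennreal m" "emeasure lborel D' = ennreal m'" "0 \<le> m" "0 \<le> m'"
    and dist: "\<And>y z. y \<in> D \<Longrightarrow> z \<in> D' \<Longrightarrow> norm (z - y) \<le> d"
    and p: "1 \<le> p" and s: "0 < s" and \<epsilon>: "0 < \<epsilon>"
    and Q: "gagliardo_power p s B u \<le> ennreal Q" "0 \<le> Q"
  shows "(\<integral>\<^sup>+ z\<in>D'. (\<integral>\<^sup>+ y\<in>D. ennreal \<bar>u z - u y\<bar> \<partial>lborel) \<partial>lborel)
    \<le> ennreal (\<epsilon> * m * m' + \<epsilon> powr (1 - p) * d powr (real CARD('n) + s * p) * Q)"
proof -
  define k where "k z y = \<bar>u z - u y\<bar> powr p / norm (z - y) powr (real CARD('n) + s * p)" for z y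
  have [measurable]: "(\<lambda>z. k (fst z) (snd z)) \<in> borel_measurable (borel \<Otimes>\<^sub>M borel)"
    "(\<lambda>y. k z y) \<in> borel_measurable borel" for z
    unfolding k_def by measurable
  have k0: "0 \<le> k z y" for z y by (simp add: k_def)
  define b where "b = \<epsilon> powr (1 - p) * d powr (real CARD('n) + s * p)"
  have b0: "0 \<le> b" by (simp add: b_def)
  have pw: "\<bar>u z - u y\<bar> \<le> \<epsilon> + b * k z y" if "y \<in> D" "z \<in> D'" for y z
  proof (cases "\<bar>u z - u y\<bar> \<le> \<epsilon>")
    case False
    then have ne: "y \<noteq> z" "\<epsilon> < \<bar>u z - u y\<bar>" using \<epsilon> by auto
    define h where "h = \<bar>u z - u y\<bar>"
    have h: "\<epsilon> < h" "0 < h" using ne \<epsilon> by (auto simp: h_def)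
    have "h powr (1 - p) \<le> \<epsilon> powr (1 - p)"
      using h \<epsilon> p by (intro powr_mono2') auto
    then have "h powr (1 - p) * h powr p \<le> \<epsilon> powr (1 - p) * h powr p"
      by (intro mult_right_mono) auto
    then have 1: "h \<le> \<epsilon> powr (1 - p) * h powr p"
      using h by (simp add: powr_add[symmetric])
    have "norm (z - y) powr (real CARD('n) + s * p) \<le> d powr (real CARD('n) + s * p)"
      using dist[OF that] s p by (intro powr_mono2) auto
    then have "h powr p * norm (z - y) powr (real CARD('n) + s * p)
        \<le> h powr p * d powr (real CARD('n) + s * p)"
      by (intro mult_left_mono) auto
    then have "h powr p \<le> d powr (real CARD('n) + s * p) * k z y"
      using ne by (simp add: k_def h_def field_simps)
    then have "\<epsilon> powr (1 - p) * h powr p \<le> b * k z y"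
      unfolding b_def mult.assoc by (intro mult_left_mono) auto
    with 1 \<epsilon> show ?thesis unfolding h_def by linarith
  qed (use b0 k0[of z y] \<epsilon> in \<open>simp add: add_increasing2\<close>)
  have "(\<integral>\<^sup>+ z\<in>D'. (\<integral>\<^sup>+ y\<in>D. ennreal \<bar>u z - u y\<bar> \<partial>lborel) \<partial>lborel)
    \<le> (\<integral>\<^sup>+ z. (\<integral>\<^sup>+ y. ennreal \<epsilon> * indicator D y + ennreal b * (ennreal (k z y) * indicator B y) \<partial>lborel) * indicator D' z \<partial>lborel)"
  proof (intro nn_integral_mono)
    fix z
    show "(\<integral>\<^sup>+ y\<in>D. ennreal \<bar>u z - u y\<bar> \<partial>lborel) * indicator D' z
      \<le> (\<integral>\<^sup>+ y. ennreal \<epsilon> * indicator D y + ennreal b * (ennreal (k z y) * indicator B y) \<partial>lborel) * indicator D' z"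
    proof (cases "z \<in> D'")
      case True
      have "(\<integral>\<^sup>+ y\<in>D. ennreal \<bar>u z - u y\<bar> \<partial>lborel)
        \<le> (\<integral>\<^sup>+ y. ennreal \<epsilon> * indicator D y + ennreal b * (ennreal (k z y) * indicator B y) \<partial>lborel)"
      proof (intro nn_integral_mono)
        fix y
        show "ennreal \<bar>u z - u y\<bar> * indicator D y
          \<le> ennreal \<epsilon> * indicator D y + ennreal b * (ennreal (k z y) * indicator B y)"
        proof (cases "y \<in> D")
          case yD: True
          have "ennreal \<bar>u z - u y\<bar> \<le> ennreal (\<epsilon> + b * k z y)"
            by (intro ennreal_leI pw yD True)
          also have "\<dots> = ennreal \<epsilon> + ennreal b * ennreal (k z y)"
            using \<epsilon> b0 k0[of z y] by (simp add: ennreal_mult)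
          finally show ?thesis using yD sub by auto
        qed simp
      qed
      then show ?thesis using True by simp
    qed simp
  qed
  also have "\<dots> = (\<integral>\<^sup>+ z. ennreal (\<epsilon> * m) * indicator D' z
      + ennreal b * ((\<integral>\<^sup>+ y\<in>B. ennreal (k z y) \<partial>lborel) * indicator D' z) \<partial>lborel)"
    using \<epsilon> meas by (simp add: nn_integral_add nn_integral_cmult nn_integral_cmult_indicator
        ennreal_mult distrib_right mult.assoc)
  also have "\<dots> \<le> (\<integral>\<^sup>+ z. ennreal (\<epsilon> * m) * indicator D' z
      + ennreal b * ((\<integral>\<^sup>+ y\<in>B. ennreal (k z y) \<partial>lborel) * indicator B z) \<partial>lborel)"
    using sub by (intro nn_integral_mono add_left_mono mult_left_mono) (auto simp: indicator_def)
  also have "\<dots> = ennreal (\<epsilon> * m) * ennreal m' + ennreal b * gagliardo_power p s B u"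
    unfolding gagliardo_power_iterated[OF \<open>u \<in> _\<close> \<open>B \<in> _\<close>] k_def[symmetric]
    using meas by (simp add: nn_integral_add nn_integral_cmult nn_integral_cmult_indicator)
  also have "\<dots> \<le> ennreal (\<epsilon> * m) * ennreal m' + ennreal b * ennreal Q"
    using Q by (intro add_left_mono mult_left_mono) auto
  also have "\<dots> = ennreal (\<epsilon> * m * m' + b * Q)"
    using \<epsilon> meas b0 Q by (simp add: ennreal_mult ennreal_plus)
  finally show ?thesis by (simp add: b_def)
qed

text \<open>
  Passes a bound for the mean distance of \<open>u\<close> from \<open>c\<close> from one set to
  another, at the cost of the mean oscillation between the two.
\<close>

lemma average_distance_transfer:
  fixes u :: "real ^ 'n \<Rightarrow> real"
  assumes [measurable]: "u \<in> borel_measurable borel" "D \<in> sets borel" "D' \<in> sets borel"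
    and meas: "emeasure lborel D = ennreal m" "emeasure lborel D' = ennreal m'" "0 < m" "0 < m'"
    and avg: "(\<integral>\<^sup>+ y\<in>D. ennreal \<bar>u y - c\<bar> \<partial>lborel) \<le> ennreal (m * K)" "0 \<le> K"
    and osc: "(\<integral>\<^sup>+ z\<in>D'. (\<integral>\<^sup>+ y\<in>D. ennreal \<bar>u z - u y\<bar> \<partial>lborel) \<partial>lborel) \<le> ennreal (m * m' * \<eta>)" "0 \<le> \<eta>"
  shows "(\<integral>\<^sup>+ z\<in>D'. ennreal \<bar>u z - c\<bar> \<partial>lborel) \<le> ennreal (m' * (K + \<eta>))"
proof -
  have "ennreal m * (\<integral>\<^sup>+ z\<in>D'. ennreal \<bar>u z - c\<bar> \<partial>lborel)
    = (\<integral>\<^sup>+ z. (\<integral>\<^sup>+ y. ennreal \<bar>u z - c\<bar> * indicator D y \<partial>lborel) * indicator D' z \<partial>lborel)"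
  proof -
    have "(\<integral>\<^sup>+ y. ennreal \<bar>u z - c\<bar> * indicator D y \<partial>lborel) = ennreal m * ennreal \<bar>u z - c\<bar>" for z
      by (subst nn_integral_cmult_indicator) (simp_all add: meas mult.commute)
    then show ?thesis by (simp add: nn_integral_cmult mult.assoc)
  qed
  also have "\<dots> \<le> (\<integral>\<^sup>+ z. (\<integral>\<^sup>+ y. ennreal \<bar>u z - u y\<bar> * indicator D y + ennreal \<bar>u y - c\<bar> * indicator D y \<partial>lborel) * indicator D' z \<partial>lborel)"
    by (intro nn_integral_mono mult_right_mono)
       (auto simp: distrib_right[symmetric] ennreal_plus[symmetric] simp del: ennreal_plus
         intro!: mult_right_mono ennreal_leI)
  also have "\<dots> = (\<integral>\<^sup>+ z\<in>D'. (\<integral>\<^sup>+ y\<in>D. ennreal \<bar>u z - u y\<bar> \<partial>lborel) \<partial>lborel)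
      + (\<integral>\<^sup>+ y\<in>D. ennreal \<bar>u y - c\<bar> \<partial>lborel) * ennreal m'"
    using meas by (simp add: nn_integral_add nn_integral_cmult_indicator distrib_right)
  also have "\<dots> \<le> ennreal (m * m' * \<eta>) + ennreal (m * K) * ennreal m'"
    using osc avg by (intro add_mono mult_right_mono) auto
  also have "\<dots> = ennreal m * ennreal (m' * (K + \<eta>))"
    using meas osc avg
    by (simp add: ennreal_mult[symmetric] ennreal_plus[symmetric] algebra_simps del: ennreal_plus)
  finally show ?thesis
    using meas by (subst (asm) ennreal_mult_le_mult_iff) auto
qed

text \<open>
  Compare means over the balls \<open>D j\<close>, the images of the whole ball under the
  contraction with centre \<open>x\<close> and ratio \<open>1 / 2 ^ j\<close>.  They stay inside
  the ball for every \<open>x\<close> in it, so the estimate holds up to the boundary.  The mean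
  oscillation between consecutive ones decays geometrically because \<open>s p > n\<close>, and
  where the inner integral of the seminorm is finite, hence almost everywhere, the mean of
  \<open>\<bar>u x - u y\<bar>\<close> over \<open>D j\<close> is at most \<open>2\<close> for
  some \<open>j\<close>.
\<close>

lemma morrey_oscillation_bound:
  fixes p s Q :: real
  assumes s: "0 < s" and p: "1 \<le> p" and sp: "real CARD('n::finite) < s * p" and Q: "0 \<le> Q"
  shows "\<exists>N\<ge>0. \<forall>(x0 :: real ^ 'n) r u. 0 < r \<and> r \<le> 1 \<and> u \<in> borel_measurable borel \<and>
      gagliardo_power p s (ball x0 r) u \<le> ennreal Q
    \<longrightarrow> (\<exists>c. AE x in lborel. x \<in> ball x0 r \<longrightarrow> \<bar>u x - c\<bar> \<le> N)"
proof -
  define n where "n = real CARD('n)"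
  define \<omega> where "\<omega> = unit_ball_vol n"
  have \<omega>: "0 < \<omega>" by (simp add: \<omega>_def n_def)
  define \<gamma> where "\<gamma> = (s * p - n) / p"
  have \<gamma>: "0 < \<gamma>" "\<gamma> * p = s * p - n" using sp p by (auto simp: \<gamma>_def n_def)
  define C where "C = 2 powr (2 * n + s * p) / \<omega>\<^sup>2"
  have C: "0 \<le> C" by (simp add: C_def)
  define \<beta> :: real where "\<beta> = (1/2) powr \<gamma>"
  have \<beta>: "0 < \<beta>" "\<beta> < 1" using \<gamma> powr_less_mono2[of \<gamma> "1/2" 1] by (auto simp: \<beta>_def)
  define N where "N = 4 + C * Q + (1 + C * Q) / (1 - \<beta>)"
  have CQ: "0 \<le> C * Q" using C Q by simp
  have volume_bound: "(2 * R) powr (n + s * p) \<le> (\<omega> * R ^ CARD('n)) * (\<omega> * (R / 2) ^ CARD('n)) * C * R powr (\<gamma> * p)"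
    if "0 < R" for R
  proof -
    have "(\<omega> * R ^ CARD('n)) * (\<omega> * (R / 2) ^ CARD('n)) * C * R powr (\<gamma> * p)
        = R powr n * (R / 2) powr n * 2 powr (2 * n + s * p) * R powr (s * p - n)"
      using \<omega> that by (simp add: C_def \<gamma> n_def powr_realpow power2_eq_square)
    also have "\<dots> = (2 * R) powr (n + s * p)"
      using that by (simp add: powr_mult powr_divide powr_add powr_diff mult_ac)
        (simp add: mult.commute[of 2] powr_powr[symmetric] power2_eq_square)
    finally show ?thesis by simp
  qed
  show ?thesis
  proof (rule exI[of _ N], intro conjI allI impI; (elim conjE)?)
    show "0 \<le> N" using \<beta> CQ by (simp add: N_def add_nonneg_nonneg)
    fix x0 :: "real ^ 'n" and r and u :: "real ^ 'n \<Rightarrow> real"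
    assume r: "0 < r" "r \<le> 1" and [measurable]: "u \<in> borel_measurable borel"
      and G: "gagliardo_power p s (ball x0 r) u \<le> ennreal Q"
    define B where "B = ball x0 r"
    have [measurable]: "B \<in> sets borel" by (simp add: B_def)
    define m where "m R = \<omega> * R ^ CARD('n)" for R
    have m: "0 < m R" if "0 < R" for R using that \<omega> by (simp add: m_def)
    have em: "emeasure lborel (ball z R) = ennreal (m R)" if "0 < R" for z :: "real ^ 'n" and R
      using that by (simp add: emeasure_lborel_ball_cart m_def \<omega>_def n_def)
    have vb: "(2 * R) powr (n + s * p) \<le> m R * m (R / 2) * C * R powr (\<gamma> * p)" if "0 < R" for R
      using volume_bound[OF that] by (simp add: m_def)
    obtain c where c: "(\<integral>\<^sup>+ y\<in>B. ennreal \<bar>u y - c\<bar> \<partial>lborel) \<le> ennreal (m r * (2 + C * Q))"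
    proof -
      have "(\<integral>\<^sup>+ z\<in>B. (\<integral>\<^sup>+ y\<in>B. ennreal \<bar>u z - u y\<bar> \<partial>lborel) \<partial>lborel)
          \<le> ennreal (1 * m r * m r + 1 powr (1 - p) * (2 * r) powr (real CARD('n) + s * p) * Q)"
      proof (intro ball_oscillation_integral[where B = B])
        fix y z assume "y \<in> B" "z \<in> B"
        then show "norm (z - y) \<le> 2 * r"
          using dist_triangle3[of z y x0] by (simp add: B_def dist_norm)
      qed (use r m[of r] p s G Q in \<open>auto simp: em B_def\<close>)
      also have "\<dots> \<le> ennreal (m r * m r * (1 + C * Q))"
      proof (intro ennreal_leI)
        have "(2 * r) powr (n + s * p) \<le> m r * m (r / 2) * C * r powr (\<gamma> * p)" using vb r by simp
        also have "\<dots> \<le> m r * m (r / 2) * C * 1"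
          using r \<gamma>(1) p m[of r] m[of "r/2"] C by (intro mult_left_mono powr_le1) auto
        also have "\<dots> \<le> m r * m r * C * 1"
          using r m[of r] C \<omega> unfolding m_def
          by (intro mult_left_mono mult_right_mono power_mono) auto
        finally have "(2 * r) powr (n + s * p) * Q \<le> m r * m r * C * 1 * Q"
          using Q by (intro mult_right_mono) auto
        then show "1 * m r * m r + 1 powr (1 - p) * (2 * r) powr (real CARD('n) + s * p) * Q
          \<le> m r * m r * (1 + C * Q)"
          by (simp add: n_def algebra_simps)
      qed
      finally have tot: "(\<integral>\<^sup>+ z\<in>B. (\<integral>\<^sup>+ y\<in>B. ennreal \<bar>u z - u y\<bar> \<partial>lborel) \<partial>lborel)
        \<le> ennreal (m r * m r * (1 + C * Q))" .
      \<comment> \<open>Some value \<open>u z\<close> is close to \<open>u\<close> in the mean, and can serve as \<open>c\<close>.\<close>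
      have "\<exists>z\<in>B. (\<integral>\<^sup>+ y\<in>B. ennreal \<bar>u z - u y\<bar> \<partial>lborel) \<le> ennreal (m r * (2 + C * Q))"
      proof (rule ccontr)
        assume "\<not> ?thesis"
        then have "ennreal (m r * (2 + C * Q)) * indicator B z
            \<le> (\<integral>\<^sup>+ y\<in>B. ennreal \<bar>u z - u y\<bar> \<partial>lborel) * indicator B z" for z
          by (auto simp: indicator_def intro: less_imp_le)
        then have "(\<integral>\<^sup>+ z. ennreal (m r * (2 + C * Q)) * indicator B z \<partial>lborel)
            \<le> (\<integral>\<^sup>+ z\<in>B. (\<integral>\<^sup>+ y\<in>B. ennreal \<bar>u z - u y\<bar> \<partial>lborel) \<partial>lborel)"
          by (intro nn_integral_mono)
        with tot have "ennreal (m r * (2 + C * Q)) * ennreal (m r) \<le> ennreal (m r * m r * (1 + C * Q))"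
          using r em[of r x0] by (simp add: nn_integral_cmult_indicator B_def)
        then have "m r * (2 + C * Q) * m r \<le> m r * m r * (1 + C * Q)"
          using m[of r] r CQ by (simp add: ennreal_mult[symmetric])
        then show False using m[of r] r by (simp add: algebra_simps)
      qed
      then obtain z where "(\<integral>\<^sup>+ y\<in>B. ennreal \<bar>u z - u y\<bar> \<partial>lborel) \<le> ennreal (m r * (2 + C * Q))" by blast
      then show thesis by (intro that[of "u z"]) (simp add: abs_minus_commute)
    qed
    define k where "k z y = \<bar>u z - u y\<bar> powr p / norm (z - y) powr (n + s * p)" for z y
    have [measurable]: "(\<lambda>z. k (fst z) (snd z)) \<in> borel_measurable (borel \<Otimes>\<^sub>M borel)"
      "(\<lambda>y. k z y) \<in> borel_measurable borel" for z
      unfolding k_def by measurable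
    have k0: "0 \<le> k z y" for z y by (simp add: k_def)
    define g where "g x = (\<integral>\<^sup>+ y\<in>B. ennreal (k x y) \<partial>lborel)" for x
    have "(\<integral>\<^sup>+ x. g x * indicator B x \<partial>lborel) \<noteq> \<infinity>"
      using G unfolding B_def[symmetric] gagliardo_power_iterated[OF \<open>u \<in> _\<close> \<open>B \<in> _\<close>] g_def k_def n_def
      by (auto simp: top_unique)
    then have "AE x in lborel. g x * indicator B x \<noteq> \<infinity>"
      by (intro nn_integral_PInf_AE) (auto simp: g_def)
    then have "AE x in lborel. x \<in> B \<longrightarrow> \<bar>u x - c\<bar> \<le> N"
    proof (eventually_elim, intro impI)
      fix x assume "g x * indicator B x \<noteq> \<infinity>" and xB: "x \<in> B"
      then obtain gx where gx: "g x = ennreal gx" "0 \<le> gx"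
        by (cases "g x") auto
      define \<theta> :: "nat \<Rightarrow> real" where "\<theta> j = (1/2) ^ j" for j
      have \<theta>: "0 < \<theta> j" "\<theta> j \<le> 1" for j by (auto simp: \<theta>_def power_le_one)
      define D where "D j = ball (x + \<theta> j *\<^sub>R (x0 - x)) (\<theta> j * r)" for j
      have [measurable]: "D j \<in> sets borel" for j by (simp add: D_def)
      have dx: "dist x0 x < r" using xB by (simp add: B_def)
      have Dx: "norm (x - y) \<le> 2 * (\<theta> j * r)" if "y \<in> D j" for y j
      proof -
        have "norm (x - y) \<le> norm (x - (x + \<theta> j *\<^sub>R (x0 - x))) + norm (x + \<theta> j *\<^sub>R (x0 - x) - y)"
          using norm_triangle_ineq[of "x - (x + \<theta> j *\<^sub>R (x0 - x))" "x + \<theta> j *\<^sub>R (x0 - x) - y"] by simp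
        also have "\<dots> \<le> \<theta> j * r + \<theta> j * r"
          using that dx \<theta>[of j] by (intro add_mono) (auto simp: D_def dist_norm intro: mult_left_mono)
        finally show ?thesis by (simp add: mult.commute)
      qed
      have DB: "D j \<subseteq> B" for j
      proof
        fix y assume y: "y \<in> D j"
        have "dist x0 y \<le> norm ((1 - \<theta> j) *\<^sub>R (x0 - x)) + norm (x + \<theta> j *\<^sub>R (x0 - x) - y)"
          using norm_triangle_ineq[of "(1 - \<theta> j) *\<^sub>R (x0 - x)" "x + \<theta> j *\<^sub>R (x0 - x) - y"]
          by (simp add: dist_norm algebra_simps)
        also have "\<dots> < (1 - \<theta> j) * r + \<theta> j * r"
          using y dx \<theta>[of j] by (intro add_le_less_mono) (auto simp: D_def dist_norm intro!: mult_left_mono)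
        finally show "y \<in> B" by (simp add: B_def algebra_simps)
      qed
      have DS: "D (Suc j) \<subseteq> D j" for j
      proof
        fix y assume y: "y \<in> D (Suc j)"
        have "dist (x + \<theta> j *\<^sub>R (x0 - x)) y \<le> norm (\<theta> (Suc j) *\<^sub>R (x0 - x)) + norm (x + \<theta> (Suc j) *\<^sub>R (x0 - x) - y)"
        proof -
          have "x + \<theta> j *\<^sub>R (x0 - x) - y = \<theta> (Suc j) *\<^sub>R (x0 - x) + (x + \<theta> (Suc j) *\<^sub>R (x0 - x) - y)"
          proof -
            have half: "\<theta> j = \<theta> (Suc j) + \<theta> (Suc j)" by (simp add: \<theta>_def)
            show ?thesis unfolding half scaleR_left_distrib by simp
          qed
          then show ?thesis
            unfolding dist_norm by (metis norm_triangle_ineq)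
        qed
        also have "\<dots> < \<theta> (Suc j) * r + \<theta> (Suc j) * r"
          using y dx \<theta>[of "Suc j"] by (intro add_le_less_mono) (auto simp: D_def dist_norm intro!: mult_left_mono)
        finally show "y \<in> D j" by (simp add: D_def \<theta>_def mult.commute)
      qed
      have emD: "emeasure lborel (D j) = ennreal (m (\<theta> j * r))" for j
        unfolding D_def using \<theta> r by (intro em) simp
      have mD: "0 < m (\<theta> j * r)" for j using \<theta> r by (intro m) simp
      define K where "K j = 2 + C * Q + (\<Sum>i<j. \<beta> ^ i * (1 + C * Q))" for j
      have K0: "0 \<le> K j" for j unfolding K_def using CQ \<beta> by (intro add_nonneg_nonneg sum_nonneg) auto
      have avg: "(\<integral>\<^sup>+ y\<in>D j. ennreal \<bar>u y - c\<bar> \<partial>lborel) \<le> ennreal (m (\<theta> j * r) * K j)" for j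
      proof (induction j)
        case 0
        show ?case using c by (simp add: D_def \<theta>_def K_def B_def)
      next
        case (Suc j)
        have bj: "\<beta> ^ j = \<theta> j powr \<gamma>"
          by (simp add: \<beta>_def \<theta>_def powr_realpow[symmetric] powr_powr mult.commute)
        have "(\<integral>\<^sup>+ z\<in>D (Suc j). (\<integral>\<^sup>+ y\<in>D j. ennreal \<bar>u z - u y\<bar> \<partial>lborel) \<partial>lborel)
          \<le> ennreal (\<beta> ^ j * m (\<theta> j * r) * m (\<theta> (Suc j) * r)
              + (\<beta> ^ j) powr (1 - p) * (2 * (\<theta> j * r)) powr (real CARD('n) + s * p) * Q)"
        proof (intro ball_oscillation_integral[where B = B])
          fix y z assume "y \<in> D j" "z \<in> D (Suc j)"
          then have "y \<in> D j" "z \<in> D j" using DS by auto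
          then show "norm (z - y) \<le> 2 * (\<theta> j * r)"
            using dist_triangle3[of z y "x + \<theta> j *\<^sub>R (x0 - x)"] by (simp add: D_def dist_norm)
        qed (use DB emD mD p s \<beta> G Q in \<open>auto simp: B_def less_imp_le\<close>)
        also have "\<dots> \<le> ennreal (m (\<theta> j * r) * m (\<theta> (Suc j) * r) * (\<beta> ^ j * (1 + C * Q)))"
        proof (intro ennreal_leI)
          have half: "\<theta> (Suc j) * r = \<theta> j * r / 2" by (simp add: \<theta>_def)
          define mm where "mm = m (\<theta> j * r) * m (\<theta> (Suc j) * r)"
          have mm: "0 < mm" using mD by (simp add: mm_def)
          have "(2 * (\<theta> j * r)) powr (n + s * p) \<le> mm * C * (\<theta> j * r) powr (\<gamma> * p)"
            using vb[of "\<theta> j * r"] \<theta>[of j] r unfolding half[symmetric] mm_def by simp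
          also have "\<dots> \<le> mm * C * \<theta> j powr (\<gamma> * p)"
            using mm C \<theta>[of j] r \<gamma>(1) p mult_left_mono[of r 1 "\<theta> j"]
            by (intro mult_left_mono powr_mono2) auto
          also have "\<theta> j powr (\<gamma> * p) = (\<beta> ^ j) powr p"
            by (simp add: bj powr_powr)
          finally have "(\<beta> ^ j) powr (1 - p) * (2 * (\<theta> j * r)) powr (n + s * p) * Q
              \<le> (\<beta> ^ j) powr (1 - p) * (mm * C * (\<beta> ^ j) powr p) * Q"
            using Q by (intro mult_right_mono mult_left_mono) auto
          also have "\<dots> = ((\<beta> ^ j) powr (1 - p) * (\<beta> ^ j) powr p) * (mm * C * Q)" by simp
          also have "(\<beta> ^ j) powr (1 - p) * (\<beta> ^ j) powr p = \<beta> ^ j"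
            using \<beta> by (simp add: powr_add[symmetric])
          finally show "\<beta> ^ j * m (\<theta> j * r) * m (\<theta> (Suc j) * r)
              + (\<beta> ^ j) powr (1 - p) * (2 * (\<theta> j * r)) powr (real CARD('n) + s * p) * Q
            \<le> m (\<theta> j * r) * m (\<theta> (Suc j) * r) * (\<beta> ^ j * (1 + C * Q))"
            unfolding mm_def n_def by (simp add: algebra_simps)
        qed
        finally have osc: "(\<integral>\<^sup>+ z\<in>D (Suc j). (\<integral>\<^sup>+ y\<in>D j. ennreal \<bar>u z - u y\<bar> \<partial>lborel) \<partial>lborel)
          \<le> ennreal (m (\<theta> j * r) * m (\<theta> (Suc j) * r) * (\<beta> ^ j * (1 + C * Q)))" .
        have "(\<integral>\<^sup>+ y\<in>D (Suc j). ennreal \<bar>u y - c\<bar> \<partial>lborel)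
            \<le> ennreal (m (\<theta> (Suc j) * r) * (K j + \<beta> ^ j * (1 + C * Q)))"
          using Suc osc K0 \<beta> CQ emD mD by (intro average_distance_transfer[where D = "D j"]) auto
        then show ?case by (simp add: K_def add.assoc)
      qed
      have Kle: "K j \<le> 2 + C * Q + (1 + C * Q) / (1 - \<beta>)" for j
      proof -
        have "(\<Sum>i<j. \<beta> ^ i) \<le> 1 / (1 - \<beta>)"
          using \<beta> by (simp add: sum_gp_strict divide_right_mono)
        then have "(\<Sum>i<j. \<beta> ^ i) * (1 + C * Q) \<le> 1 / (1 - \<beta>) * (1 + C * Q)"
          using CQ by (intro mult_right_mono) auto
        then show ?thesis by (simp add: K_def sum_distrib_right[symmetric])
      qed
      define e where "e = 2 powr (n + s * p) * gx + 1"
      have e: "0 < e" using gx by (simp add: e_def add_nonneg_pos)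
      obtain j where j: "((1/2::real) powr (s * p)) ^ j < \<omega> / e"
        using real_arch_pow_inv[of "\<omega> / e" "(1/2::real) powr (s * p)"] e \<omega> s p
          powr_less_mono2[of "s * p" "1/2" 1] by auto
      have j': "\<theta> j powr (s * p) * e < \<omega>"
      proof -
        have "((1/2::real) powr (s * p)) ^ j = ((1/2) powr (s * p)) powr real j"
          by (rule powr_realpow[symmetric]) simp
        also have "\<dots> = ((1/2) powr real j) powr (s * p)"
          by (rule powr_powr_swap)
        also have "(1/2) powr real j = \<theta> j"
          unfolding \<theta>_def by (rule powr_realpow) simp
        finally show ?thesis
          using j e by (simp add: field_simps)
      qed
      define R where "R = \<theta> j * r"
      have R: "0 < R" "R \<le> \<theta> j" using \<theta>[of j] r mult_left_mono[of r 1 "\<theta> j"] by (auto simp: R_def)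
      have "ennreal \<bar>u x - c\<bar> * ennreal (m R) = (\<integral>\<^sup>+ y. ennreal \<bar>u x - c\<bar> * indicator (D j) y \<partial>lborel)"
        by (simp add: nn_integral_cmult_indicator emD R_def)
      also have "\<dots> \<le> (\<integral>\<^sup>+ y. (indicator (D j) y
          + ennreal ((2 * R) powr (n + s * p)) * (ennreal (k x y) * indicator B y))
          + ennreal \<bar>u y - c\<bar> * indicator (D j) y \<partial>lborel)"
      proof (intro nn_integral_mono)
        fix y
        show "ennreal \<bar>u x - c\<bar> * indicator (D j) y \<le> (indicator (D j) y
          + ennreal ((2 * R) powr (n + s * p)) * (ennreal (k x y) * indicator B y))
          + ennreal \<bar>u y - c\<bar> * indicator (D j) y"
        proof (cases "y \<in> D j")
          case True
          have "\<bar>u x - u y\<bar> \<le> 1 + (2 * R) powr (n + s * p) * k x y"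
          proof (cases "\<bar>u x - u y\<bar> \<le> 1")
            case False
            then have ne: "x \<noteq> y" by auto
            have "\<bar>u x - u y\<bar> powr 1 \<le> \<bar>u x - u y\<bar> powr p"
              using False p by (intro powr_mono) auto
            moreover have "\<bar>u x - u y\<bar> powr p * norm (x - y) powr (n + s * p) \<le> \<bar>u x - u y\<bar> powr p * (2 * R) powr (n + s * p)"
              using Dx[OF True] s p by (intro mult_left_mono powr_mono2) (auto simp: R_def n_def)
            then have "\<bar>u x - u y\<bar> powr p \<le> (2 * R) powr (n + s * p) * k x y"
              using ne by (simp add: k_def field_simps)
            ultimately show ?thesis by simp
          qed (use k0[of x y] in \<open>simp add: add_increasing2\<close>)
          then have "\<bar>u x - c\<bar> \<le> 1 + (2 * R) powr (n + s * p) * k x y + \<bar>u y - c\<bar>" by linarith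
          then have "ennreal \<bar>u x - c\<bar> \<le> ennreal (1 + (2 * R) powr (n + s * p) * k x y + \<bar>u y - c\<bar>)"
            by (rule ennreal_leI)
          also have "\<dots> = 1 + ennreal ((2 * R) powr (n + s * p)) * ennreal (k x y) + ennreal \<bar>u y - c\<bar>"
            using k0[of x y] by (simp add: ennreal_mult)
          finally show ?thesis using True subsetD[OF DB True] by simp
        qed simp
      qed
      also have "\<dots> = ennreal (m R) + ennreal ((2 * R) powr (n + s * p)) * g x
          + (\<integral>\<^sup>+ y\<in>D j. ennreal \<bar>u y - c\<bar> \<partial>lborel)"
        by (simp add: nn_integral_add nn_integral_cmult emD g_def R_def)
      also have "\<dots> \<le> ennreal (m R) + ennreal ((2 * R) powr (n + s * p)) * ennreal gx + ennreal (m R * K j)"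
        using avg[of j] gx by (intro add_mono) (auto simp: R_def)
      also have "\<dots> = ennreal (m R + (2 * R) powr (n + s * p) * gx + m R * K j)"
        using gx m[OF R(1)] K0[of j] by (simp add: ennreal_mult ennreal_plus)
      finally have "ennreal (\<bar>u x - c\<bar> * m R) \<le> ennreal (m R + (2 * R) powr (n + s * p) * gx + m R * K j)"
        using m[OF R(1)] by (simp add: ennreal_mult)
      then have 1: "\<bar>u x - c\<bar> * m R \<le> m R + (2 * R) powr (n + s * p) * gx + m R * K j"
        using gx m[OF R(1)] K0[of j] by (subst (asm) ennreal_le_iff) auto
      have "(2 * R) powr (n + s * p) * gx = R ^ CARD('n) * (R powr (s * p) * (2 powr (n + s * p) * gx))"
        using R by (simp add: powr_mult powr_add powr_realpow n_def)
      also have "\<dots> \<le> R ^ CARD('n) * (\<theta> j powr (s * p) * e)"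
        using R gx s p by (intro mult_left_mono mult_mono powr_mono2) (auto simp: e_def)
      also have "\<dots> \<le> R ^ CARD('n) * \<omega>"
        using R j' by (intro mult_left_mono) auto
      finally have "(2 * R) powr (n + s * p) * gx \<le> m R" by (simp add: m_def mult.commute)
      with 1 have "\<bar>u x - c\<bar> * m R \<le> (2 + K j) * m R" by (simp add: algebra_simps)
      then have "\<bar>u x - c\<bar> \<le> 2 + K j" using m[OF R(1)] by simp
      with Kle[of j] show "\<bar>u x - c\<bar> \<le> N" by (simp add: N_def)
    qed
    then show "\<exists>c. AE x in lborel. x \<in> ball x0 r \<longrightarrow> \<bar>u x - c\<bar> \<le> N"
      unfolding B_def by blast
  qed
qed

section \<open>Energy of the competitor\<close>

text \<open>
  The double phase integrand for the pure kernels, with the two numerators \<open>f\<close> and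
  \<open>g\<close> left open: the gain and both error terms have this form.
\<close>

definition phase_density :: "real \<Rightarrow> real \<Rightarrow> real \<Rightarrow> real \<Rightarrow> (real ^ 'n \<Rightarrow> real ^ 'n \<Rightarrow> real) \<Rightarrow>
    (real ^ 'n \<Rightarrow> real ^ 'n \<Rightarrow> real) \<Rightarrow> (real ^ 'n \<Rightarrow> real ^ 'n \<Rightarrow> real) \<Rightarrow> real ^ 'n \<Rightarrow> real ^ 'n \<Rightarrow> real" where
  "phase_density p q s t a f g x y = f x y / norm (x - y) powr (real CARD('n) + s * p)
     + a x y * (g x y / norm (x - y) powr (real CARD('n) + t * q))"

text \<open>
  Collects all positions of the two points relative to the three sets.  \<open>B1\<close> is
  where the cutoff equals one, \<open>B2\<close> contains its support, and \<open>B3\<close>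
  separates near pairs from far ones.
\<close>

lemma cutoff_single_phase:
  fixes u \<psi> :: "'a \<Rightarrow> real"
  assumes e: "1 \<le> e" "e \<le> q" and \<Lambda>: "1 \<le> \<Lambda>" and N: "0 < N" and K: "inverse \<Lambda> / N \<le> K" "K \<le> \<Lambda> / N"
    and k: "0 \<le> k" and \<psi>: "\<And>x. 0 \<le> \<psi> x" "\<And>x. \<psi> x \<le> 1"
    and \<psi>1: "\<And>x. x \<in> B1 \<Longrightarrow> \<psi> x = 1" and \<psi>0: "\<And>x. x \<notin> B2 \<Longrightarrow> \<psi> x = 0"
    and sub: "B1 \<subseteq> B3" "B2 \<subseteq> B3"
  defines "v \<equiv> \<lambda>x. cutoff_competitor k (\<psi> x powr q) (u x)" and "w \<equiv> \<lambda>x. max (u x - k) 0"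
  shows "\<bar>v x - v y\<bar> powr e * K + inverse \<Lambda> * (indicator B1 x * indicator B1 y * \<bar>w x - w y\<bar> powr e / N)
    \<le> \<bar>u x - u y\<bar> powr e * K
      + \<Lambda> * q powr q * (indicator B3 x * indicator B3 y * ((w x powr e + w y powr e) * \<bar>\<psi> x - \<psi> y\<bar> powr e) / N)
      + \<Lambda> * q * (indicator B2 x * indicator (- B3) y * (w x * max (u y) 0 powr (e - 1)) / N)
      + \<Lambda> * q * (indicator B2 y * indicator (- B3) x * (w y * max (u x) 0 powr (e - 1)) / N)"
proof -
  have K0: "0 \<le> K" using K \<Lambda> N by (meson divide_nonneg_pos dual_order.trans inverse_nonnegative_iff_nonnegative order_trans zero_le_one)
  have KN: "X * K \<le> \<Lambda> * (X / N)" if "0 \<le> X" for X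
    using mult_left_mono[OF K(2) that] by (simp add: mult.commute)
  have w0: "0 \<le> w z" for z by (simp add: w_def)
  have t0: "0 \<le> \<Lambda> * q * (indicator B2 x * indicator (- B3) y * (w x * max (u y) 0 powr (e - 1)) / N)"
    "0 \<le> \<Lambda> * q * (indicator B2 y * indicator (- B3) x * (w y * max (u x) 0 powr (e - 1)) / N)"
    "0 \<le> \<Lambda> * q powr q * (indicator B3 x * indicator B3 y * ((w x powr e + w y powr e) * \<bar>\<psi> x - \<psi> y\<bar> powr e) / N)"
    using \<Lambda> e N w0 by (auto intro!: mult_nonneg_nonneg divide_nonneg_nonneg)
  have nonlocal: "\<bar>v x - u y\<bar> powr e * K \<le> \<bar>u x - u y\<bar> powr e * K + \<Lambda> * q * (w x * max (u y) 0 powr (e - 1) / N)" for x y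
  proof -
    have \<phi>: "0 \<le> \<psi> x powr q" "\<psi> x powr q \<le> 1" using \<psi>[of x] e by (auto intro: powr_le1)
    define Z where "Z = e * (max (u y - k) 0 powr (e - 1) * (\<psi> x powr q * w x))"
    have "\<bar>v x - u y\<bar> powr e \<le> \<bar>u x - u y\<bar> powr e + Z"
      unfolding v_def Z_def w_def using cutoff_competitor_nonlocal[OF e(1) \<phi>] .
    then have 1: "\<bar>v x - u y\<bar> powr e * K \<le> \<bar>u x - u y\<bar> powr e * K + Z * K"
      using K0 by (simp add: distrib_right[symmetric] mult_right_mono)
    have "Z \<le> q * (max (u y) 0 powr (e - 1) * (1 * w x))"
      unfolding Z_def using e k \<phi> w0[of x] by (intro mult_mono powr_mono2) auto
    moreover have "0 \<le> Z" unfolding Z_def using e \<phi> w0[of x] by simp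
    ultimately have "Z * K \<le> \<Lambda> * (q * (max (u y) 0 powr (e - 1) * (1 * w x)) / N)"
      using KN[of Z] \<Lambda> N by (smt (verit) divide_right_mono mult_left_mono)
    with 1 show ?thesis by (simp add: mult_ac)
  qed
  have out: "v z = u z" if "z \<notin> B2" for z
    using \<psi>0[OF that] e by (simp add: v_def cutoff_competitor_def)
  consider "x \<in> B3" "y \<in> B3" | "x \<in> B3" "y \<notin> B3" | "x \<notin> B3" "y \<in> B3" | "x \<notin> B3" "y \<notin> B3" by blast
  then show ?thesis
  proof cases
    case 1
    define E where "E = (w x powr e + w y powr e) * \<bar>\<psi> x - \<psi> y\<bar> powr e"
    define mn where "mn = min (\<psi> x powr q) (\<psi> y powr q)"
    have "\<bar>v x - v y\<bar> powr e + mn * \<bar>w x - w y\<bar> powr e \<le> \<bar>u x - u y\<bar> powr e + q powr e * E"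
      unfolding v_def w_def E_def mn_def
      using e \<psi> by (intro cutoff_competitor_local) auto
    also have "q powr e * E \<le> q powr q * E"
      unfolding E_def using e by (intro mult_right_mono powr_mono) auto
    finally have "(\<bar>v x - v y\<bar> powr e + mn * \<bar>w x - w y\<bar> powr e) * K \<le> (\<bar>u x - u y\<bar> powr e + q powr q * E) * K"
      using K0 by (intro mult_right_mono) auto
    then have main: "\<bar>v x - v y\<bar> powr e * K + mn * \<bar>w x - w y\<bar> powr e * K
        \<le> \<bar>u x - u y\<bar> powr e * K + q powr q * E * K" by (simp add: distrib_right)
    have "q powr q * E * K \<le> \<Lambda> * (q powr q * E / N)" by (intro KN) (simp add: E_def)
    moreover have "inverse \<Lambda> * (indicator B1 x * indicator B1 y * \<bar>w x - w y\<bar> powr e / N) \<le> mn * \<bar>w x - w y\<bar> powr e * K"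
    proof (cases "x \<in> B1 \<and> y \<in> B1")
      case True
      then have "mn = 1" using \<psi>1 by (simp add: mn_def)
      then show ?thesis
        using True mult_left_mono[OF K(1), of "\<bar>w x - w y\<bar> powr e"] by (simp add: mult_ac)
    next
      case False
      have "0 \<le> mn" by (simp add: mn_def)
      then show ?thesis using False K0 by auto
    qed
    ultimately show ?thesis
      using main t0 1 by (simp add: E_def mult_ac)
  next
    case 2
    then have "y \<notin> B1" "v y = u y" "y \<notin> B2" using sub out by auto
    then show ?thesis
      using 2 nonlocal[of x y] out[of x] by (cases "x \<in> B2") auto
  next
    case 3
    then have "x \<notin> B1" "v x = u x" "x \<notin> B2" using sub out by auto
    then show ?thesis
      using 3 nonlocal[of y x] out[of y] by (cases "y \<in> B2") (auto simp: abs_minus_commute)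
  next
    case 4
    then have "x \<notin> B1" "y \<notin> B1" "x \<notin> B2" "y \<notin> B2" "v x = u x" "v y = u y" using sub out by auto
    then show ?thesis using 4 by simp
  qed
qed

lemma phase_density_nonneg:
  assumes "0 \<le> f x y" "0 \<le> g x y" "0 \<le> a x y"
  shows "0 \<le> phase_density p q s t a f g x y"
  using assms by (simp add: phase_density_def)

lemma borel_measurable_phase_density:
  fixes a f g :: "real ^ 'n \<Rightarrow> real ^ 'n \<Rightarrow> real"
  assumes [measurable]: "(\<lambda>(x, y). a x y) \<in> borel_measurable borel"
    "(\<lambda>(x, y). f x y) \<in> borel_measurable borel" "(\<lambda>(x, y). g x y) \<in> borel_measurable borel"
  shows "(\<lambda>(x, y). phase_density p q s t a f g x y) \<in> borel_measurable borel"
proof -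
  have "(\<lambda>z. norm (fst z - snd z :: real ^ 'n)) \<in> borel_measurable borel"
    by (simp add: borel_prod[symmetric])
  then have [measurable]: "(\<lambda>(x :: real ^ 'n, y). norm (x - y)) \<in> borel_measurable borel"
    by (simp add: split_beta)
  have eq: "(\<lambda>(x, y). phase_density p q s t a f g x y) = (\<lambda>z. (\<lambda>(x, y). f x y) z / (\<lambda>(x, y). norm (x - y)) z powr (real CARD('n) + s * p)
     + (\<lambda>(x, y). a x y) z * ((\<lambda>(x, y). g x y) z / (\<lambda>(x, y). norm (x - y)) z powr (real CARD('n) + t * q)))"
    by (auto simp: phase_density_def fun_eq_iff)
  show ?thesis unfolding eq by measurable
qed

lemma phase_density_product_measurable:
  fixes a :: "real ^ 'n \<Rightarrow> real ^ 'n \<Rightarrow> real"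
  assumes "(\<lambda>(x, y). a x y) \<in> borel_measurable borel"
    "(\<lambda>z. f (fst z) (snd z)) \<in> borel_measurable (borel \<Otimes>\<^sub>M borel)"
    "(\<lambda>z. g (fst z) (snd z)) \<in> borel_measurable (borel \<Otimes>\<^sub>M borel)"
  shows "(\<lambda>z. phase_density p q s t a f g (fst z) (snd z)) \<in> borel_measurable (borel \<Otimes>\<^sub>M borel)"
  using borel_measurable_phase_density[of a f g p q s t] assms
  by (simp add: borel_prod case_prod_beta')

text \<open>
  What the competitor gains where the cutoff equals one.  Its integral is a pair of seminorms of
  \<open>w\<close>, the second one weighted by the coefficient.
\<close>

definition gain_density :: "real \<Rightarrow> real \<Rightarrow> real \<Rightarrow> real \<Rightarrow> (real ^ 'n \<Rightarrow> real ^ 'n \<Rightarrow> real) \<Rightarrow>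
    (real ^ 'n) set \<Rightarrow> (real ^ 'n \<Rightarrow> real) \<Rightarrow> real ^ 'n \<Rightarrow> real ^ 'n \<Rightarrow> real" where
  "gain_density p q s t a B w = phase_density p q s t a
     (\<lambda>x y. indicator B x * indicator B y * \<bar>w x - w y\<bar> powr p)
     (\<lambda>x y. indicator B x * indicator B y * \<bar>w x - w y\<bar> powr q)"

text \<open>
  The cost of the cutoff for two near points; it is small where \<open>\<psi>\<close> varies
  slowly.
\<close>

definition cutoff_error_density :: "real \<Rightarrow> real \<Rightarrow> real \<Rightarrow> real \<Rightarrow> (real ^ 'n \<Rightarrow> real ^ 'n \<Rightarrow> real) \<Rightarrow>
    (real ^ 'n) set \<Rightarrow> (real ^ 'n \<Rightarrow> real) \<Rightarrow> (real ^ 'n \<Rightarrow> real) \<Rightarrow> real ^ 'n \<Rightarrow> real ^ 'n \<Rightarrow> real" where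
  "cutoff_error_density p q s t a B \<psi> w = phase_density p q s t a
     (\<lambda>x y. indicator B x * indicator B y * ((w x powr p + w y powr p) * \<bar>\<psi> x - \<psi> y\<bar> powr p))
     (\<lambda>x y. indicator B x * indicator B y * ((w x powr q + w y powr q) * \<bar>\<psi> x - \<psi> y\<bar> powr q))"

text \<open>
  The cost for a point \<open>x\<close> in the support of the cutoff and a far point
  \<open>y\<close>.
\<close>

definition tail_error_density :: "real \<Rightarrow> real \<Rightarrow> real \<Rightarrow> real \<Rightarrow> (real ^ 'n \<Rightarrow> real ^ 'n \<Rightarrow> real) \<Rightarrow>
    (real ^ 'n) set \<Rightarrow> (real ^ 'n) set \<Rightarrow> (real ^ 'n \<Rightarrow> real) \<Rightarrow> (real ^ 'n \<Rightarrow> real) \<Rightarrow> real ^ 'n \<Rightarrow> real ^ 'n \<Rightarrow> real" where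
  "tail_error_density p q s t a B B' u w = phase_density p q s t a
     (\<lambda>x y. indicator B x * indicator (- B') y * (w x * max (u y) 0 powr (p - 1)))
     (\<lambda>x y. indicator B x * indicator (- B') y * (w x * max (u y) 0 powr (q - 1)))"

lemma cutoff_density_comparison:
  fixes u \<psi> :: "real ^ 'n \<Rightarrow> real"
  assumes pq: "1 \<le> p" "p \<le> q" and \<Lambda>: "1 \<le> \<Lambda>"
    and ker: "comparable_kernel \<Lambda> (s * p) Ksp" "comparable_kernel \<Lambda> (t * q) Ktq"
    and a: "\<And>x y. 0 \<le> a x y" "\<And>x y. a x y = a y x"
    and k: "0 \<le> k" and \<psi>: "\<And>x. 0 \<le> \<psi> x" "\<And>x. \<psi> x \<le> 1"
    and \<psi>1: "\<And>x. x \<in> B1 \<Longrightarrow> \<psi> x = 1" and \<psi>0: "\<And>x. x \<notin> B2 \<Longrightarrow> \<psi> x = 0"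
    and sub: "B1 \<subseteq> B3" "B2 \<subseteq> B3"
  defines "v \<equiv> \<lambda>x. cutoff_competitor k (\<psi> x powr q) (u x)" and "w \<equiv> \<lambda>x. max (u x - k) 0"
  shows "(\<bar>v x - v y\<bar> powr p * Ksp x y + a x y * \<bar>v x - v y\<bar> powr q * Ktq x y)
      + inverse \<Lambda> * gain_density p q s t a B1 w x y
    \<le> (\<bar>u x - u y\<bar> powr p * Ksp x y + a x y * \<bar>u x - u y\<bar> powr q * Ktq x y)
      + \<Lambda> * q powr q * cutoff_error_density p q s t a B3 \<psi> w x y
      + \<Lambda> * q * tail_error_density p q s t a B2 B3 u w x y
      + \<Lambda> * q * tail_error_density p q s t a B2 B3 u w y x"
proof (cases "x = y")
  case True
  then show ?thesis
    by (simp add: gain_density_def cutoff_error_density_def tail_error_density_def phase_density_def)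
next
  case False
  then have N: "0 < norm (x - y) powr c" for c by simp
  have K: "inverse \<Lambda> / norm (x - y) powr (real CARD('n) + s * p) \<le> Ksp x y"
    "Ksp x y \<le> \<Lambda> / norm (x - y) powr (real CARD('n) + s * p)"
    "inverse \<Lambda> / norm (x - y) powr (real CARD('n) + t * q) \<le> Ktq x y"
    "Ktq x y \<le> \<Lambda> / norm (x - y) powr (real CARD('n) + t * q)"
    using ker False by (auto simp: comparable_kernel_def)
  have 1: "1 \<le> q" "q \<le> q" using pq by auto
  note P = cutoff_single_phase[OF pq \<Lambda> N K(1,2) k \<psi> \<psi>1 \<psi>0 sub, where x = x and y = y and u = u]
  note Q = cutoff_single_phase[OF 1 \<Lambda> N K(3,4) k \<psi> \<psi>1 \<psi>0 sub, where x = x and y = y and u = u]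
  have combine: "X1 + \<alpha> * X2 * k2 + i * (A1 + \<alpha> * A2)
      \<le> Y1 + \<alpha> * Y2 * k2 + c * (B1 + \<alpha> * B2) + d * (C1 + \<alpha> * C2) + d * (D1 + \<alpha> * D2)"
    if "X1 + i * A1 \<le> Y1 + c * B1 + d * C1 + d * D1" "X2 * k2 + i * A2 \<le> Y2 * k2 + c * B2 + d * C2 + d * D2" "0 \<le> \<alpha>"
    for X1 X2 Y1 Y2 k2 A1 A2 B1 B2 C1 C2 D1 D2 i c d \<alpha> :: real
    using add_mono[OF that(1) mult_left_mono[OF that(2,3)]] by (simp add: algebra_simps)
  show ?thesis
    unfolding gain_density_def cutoff_error_density_def tail_error_density_def phase_density_def a(2)[of y x] norm_minus_commute[of y x] v_def w_def
    by (rule combine[OF P Q a(1)])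
qed

lemma borel_measurable_lebesgueI:
  fixes f :: "'a::euclidean_space \<Rightarrow> 'b::topological_space"
  assumes "f \<in> borel_measurable borel"
  shows "f \<in> borel_measurable lebesgue"
  using assms by (intro measurable_completion) simp

text \<open>
  The pure kernel is itself admissible in the comparison of energies; this is how finiteness of
  the energy of the competitor, and thereby its admissibility, is obtained.
\<close>

lemma pure_kernel_comparable:
  fixes \<Lambda> \<sigma> :: real
  assumes "1 \<le> \<Lambda>"
  shows "comparable_kernel \<Lambda> \<sigma> (\<lambda>x y :: real ^ 'n. 1 / norm (x - y) powr (real CARD('n) + \<sigma>))"
proof -
  have "(\<lambda>z. 1 / norm (fst z - snd z :: real ^ 'n) powr (real CARD('n) + \<sigma>)) \<in> borel_measurable (borel \<Otimes>\<^sub>M borel)"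
    by measurable
  then have "(\<lambda>(x, y). 1 / norm (x - y :: real ^ 'n) powr (real CARD('n) + \<sigma>)) \<in> borel_measurable lebesgue"
    by (intro borel_measurable_lebesgueI) (simp add: borel_prod split_beta)
  moreover have "inverse \<Lambda> \<le> 1" using assms by (simp add: inverse_le_1_iff)
  ultimately show ?thesis
    using assms by (auto simp: comparable_kernel_def divide_right_mono)
qed

lemma measurable_energy_integrand:
  fixes u :: "real ^ 'n \<Rightarrow> real"
  assumes u: "u \<in> borel_measurable borel" and a: "(\<lambda>(x, y). a x y) \<in> borel_measurable borel"
    and ker: "comparable_kernel \<Lambda> \<sigma> Ksp" "comparable_kernel \<Lambda>' \<sigma>' Ktq"
  shows "(\<lambda>(x, y). \<bar>u x - u y\<bar> powr p * Ksp x y + a x y * \<bar>u x - u y\<bar> powr q * Ktq x y) \<in> borel_measurable lebesgue"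
proof -
  note [measurable] = u
  have "(\<lambda>z. \<bar>u (fst z) - u (snd z)\<bar>) \<in> borel_measurable (borel \<Otimes>\<^sub>M borel)"
    by measurable
  then have [measurable]: "(\<lambda>(x, y). \<bar>u x - u y\<bar>) \<in> borel_measurable lebesgue"
    by (intro borel_measurable_lebesgueI) (simp add: borel_prod split_beta)
  have [measurable]: "(\<lambda>(x, y). a x y) \<in> borel_measurable lebesgue"
    "(\<lambda>(x, y). Ksp x y) \<in> borel_measurable lebesgue" "(\<lambda>(x, y). Ktq x y) \<in> borel_measurable lebesgue"
    using a ker by (auto simp: comparable_kernel_def intro: borel_measurable_lebesgueI)
  have eq: "(\<lambda>(x, y). \<bar>u x - u y\<bar> powr p * Ksp x y + a x y * \<bar>u x - u y\<bar> powr q * Ktq x y)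
    = (\<lambda>z. (\<lambda>(x, y). \<bar>u x - u y\<bar>) z powr p * (\<lambda>(x, y). Ksp x y) z
        + (\<lambda>(x, y). a x y) z * (\<lambda>(x, y). \<bar>u x - u y\<bar>) z powr q * (\<lambda>(x, y). Ktq x y) z)"
    by auto
  show ?thesis unfolding eq by measurable
qed

lemma open_cross_domain:
  assumes "open \<Omega>"
  shows "cross_domain \<Omega> \<in> sets lebesgue"
proof -
  have "closed ((- \<Omega>) \<times> (- \<Omega>))" using assms by (intro closed_Times) auto
  then have "cross_domain \<Omega> \<in> sets borel" unfolding cross_domain_def by auto
  then show ?thesis by simp
qed

lemma energy_eq:
  assumes "open \<Omega>"
  shows "energy p q a Ksp Ktq \<Omega> u =
    (\<integral>\<^sup>+ z. ennreal (case z of (x, y) \<Rightarrow> \<bar>u x - u y\<bar> powr p * Ksp x y + a x y * \<bar>u x - u y\<bar> powr q * Ktq x y)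
       * indicator (cross_domain \<Omega>) z \<partial>lebesgue)"
  unfolding energy_def using open_cross_domain[OF assms]
  by (subst nn_integral_restrict_space) (auto simp: split_beta)

lemma energy_le_pure:
  fixes u :: "real ^ 'n \<Rightarrow> real"
  assumes u: "u \<in> borel_measurable borel" and a: "(\<lambda>(x, y). a x y) \<in> borel_measurable borel" "\<And>x y. 0 \<le> a x y"
    and ker: "comparable_kernel \<Lambda> (s * p) Ksp" "comparable_kernel \<Lambda> (t * q) Ktq" and \<Lambda>: "1 \<le> \<Lambda>"
    and \<Omega>: "open \<Omega>"
  shows "energy p q a Ksp Ktq \<Omega> u \<le> ennreal \<Lambda> *
    energy p q a (\<lambda>x y. 1 / norm (x - y) powr (real CARD('n) + s * p)) (\<lambda>x y. 1 / norm (x - y) powr (real CARD('n) + t * q)) \<Omega> u"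
proof -
  define F where "F = (\<lambda>(x, y). \<bar>u x - u y\<bar> powr p * (1 / norm (x - y) powr (real CARD('n) + s * p))
      + a x y * \<bar>u x - u y\<bar> powr q * (1 / norm (x - y) powr (real CARD('n) + t * q)))"
  have [measurable]: "F \<in> borel_measurable lebesgue"
    unfolding F_def by (rule measurable_energy_integrand[OF u a(1) pure_kernel_comparable[OF \<Lambda>] pure_kernel_comparable[OF \<Lambda>]])
  note [measurable] = open_cross_domain[OF \<Omega>]
  have F0: "0 \<le> F z" for z using a(2) by (simp add: F_def split_beta)
  have le: "\<bar>u x - u y\<bar> powr p * Ksp x y + a x y * \<bar>u x - u y\<bar> powr q * Ktq x y \<le> \<Lambda> * F (x, y)" for x y
  proof (cases "x = y")
    case False
    then have "Ksp x y \<le> \<Lambda> / norm (x - y) powr (real CARD('n) + s * p)"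
      "Ktq x y \<le> \<Lambda> / norm (x - y) powr (real CARD('n) + t * q)"
      using ker by (auto simp: comparable_kernel_def)
    then have "\<bar>u x - u y\<bar> powr p * Ksp x y + a x y * \<bar>u x - u y\<bar> powr q * Ktq x y
      \<le> \<bar>u x - u y\<bar> powr p * (\<Lambda> / norm (x - y) powr (real CARD('n) + s * p))
        + a x y * \<bar>u x - u y\<bar> powr q * (\<Lambda> / norm (x - y) powr (real CARD('n) + t * q))"
      using a(2) by (intro add_mono mult_left_mono) auto
    then show ?thesis by (simp add: F_def algebra_simps)
  qed (simp add: F_def)
  have "energy p q a Ksp Ktq \<Omega> u \<le> (\<integral>\<^sup>+ z. ennreal \<Lambda> * (ennreal (F z) * indicator (cross_domain \<Omega>) z) \<partial>lebesgue)"
    unfolding energy_eq[OF \<Omega>] using le F0 \<Lambda>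
    by (intro nn_integral_mono) (auto simp: indicator_def ennreal_mult[symmetric] ennreal_leI split: prod.splits)
  also have "\<dots> = ennreal \<Lambda> * (\<integral>\<^sup>+ z. ennreal (F z) * indicator (cross_domain \<Omega>) z \<partial>lebesgue)"
    by (intro nn_integral_cmult) measurable
  finally show ?thesis
    unfolding energy_eq[OF \<Omega>] by (simp add: F_def)
qed

lemma admissible_energy:
  fixes u :: "real ^ 'n \<Rightarrow> real"
  shows "u \<in> admissible p q s t a \<Omega> \<longleftrightarrow> u \<in> borel_measurable lebesgue \<and>
    (\<integral>\<^sup>+ x. ennreal (\<bar>u x\<bar> powr p) \<partial>lebesgue_on \<Omega>) < \<infinity> \<and>
    energy p q a (\<lambda>x y. 1 / norm (x - y) powr (real CARD('n) + s * p))
      (\<lambda>x y. 1 / norm (x - y) powr (real CARD('n) + t * q)) \<Omega> u < \<infinity>"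
  by (simp add: admissible_def energy_def)

text \<open>
  The pointwise comparison integrated.  It is stated as a sum of nonnegative terms on both
  sides, so that it also makes sense when the error is infinite.  The two far terms agree after
  exchanging the variables.
\<close>

lemma cutoff_energy_comparison:
  fixes u \<psi> :: "real ^ 'n \<Rightarrow> real"
  assumes pq: "1 \<le> p" "p \<le> q" and \<Lambda>: "1 \<le> \<Lambda>"
    and ker: "comparable_kernel \<Lambda> (s * p) Ksp" "comparable_kernel \<Lambda> (t * q) Ktq"
    and a: "\<And>x y. 0 \<le> a x y" "\<And>x y. a x y = a y x" "(\<lambda>(x, y). a x y) \<in> borel_measurable borel"
    and u [measurable]: "u \<in> borel_measurable borel"
    and k: "0 \<le> k" and \<psi>: "\<And>x. 0 \<le> \<psi> x" "\<And>x. \<psi> x \<le> 1" and \<psi>_meas [measurable]: "\<psi> \<in> borel_measurable borel"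
    and \<psi>1: "\<And>x. x \<in> B1 \<Longrightarrow> \<psi> x = 1" and \<psi>0: "\<And>x. x \<notin> B2 \<Longrightarrow> \<psi> x = 0"
    and sub: "B1 \<subseteq> B3" "B2 \<subseteq> B3" "B3 \<subseteq> \<Omega>" and \<Omega>: "open \<Omega>"
    and [measurable]: "B1 \<in> sets borel" "B2 \<in> sets borel" "B3 \<in> sets borel"
  defines "v \<equiv> \<lambda>x. cutoff_competitor k (\<psi> x powr q) (u x)" and "w \<equiv> \<lambda>x. max (u x - k) 0"
  defines "S \<equiv> gain_density p q s t a B1 w"
    and "E \<equiv> cutoff_error_density p q s t a B3 \<psi> w"
    and "T \<equiv> tail_error_density p q s t a B2 B3 u w"
  shows "energy p q a Ksp Ktq \<Omega> v + ennreal (inverse \<Lambda>) * (\<integral>\<^sup>+ z. ennreal (S (fst z) (snd z)) \<partial>lborel)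
    \<le> energy p q a Ksp Ktq \<Omega> u
      + (ennreal (\<Lambda> * q powr q) * (\<integral>\<^sup>+ z. ennreal (E (fst z) (snd z)) \<partial>lborel)
        + ennreal (2 * \<Lambda> * q) * (\<integral>\<^sup>+ z. ennreal (T (fst z) (snd z)) \<partial>lborel))"
proof -
  have [measurable]: "w \<in> borel_measurable borel" unfolding w_def by measurable
  have vm [measurable]: "v \<in> borel_measurable borel" unfolding v_def cutoff_competitor_def by measurable
  have [measurable]: "(\<lambda>z. S (fst z) (snd z)) \<in> borel_measurable (borel \<Otimes>\<^sub>M borel)"
    "(\<lambda>z. E (fst z) (snd z)) \<in> borel_measurable (borel \<Otimes>\<^sub>M borel)"
    "(\<lambda>z. T (fst z) (snd z)) \<in> borel_measurable (borel \<Otimes>\<^sub>M borel)"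
    unfolding S_def E_def T_def gain_density_def cutoff_error_density_def tail_error_density_def
    by (intro phase_density_product_measurable a(3); measurable)+
  then have bm: "(\<lambda>z. S (fst z) (snd z)) \<in> borel_measurable borel"
    "(\<lambda>z. E (fst z) (snd z)) \<in> borel_measurable borel"
    "(\<lambda>z. T (fst z) (snd z)) \<in> borel_measurable borel"
    by (simp_all add: borel_prod)
  have "(\<lambda>z. T (snd z) (fst z)) \<in> borel_measurable (borel \<Otimes>\<^sub>M borel)"
    using measurable_compose[OF measurable_pair_swap' \<open>(\<lambda>z. T (fst z) (snd z)) \<in> borel_measurable (borel \<Otimes>\<^sub>M borel)\<close>]
    by (simp add: split_beta)
  then have bm': "(\<lambda>z. T (snd z) (fst z)) \<in> borel_measurable borel"
    by (simp add: borel_prod)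
  have lm [measurable]: "(\<lambda>z. S (fst z) (snd z)) \<in> borel_measurable lebesgue"
    "(\<lambda>z. E (fst z) (snd z)) \<in> borel_measurable lebesgue"
    "(\<lambda>z. T (fst z) (snd z)) \<in> borel_measurable lebesgue"
    "(\<lambda>z. T (snd z) (fst z)) \<in> borel_measurable lebesgue"
    using bm bm' by (auto intro: borel_measurable_lebesgueI)
  note [measurable] = open_cross_domain[OF \<Omega>]
  define dv where "dv = (\<lambda>(x, y). \<bar>v x - v y\<bar> powr p * Ksp x y + a x y * \<bar>v x - v y\<bar> powr q * Ktq x y)"
  define du where "du = (\<lambda>(x, y). \<bar>u x - u y\<bar> powr p * Ksp x y + a x y * \<bar>u x - u y\<bar> powr q * Ktq x y)"
  have [measurable]: "dv \<in> borel_measurable lebesgue" "du \<in> borel_measurable lebesgue"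
    unfolding dv_def du_def using measurable_energy_integrand[OF _ a(3) ker] vm u by blast+
  have K0: "0 \<le> Ksp x y" "0 \<le> Ktq x y" for x y using ker by (auto simp: comparable_kernel_def)
  have d0: "0 \<le> dv z" "0 \<le> du z" for z
    using K0 a(1) by (auto simp: dv_def du_def split_beta)
  have w0: "0 \<le> w x" for x by (simp add: w_def)
  have n0: "0 \<le> S x y" "0 \<le> E x y" "0 \<le> T x y" for x y
    unfolding S_def E_def T_def gain_density_def cutoff_error_density_def tail_error_density_def using a(1) w0
    by (auto intro!: phase_density_nonneg mult_nonneg_nonneg add_nonneg_nonneg)
  have \<Lambda>0: "0 \<le> \<Lambda>" "0 \<le> q" using \<Lambda> pq by auto
  have main: "dv (x, y) + inverse \<Lambda> * S x y \<le> du (x, y) + (\<Lambda> * q powr q * E x y + (\<Lambda> * q * T x y + \<Lambda> * q * T y x))" for x y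
    using cutoff_density_comparison[OF pq \<Lambda> ker a(1,2) k \<psi> \<psi>1 \<psi>0 sub(1,2), where u = u and x = x and y = y]
    unfolding S_def E_def T_def v_def w_def dv_def du_def prod.case by (simp only: add.assoc)
  have supp: "S x y = 0" if "(x, y) \<notin> cross_domain \<Omega>" for x y
    using that sub by (auto simp: S_def gain_density_def phase_density_def cross_domain_def indicator_def)
  define I where "I = (indicator (cross_domain \<Omega>) :: _ \<Rightarrow> ennreal)"
  have [measurable]: "I \<in> borel_measurable lebesgue" unfolding I_def by measurable
  have "energy p q a Ksp Ktq \<Omega> v + ennreal (inverse \<Lambda>) * (\<integral>\<^sup>+ z. ennreal (S (fst z) (snd z)) \<partial>lborel)
    = (\<integral>\<^sup>+ z. ennreal (dv z) * I z + ennreal (inverse \<Lambda>) * ennreal (S (fst z) (snd z)) \<partial>lebesgue)"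
    unfolding energy_eq[OF \<Omega>] dv_def[symmetric] I_def[symmetric]
    by (simp add: nn_integral_add nn_integral_cmult nn_integral_completion[symmetric, where M = lborel])
  also have "\<dots> \<le> (\<integral>\<^sup>+ z. ennreal (du z) * I z + (ennreal (\<Lambda> * q powr q) * ennreal (E (fst z) (snd z))
      + (ennreal (\<Lambda> * q) * ennreal (T (fst z) (snd z)) + ennreal (\<Lambda> * q) * ennreal (T (snd z) (fst z)))) \<partial>lebesgue)"
  proof (intro nn_integral_mono)
    fix z :: "(real ^ 'n) \<times> (real ^ 'n)"
    obtain x y where z: "z = (x, y)" by fastforce
    show "ennreal (dv z) * I z + ennreal (inverse \<Lambda>) * ennreal (S (fst z) (snd z))
      \<le> ennreal (du z) * I z + (ennreal (\<Lambda> * q powr q) * ennreal (E (fst z) (snd z))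
      + (ennreal (\<Lambda> * q) * ennreal (T (fst z) (snd z)) + ennreal (\<Lambda> * q) * ennreal (T (snd z) (fst z))))"
    proof (cases "z \<in> cross_domain \<Omega>")
      case True
      have "ennreal (dv (x, y) + inverse \<Lambda> * S x y)
        \<le> ennreal (du (x, y) + (\<Lambda> * q powr q * E x y + (\<Lambda> * q * T x y + \<Lambda> * q * T y x)))"
        by (intro ennreal_leI main)
      then show ?thesis
        using True \<Lambda>0 d0 n0 by (simp add: z I_def ennreal_plus ennreal_mult)
    next
      case False
      then show ?thesis using supp[of x y] by (simp add: z I_def)
    qed
  qed
  also have "\<dots> = energy p q a Ksp Ktq \<Omega> u
      + (ennreal (\<Lambda> * q powr q) * (\<integral>\<^sup>+ z. ennreal (E (fst z) (snd z)) \<partial>lborel)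
        + (ennreal (\<Lambda> * q) * (\<integral>\<^sup>+ z. ennreal (T (fst z) (snd z)) \<partial>lborel)
          + ennreal (\<Lambda> * q) * (\<integral>\<^sup>+ z. ennreal (T (snd z) (fst z)) \<partial>lborel)))"
    unfolding energy_eq[OF \<Omega>] du_def[symmetric] I_def[symmetric]
    by (simp add: nn_integral_add nn_integral_cmult nn_integral_completion[symmetric, where M = lborel])
  also have "(\<integral>\<^sup>+ z. ennreal (T (snd z) (fst z)) \<partial>lborel) = (\<integral>\<^sup>+ z. ennreal (T (fst z) (snd z)) \<partial>lborel)"
  proof -
    have "(\<integral>\<^sup>+ z. ennreal (T (snd z) (fst z)) \<partial>lborel) = (\<integral>\<^sup>+ x. \<integral>\<^sup>+ y. ennreal (T y x) \<partial>lborel \<partial>lborel)"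
      using bm' by (subst nn_integral_lborel_iterated) auto
    also have "\<dots> = (\<integral>\<^sup>+ y. \<integral>\<^sup>+ x. ennreal (T y x) \<partial>lborel \<partial>lborel)"
      using bm' by (intro nn_integral_lborel_swap) (simp add: split_beta)
    also have "\<dots> = (\<integral>\<^sup>+ z. ennreal (T (fst z) (snd z)) \<partial>lborel)"
      using bm by (subst nn_integral_lborel_iterated) auto
    finally show ?thesis .
  qed
  also have "ennreal (\<Lambda> * q) * X + ennreal (\<Lambda> * q) * X = ennreal (2 * \<Lambda> * q) * X" for X
    using \<Lambda>0 by (simp add: distrib_right[symmetric] ennreal_plus[symmetric] del: ennreal_plus)
  finally show ?thesis .
qed

text \<open>
  If the error is infinite there is nothing to prove.  Otherwise the comparison for the pure
  kernels makes the competitor admissible, and in the comparison for the given kernels the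
  finite energies cancel by minimality.
\<close>

lemma minimizer_cutoff_estimate:
  fixes u \<psi> :: "real ^ 'n \<Rightarrow> real"
  assumes pq: "1 \<le> p" "p \<le> q" and \<Lambda>: "1 \<le> \<Lambda>"
    and ker: "comparable_kernel \<Lambda> (s * p) Ksp" "comparable_kernel \<Lambda> (t * q) Ktq"
    and a: "\<And>x y. 0 \<le> a x y" "\<And>x y. a x y = a y x" "(\<lambda>(x, y). a x y) \<in> borel_measurable borel"
    and u [measurable]: "u \<in> borel_measurable borel" and min: "minimizer p q s t a Ksp Ktq \<Omega> u"
    and k: "0 \<le> k" and \<psi>: "\<And>x. 0 \<le> \<psi> x" "\<And>x. \<psi> x \<le> 1" and \<psi>_meas [measurable]: "\<psi> \<in> borel_measurable borel"
    and \<psi>1: "\<And>x. x \<in> B1 \<Longrightarrow> \<psi> x = 1" and \<psi>0: "\<And>x. x \<notin> B2 \<Longrightarrow> \<psi> x = 0"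
    and sub: "B1 \<subseteq> B3" "B2 \<subseteq> B3" "B3 \<subseteq> \<Omega>" and \<Omega>: "open \<Omega>"
    and sets: "B1 \<in> sets borel" "B2 \<in> sets borel" "B3 \<in> sets borel"
  defines "w \<equiv> \<lambda>x. max (u x - k) 0"
  defines "S \<equiv> gain_density p q s t a B1 w"
    and "E \<equiv> cutoff_error_density p q s t a B3 \<psi> w"
    and "T \<equiv> tail_error_density p q s t a B2 B3 u w"
  shows "ennreal (inverse \<Lambda>) * (\<integral>\<^sup>+ z. ennreal (S (fst z) (snd z)) \<partial>lborel)
    \<le> ennreal (\<Lambda> * q powr q) * (\<integral>\<^sup>+ z. ennreal (E (fst z) (snd z)) \<partial>lborel)
        + ennreal (2 * \<Lambda> * q) * (\<integral>\<^sup>+ z. ennreal (T (fst z) (snd z)) \<partial>lborel)" (is "?lhs \<le> ?err")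
proof (cases "?err = \<infinity>")
  case False
  define v where "v = (\<lambda>x. cutoff_competitor k (\<psi> x powr q) (u x))"
  have vm [measurable]: "v \<in> borel_measurable borel" unfolding v_def cutoff_competitor_def by measurable
  note comparison = cutoff_energy_comparison[OF pq \<Lambda> _ _ a u k \<psi> \<psi>_meas \<psi>1 \<psi>0 sub \<Omega> sets,
      where s = s and t = t, folded v_def, folded S_def[unfolded w_def] E_def[unfolded w_def] T_def[unfolded w_def]]
  define Kp Kq where "Kp = (\<lambda>x y :: real ^ 'n. 1 / norm (x - y) powr (real CARD('n) + s * p))"
    and "Kq = (\<lambda>x y :: real ^ 'n. 1 / norm (x - y) powr (real CARD('n) + t * q))"
  have pure: "comparable_kernel \<Lambda> (s * p) Kp" "comparable_kernel \<Lambda> (t * q) Kq"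
    unfolding Kp_def Kq_def by (intro pure_kernel_comparable \<Lambda>)+
  have adm: "u \<in> admissible p q s t a \<Omega>" using min by (simp add: minimizer_def)
  have abs_le: "\<bar>v x\<bar> \<le> \<bar>u x\<bar>" for x
  proof (cases "u x \<le> k")
    case False
    have f: "0 \<le> \<psi> x powr q" "\<psi> x powr q \<le> 1" using \<psi>[of x] pq by (auto intro: powr_le1)
    define b where "b = \<psi> x powr q * max (u x - k) 0"
    have "b \<le> 1 * max (u x - k) 0" unfolding b_def using f False by (intro mult_right_mono) auto
    moreover have "0 \<le> b" unfolding b_def using f by simp
    moreover have "v x = u x - b" by (simp add: v_def cutoff_competitor_def b_def)
    ultimately show ?thesis using False k by (simp add: max_def abs_if)
  qed (simp add: v_def cutoff_competitor_def)
  have vadm: "v \<in> admissible p q s t a \<Omega>"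
    unfolding admissible_energy Kp_def[symmetric] Kq_def[symmetric]
  proof (intro conjI)
    show "v \<in> borel_measurable lebesgue" by (intro borel_measurable_lebesgueI vm)
    have "(\<integral>\<^sup>+ x. ennreal (\<bar>v x\<bar> powr p) \<partial>lebesgue_on \<Omega>) \<le> (\<integral>\<^sup>+ x. ennreal (\<bar>u x\<bar> powr p) \<partial>lebesgue_on \<Omega>)"
      using abs_le pq by (intro nn_integral_mono ennreal_leI powr_mono2) auto
    also have "\<dots> < \<infinity>" using adm by (simp add: admissible_def)
    finally show "(\<integral>\<^sup>+ x. ennreal (\<bar>v x\<bar> powr p) \<partial>lebesgue_on \<Omega>) < \<infinity>" .
    have "energy p q a Kp Kq \<Omega> v \<le> energy p q a Kp Kq \<Omega> v + ?lhs" by simp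
    also have "\<dots> \<le> energy p q a Kp Kq \<Omega> u + ?err" using comparison[OF pure] .
    also have "\<dots> < \<infinity>"
      using adm False unfolding admissible_energy Kp_def[symmetric] Kq_def[symmetric]
      by (simp add: less_top)
    finally show "energy p q a Kp Kq \<Omega> v < \<infinity>" .
  qed
  have "v x = u x" if "x \<notin> \<Omega>" for x
    using that sub \<psi>0[of x] pq by (auto simp: v_def cutoff_competitor_def)
  then have le: "energy p q a Ksp Ktq \<Omega> u \<le> energy p q a Ksp Ktq \<Omega> v"
    using min vadm by (auto simp: minimizer_def)
  have "energy p q a Ksp Ktq \<Omega> v \<le> ennreal \<Lambda> * energy p q a Kp Kq \<Omega> v"
    unfolding Kp_def Kq_def by (intro energy_le_pure vm a ker \<Lambda> \<Omega>)
  also have "\<dots> < \<infinity>"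
    using vadm unfolding admissible_energy Kp_def[symmetric] Kq_def[symmetric]
    by (simp add: ennreal_mult_less_top)
  finally have fin: "energy p q a Ksp Ktq \<Omega> v < \<infinity>" .
  have "energy p q a Ksp Ktq \<Omega> v + ?lhs \<le> energy p q a Ksp Ktq \<Omega> v + ?err"
    using comparison[OF ker] le by (meson add_right_mono order_trans)
  with fin show ?thesis by (subst (asm) ennreal_add_left_cancel_le) auto
next
  case True
  then show ?thesis by (simp only: infinity_ennreal_def top_greatest)
qed

section \<open>Error terms of the energy comparison\<close>

definition radial_cutoff :: "real ^ 'n \<Rightarrow> real \<Rightarrow> real \<Rightarrow> real ^ 'n \<Rightarrow> real" where
  "radial_cutoff x0 \<rho> \<sigma> x = max 0 (min 1 ((\<rho> + \<sigma> - dist x0 x) / \<sigma>))"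

lemma radial_cutoff:
  assumes \<sigma>: "0 < \<sigma>"
  shows "0 \<le> radial_cutoff x0 \<rho> \<sigma> x" "radial_cutoff x0 \<rho> \<sigma> x \<le> 1"
    and "x \<in> ball x0 \<rho> \<Longrightarrow> radial_cutoff x0 \<rho> \<sigma> x = 1"
    and "x \<notin> ball x0 (\<rho> + \<sigma>) \<Longrightarrow> radial_cutoff x0 \<rho> \<sigma> x = 0"
    and "\<bar>radial_cutoff x0 \<rho> \<sigma> x - radial_cutoff x0 \<rho> \<sigma> y\<bar> \<le> norm (x - y) / \<sigma>"
    and "radial_cutoff x0 \<rho> \<sigma> \<in> borel_measurable borel"
proof -
  show "0 \<le> radial_cutoff x0 \<rho> \<sigma> x" "radial_cutoff x0 \<rho> \<sigma> x \<le> 1"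
    by (auto simp: radial_cutoff_def)
  show "x \<in> ball x0 \<rho> \<Longrightarrow> radial_cutoff x0 \<rho> \<sigma> x = 1"
    using \<sigma> by (auto simp: radial_cutoff_def min_def field_simps)
  show "x \<notin> ball x0 (\<rho> + \<sigma>) \<Longrightarrow> radial_cutoff x0 \<rho> \<sigma> x = 0"
    using \<sigma> by (auto simp: radial_cutoff_def max_def min_def field_simps)
  have clamp: "\<bar>max 0 (min 1 A) - max 0 (min 1 B)\<bar> \<le> \<bar>A - B\<bar>" for A B :: real by auto
  have "\<bar>dist x0 x - dist x0 y\<bar> \<le> norm (x - y)"
    using abs_dist_diff_le[of x x0 y] by (simp add: dist_commute dist_norm)
  then have "\<bar>(\<rho> + \<sigma> - dist x0 x) / \<sigma> - (\<rho> + \<sigma> - dist x0 y) / \<sigma>\<bar> \<le> norm (x - y) / \<sigma>"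
    using \<sigma> by (simp add: diff_divide_distrib[symmetric] divide_right_mono abs_minus_commute)
  then show "\<bar>radial_cutoff x0 \<rho> \<sigma> x - radial_cutoff x0 \<rho> \<sigma> y\<bar> \<le> norm (x - y) / \<sigma>"
    unfolding radial_cutoff_def using clamp order_trans by blast
  show "radial_cutoff x0 \<rho> \<sigma> \<in> borel_measurable borel"
    unfolding radial_cutoff_def[abs_def] by measurable
qed

text \<open>
  By symmetry of the kernel both summands contribute the same, and the inner integral is a Riesz
  potential over a ball of radius at most \<open>2 R\<close>.
\<close>

lemma riesz_pair_bound:
  fixes f :: "real ^ 'n \<Rightarrow> real"
  assumes [measurable]: "f \<in> borel_measurable borel" and f0: "\<And>x. 0 \<le> f x"
    and C: "\<And>(x :: real ^ 'n) R. 0 < R \<Longrightarrow> (\<integral>\<^sup>+ y\<in>ball x R. ennreal (norm (x - y) powr (\<gamma> - real CARD('n))) \<partial>lborel) \<le> ennreal (C * R powr \<gamma>)"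
    and C0: "0 \<le> C" and R: "0 < R"
  shows "(\<integral>\<^sup>+ z. ennreal (indicator (ball x0 R) (fst z) * indicator (ball x0 R) (snd z)
      * ((f (fst z) + f (snd z)) * norm (fst z - snd z) powr (\<gamma> - real CARD('n)))) \<partial>lborel)
    \<le> ennreal (2 * C * (2 * R) powr \<gamma>) * (\<integral>\<^sup>+ x\<in>ball x0 R. ennreal (f x) \<partial>lborel)"
proof -
  define B where "B = ball x0 R"
  have [measurable]: "B \<in> sets borel" by (simp add: B_def)
  define g where "g x y = norm (x - y) powr (\<gamma> - real CARD('n))" for x y :: "real ^ 'n"
  have [measurable]: "(\<lambda>z. g (fst z) (snd z)) \<in> borel_measurable (borel \<Otimes>\<^sub>M borel)"
    "(\<lambda>z. g (snd z) (fst z)) \<in> borel_measurable (borel \<Otimes>\<^sub>M borel)" "(\<lambda>y. g x y) \<in> borel_measurable borel" for x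
    unfolding g_def by measurable
  define P where "P z = ennreal (f (fst z)) * indicator B (fst z) * (ennreal (g (fst z) (snd z)) * indicator B (snd z))" for z
  have mP [measurable]: "P \<in> borel_measurable (borel \<Otimes>\<^sub>M borel)" unfolding P_def by measurable
  have mP': "(\<lambda>z. P (snd z, fst z)) \<in> borel_measurable (borel \<Otimes>\<^sub>M borel)"
    unfolding P_def fst_conv snd_conv by measurable
  have half: "(\<integral>\<^sup>+ x. \<integral>\<^sup>+ y. P (x, y) \<partial>lborel \<partial>lborel) \<le> ennreal (C * (2 * R) powr \<gamma>) * (\<integral>\<^sup>+ x\<in>B. ennreal (f x) \<partial>lborel)"
  proof -
    have "(\<integral>\<^sup>+ x. \<integral>\<^sup>+ y. P (x, y) \<partial>lborel \<partial>lborel)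
        = (\<integral>\<^sup>+ x. (ennreal (f x) * indicator B x) * (\<integral>\<^sup>+ y\<in>B. ennreal (g x y) \<partial>lborel) \<partial>lborel)"
      unfolding P_def fst_conv snd_conv by (intro nn_integral_cong nn_integral_cmult) measurable
    also have "\<dots> \<le> (\<integral>\<^sup>+ x. (ennreal (f x) * indicator B x) * ennreal (C * (2 * R) powr \<gamma>) \<partial>lborel)"
    proof (intro nn_integral_mono)
      fix x
      show "(ennreal (f x) * indicator B x) * (\<integral>\<^sup>+ y\<in>B. ennreal (g x y) \<partial>lborel)
        \<le> (ennreal (f x) * indicator B x) * ennreal (C * (2 * R) powr \<gamma>)"
      proof (cases "x \<in> B")
        case True
        have "B \<subseteq> ball x (2 * R)"
        proof
          fix y assume "y \<in> B"
          with True show "y \<in> ball x (2 * R)"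
            using dist_triangle3[of x y x0] by (simp add: B_def)
        qed
        then have "(\<integral>\<^sup>+ y\<in>B. ennreal (g x y) \<partial>lborel) \<le> (\<integral>\<^sup>+ y\<in>ball x (2 * R). ennreal (g x y) \<partial>lborel)"
          by (intro nn_integral_mono mult_left_mono) (auto simp: indicator_def)
        also have "\<dots> \<le> ennreal (C * (2 * R) powr \<gamma>)"
          unfolding g_def using R by (intro C) simp
        finally show ?thesis by (intro mult_left_mono) auto
      qed simp
    qed
    also have "\<dots> = ennreal (C * (2 * R) powr \<gamma>) * (\<integral>\<^sup>+ x\<in>B. ennreal (f x) \<partial>lborel)"
      by (subst nn_integral_multc) (measurable, simp add: mult.commute)
    finally show ?thesis .
  qed
  have "(\<integral>\<^sup>+ z. ennreal (indicator B (fst z) * indicator B (snd z) * ((f (fst z) + f (snd z)) * g (fst z) (snd z))) \<partial>lborel)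
      = (\<integral>\<^sup>+ z. P z + P (snd z, fst z) \<partial>lborel)"
    using f0 by (intro nn_integral_cong)
      (auto simp: P_def g_def indicator_def norm_minus_commute distrib_right ennreal_mult)
  also have "\<dots> = (\<integral>\<^sup>+ z. P z \<partial>lborel) + (\<integral>\<^sup>+ z. P (snd z, fst z) \<partial>lborel)"
    using mP mP' by (intro nn_integral_add) (simp_all add: borel_prod)
  also have "(\<integral>\<^sup>+ z. P (snd z, fst z) \<partial>lborel) = (\<integral>\<^sup>+ x. \<integral>\<^sup>+ y. P (y, x) \<partial>lborel \<partial>lborel)"
    using mP' by (subst nn_integral_lborel_iterated) (auto simp: borel_prod)
  also have "\<dots> = (\<integral>\<^sup>+ x. \<integral>\<^sup>+ y. P (x, y) \<partial>lborel \<partial>lborel)"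
    using mP' by (intro nn_integral_lborel_swap) (auto simp: borel_prod split_beta)
  also have "(\<integral>\<^sup>+ z. P z \<partial>lborel) = (\<integral>\<^sup>+ x. \<integral>\<^sup>+ y. P (x, y) \<partial>lborel \<partial>lborel)"
    using mP by (subst nn_integral_lborel_iterated) (auto simp: borel_prod)
  also have "(\<integral>\<^sup>+ x. \<integral>\<^sup>+ y. P (x, y) \<partial>lborel \<partial>lborel) + (\<integral>\<^sup>+ x. \<integral>\<^sup>+ y. P (x, y) \<partial>lborel \<partial>lborel)
      \<le> ennreal (C * (2 * R) powr \<gamma>) * (\<integral>\<^sup>+ x\<in>B. ennreal (f x) \<partial>lborel)
        + ennreal (C * (2 * R) powr \<gamma>) * (\<integral>\<^sup>+ x\<in>B. ennreal (f x) \<partial>lborel)"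
    by (intro add_mono half)
  also have "\<dots> = ennreal (2 * C * (2 * R) powr \<gamma>) * (\<integral>\<^sup>+ x\<in>B. ennreal (f x) \<partial>lborel)"
    using C0 by (simp add: distrib_right[symmetric] ennreal_plus[symmetric] del: ennreal_plus)
  finally show ?thesis by (simp add: B_def g_def)
qed

text \<open>
  The cutoff has Lipschitz constant \<open>1 / \<sigma>\<close>, so that the singular kernel of
  order \<open>n + s p\<close> improves to the locally integrable order \<open>n + s p -
  p\<close>.  All powers of \<open>r / \<sigma>\<close> are bounded by the common exponent
  \<open>n + q\<close>.
\<close>

lemma cutoff_error_bound:
  fixes p q s t :: real
  assumes st: "0 < s" "s < 1" "0 < t" "t < 1" and pq: "1 \<le> p" "p \<le> q"
  shows "\<exists>C>0. \<forall>(w :: real ^ 'n \<Rightarrow> real) \<psi> a (x0 :: real ^ 'n) r R \<sigma> aplus.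
    w \<in> borel_measurable borel \<and> (\<forall>x. 0 \<le> w x) \<and> (\<forall>x y. 0 \<le> a x y) \<and>
    0 < R \<and> R \<le> r \<and> 0 < \<sigma> \<and> \<sigma> \<le> r \<and>
    (\<forall>x y. \<bar>\<psi> x - \<psi> y\<bar> \<le> norm (x - y) / \<sigma>) \<and> (\<forall>x\<in>ball x0 R. \<forall>y\<in>ball x0 R. a x y \<le> aplus) \<longrightarrow>
    (\<integral>\<^sup>+ z. ennreal (cutoff_error_density p q s t a (ball x0 R) \<psi> w
          (fst z) (snd z)) \<partial>lborel)
    \<le> ennreal (C * (r / \<sigma>) powr (real CARD('n) + q))
      * (\<integral>\<^sup>+ x\<in>ball x0 R. ennreal (w x powr p / r powr (s * p) + aplus * (w x powr q / r powr (t * q))) \<partial>lborel)"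
proof -
  have pos: "0 < p * (1 - s)" "0 < q * (1 - t)" using st pq by auto
  obtain Cp where Cp: "0 < Cp" and Cp': "\<And>(x :: real ^ 'n) R. 0 < R \<Longrightarrow>
      (\<integral>\<^sup>+ y\<in>ball x R. ennreal (norm (x - y) powr (p * (1 - s) - real CARD('n))) \<partial>lborel) \<le> ennreal (Cp * R powr (p * (1 - s)))"
    using riesz_kernel_ball_bound[OF pos(1), where 'n = 'n] by auto
  obtain Cq where Cq: "0 < Cq" and Cq': "\<And>(x :: real ^ 'n) R. 0 < R \<Longrightarrow>
      (\<integral>\<^sup>+ y\<in>ball x R. ennreal (norm (x - y) powr (q * (1 - t) - real CARD('n))) \<partial>lborel) \<le> ennreal (Cq * R powr (q * (1 - t)))"
    using riesz_kernel_ball_bound[OF pos(2), where 'n = 'n] by auto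
  define C where "C = 2 * (Cp + Cq) * 2 powr q"
  have C0: "0 < C" using Cp Cq by (simp add: C_def)
  show ?thesis
  proof (rule exI[of _ C], intro conjI C0 allI impI; elim conjE)
    fix w \<psi> :: "real ^ 'n \<Rightarrow> real" and a :: "real ^ 'n \<Rightarrow> real ^ 'n \<Rightarrow> real" and x0 :: "real ^ 'n" and r R \<sigma> aplus :: real
    assume wm [measurable]: "w \<in> borel_measurable borel" and w0: "\<forall>x. 0 \<le> w x" and a0: "\<forall>x y. 0 \<le> a x y"
      and R: "0 < R" "R \<le> r" and \<sigma>: "0 < \<sigma>" "\<sigma> \<le> r"
      and lip: "\<forall>x y. \<bar>\<psi> x - \<psi> y\<bar> \<le> norm (x - y) / \<sigma>"
      and ap: "\<forall>x\<in>ball x0 R. \<forall>y\<in>ball x0 R. a x y \<le> aplus"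
    have ap0: "0 \<le> aplus"
    proof -
      have "x0 \<in> ball x0 R" using R by simp
      then have "a x0 x0 \<le> aplus" using ap by blast
      with a0 show ?thesis using order_trans by blast
    qed
    define B where "B = ball x0 R"
    have [measurable]: "B \<in> sets borel" by (simp add: B_def)
    have kernel: "\<bar>\<psi> x - \<psi> y\<bar> powr e / norm (x - y) powr (real CARD('n) + \<tau> * e)
        \<le> \<sigma> powr (- e) * norm (x - y) powr (e * (1 - \<tau>) - real CARD('n))" if "0 \<le> e" for x y e \<tau>
    proof (cases "x = y")
      case False
      have "\<bar>\<psi> x - \<psi> y\<bar> powr e \<le> (norm (x - y) / \<sigma>) powr e"
        using lip that by (intro powr_mono2) auto
      then have "\<bar>\<psi> x - \<psi> y\<bar> powr e / norm (x - y) powr (real CARD('n) + \<tau> * e)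
          \<le> (norm (x - y) / \<sigma>) powr e / norm (x - y) powr (real CARD('n) + \<tau> * e)"
        by (intro divide_right_mono) auto
      also have "\<dots> = \<sigma> powr (- e) * norm (x - y) powr (e * (1 - \<tau>) - real CARD('n))"
      proof -
        define N where "N = norm (x - y)"
        have N: "0 < N" using False by (simp add: N_def)
        have "(N / \<sigma>) powr e / N powr (real CARD('n) + \<tau> * e) = \<sigma> powr (- e) * (N powr e / N powr (real CARD('n) + \<tau> * e))"
          using N \<sigma> by (simp add: powr_divide powr_minus field_simps)
        also have "N powr e / N powr (real CARD('n) + \<tau> * e) = N powr (e - (real CARD('n) + \<tau> * e))"
          using N by (simp add: powr_diff)
        also have "e - (real CARD('n) + \<tau> * e) = e * (1 - \<tau>) - real CARD('n)" by (simp add: algebra_simps)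
        finally show ?thesis by (simp add: N_def)
      qed
      finally show ?thesis .
    qed simp
    define G where "G e \<tau> z = indicator B (fst z) * indicator B (snd z)
      * ((w (fst z) powr e + w (snd z) powr e) * norm (fst z - snd z) powr (e * (1 - \<tau>) - real CARD('n)))"
      for e \<tau> and z :: "(real ^ 'n) \<times> (real ^ 'n)"
    have G0: "0 \<le> G e \<tau> z" for e \<tau> z by (simp add: G_def)
    have "(\<lambda>z. G e \<tau> z) \<in> borel_measurable (borel \<Otimes>\<^sub>M borel)" for e \<tau> unfolding G_def by measurable
    then have [measurable]: "G e \<tau> \<in> borel_measurable borel" for e \<tau> by (simp add: borel_prod)
    have pw: "cutoff_error_density p q s t a B \<psi> w
          (fst z) (snd z) \<le> \<sigma> powr (- p) * G p s z + aplus * \<sigma> powr (- q) * G q t z" for z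
    proof (cases "fst z \<in> B \<and> snd z \<in> B")
      case True
      let ?x = "fst z" and ?y = "snd z"
      have 1: "(w ?x powr p + w ?y powr p) * (\<bar>\<psi> ?x - \<psi> ?y\<bar> powr p / norm (?x - ?y) powr (real CARD('n) + s * p))
          \<le> (w ?x powr p + w ?y powr p) * (\<sigma> powr (- p) * norm (?x - ?y) powr (p * (1 - s) - real CARD('n)))"
        using pq by (intro mult_left_mono kernel) auto
      have 2: "a ?x ?y * ((w ?x powr q + w ?y powr q) * (\<bar>\<psi> ?x - \<psi> ?y\<bar> powr q / norm (?x - ?y) powr (real CARD('n) + t * q)))
          \<le> aplus * ((w ?x powr q + w ?y powr q) * (\<sigma> powr (- q) * norm (?x - ?y) powr (q * (1 - t) - real CARD('n))))"
        using pq True ap a0 ap0 by (intro mult_mono mult_left_mono kernel mult_nonneg_nonneg) (auto simp: B_def)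
      show ?thesis using add_mono[OF 1 2] True
        by (simp add: cutoff_error_density_def phase_density_def G_def mult_ac)
    next
      case False
      then show ?thesis by (auto simp: cutoff_error_density_def phase_density_def G_def)
    qed
    define Q where "Q = (r / \<sigma>) powr (real CARD('n) + q)"
    have scale: "2 * c * (2 * R) powr (e * (1 - \<tau>)) * \<sigma> powr (- e) \<le> C * Q / r powr (\<tau> * e)"
      if "0 < c" "c \<le> Cp + Cq" "1 \<le> e" "e \<le> q" "0 < \<tau>" "\<tau> < 1" for c e \<tau>
    proof -
      have "(2 * R) powr (e * (1 - \<tau>)) * \<sigma> powr (- e) \<le> (2 * r) powr (e * (1 - \<tau>)) * \<sigma> powr (- e)"
        using that R by (intro mult_right_mono powr_mono2) auto
      also have "\<dots> = 2 powr (e * (1 - \<tau>)) * ((r / \<sigma>) powr e / r powr (\<tau> * e))"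
      proof -
        have "r powr (e * (1 - \<tau>)) = r powr e / r powr (\<tau> * e)"
          using R by (simp add: right_diff_distrib powr_diff mult.commute)
        then show ?thesis
          using R \<sigma> by (simp add: powr_mult powr_divide powr_minus field_simps)
      qed
      also have "\<dots> \<le> 2 powr q * (Q / r powr (\<tau> * e))"
      proof (intro mult_mono powr_mono divide_right_mono)
        have "e * (1 - \<tau>) \<le> e * 1" using that by (intro mult_left_mono) auto
        then show "e * (1 - \<tau>) \<le> q" using that by linarith
        show "(r / \<sigma>) powr e \<le> Q"
          unfolding Q_def using that R \<sigma> by (intro powr_mono) auto
      qed auto
      finally have h: "(2 * R) powr (e * (1 - \<tau>)) * \<sigma> powr (- e) \<le> 2 powr q * (Q / r powr (\<tau> * e))" .
      have "2 * c * ((2 * R) powr (e * (1 - \<tau>)) * \<sigma> powr (- e)) \<le> 2 * (Cp + Cq) * (2 powr q * (Q / r powr (\<tau> * e)))"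
        by (rule mult_mono[OF _ h]) (use that Cp Cq in auto)
      then show ?thesis by (simp add: C_def mult_ac)
    qed
    have int: "(\<integral>\<^sup>+ z. ennreal (\<sigma> powr (- e) * G e \<tau> z) \<partial>lborel)
        \<le> ennreal (C * Q) * (\<integral>\<^sup>+ x\<in>B. ennreal (w x powr e / r powr (\<tau> * e)) \<partial>lborel)"
      if c: "0 < c" "c \<le> Cp + Cq" and e: "1 \<le> e" "e \<le> q" "0 < \<tau>" "\<tau> < 1"
        and bd: "\<And>(x :: real ^ 'n) R. 0 < R \<Longrightarrow>
      (\<integral>\<^sup>+ y\<in>ball x R. ennreal (norm (x - y) powr (e * (1 - \<tau>) - real CARD('n))) \<partial>lborel) \<le> ennreal (c * R powr (e * (1 - \<tau>)))"
      for c e \<tau>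
    proof -
      have "(\<integral>\<^sup>+ z. ennreal (\<sigma> powr (- e) * G e \<tau> z) \<partial>lborel) = ennreal (\<sigma> powr (- e)) * (\<integral>\<^sup>+ z. ennreal (G e \<tau> z) \<partial>lborel)"
        using G0 by (simp add: ennreal_mult nn_integral_cmult)
      also have "\<dots> \<le> ennreal (\<sigma> powr (- e)) * (ennreal (2 * c * (2 * R) powr (e * (1 - \<tau>))) * (\<integral>\<^sup>+ x\<in>B. ennreal (w x powr e) \<partial>lborel))"
        unfolding G_def B_def using c R bd
        by (intro mult_left_mono riesz_pair_bound) auto
      also have "\<dots> = ennreal (2 * c * (2 * R) powr (e * (1 - \<tau>)) * \<sigma> powr (- e)) * (\<integral>\<^sup>+ x\<in>B. ennreal (w x powr e) \<partial>lborel)"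
      proof -
        have "ennreal (2 * c * (2 * R) powr (e * (1 - \<tau>)) * \<sigma> powr (- e))
            = ennreal (\<sigma> powr (- e)) * ennreal (2 * c * (2 * R) powr (e * (1 - \<tau>)))"
          using c by (subst ennreal_mult[symmetric]) (auto simp: mult.commute)
        then show ?thesis by (simp only: mult.assoc)
      qed
      also have "\<dots> \<le> ennreal (C * Q / r powr (\<tau> * e)) * (\<integral>\<^sup>+ x\<in>B. ennreal (w x powr e) \<partial>lborel)"
        by (intro mult_right_mono ennreal_leI scale c e) auto
      also have "\<dots> = (\<integral>\<^sup>+ x. ennreal (C * Q / r powr (\<tau> * e)) * (ennreal (w x powr e) * indicator B x) \<partial>lborel)"
        by (subst nn_integral_cmult) auto
      also have "\<dots> = (\<integral>\<^sup>+ x. ennreal (C * Q) * (ennreal (w x powr e / r powr (\<tau> * e)) * indicator B x) \<partial>lborel)"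
        using C0 by (intro nn_integral_cong) (simp add: Q_def ennreal_mult[symmetric] mult.assoc[symmetric])
      also have "\<dots> = ennreal (C * Q) * (\<integral>\<^sup>+ x\<in>B. ennreal (w x powr e / r powr (\<tau> * e)) \<partial>lborel)"
        by (subst nn_integral_cmult) auto
      finally show ?thesis .
    qed
    have "(\<integral>\<^sup>+ z. ennreal (cutoff_error_density p q s t a B \<psi> w
          (fst z) (snd z)) \<partial>lborel)
      \<le> (\<integral>\<^sup>+ z. ennreal (\<sigma> powr (- p) * G p s z) + ennreal aplus * ennreal (\<sigma> powr (- q) * G q t z) \<partial>lborel)"
      using G0 ap0 pw by (intro nn_integral_mono) (simp add: ennreal_mult[symmetric] ennreal_plus[symmetric] mult.assoc ennreal_leI del: ennreal_plus)
    also have "\<dots> = (\<integral>\<^sup>+ z. ennreal (\<sigma> powr (- p) * G p s z) \<partial>lborel) + ennreal aplus * (\<integral>\<^sup>+ z. ennreal (\<sigma> powr (- q) * G q t z) \<partial>lborel)"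
      by (simp add: nn_integral_add nn_integral_cmult)
    also have "\<dots> \<le> ennreal (C * Q) * (\<integral>\<^sup>+ x\<in>B. ennreal (w x powr p / r powr (s * p)) \<partial>lborel)
        + ennreal aplus * (ennreal (C * Q) * (\<integral>\<^sup>+ x\<in>B. ennreal (w x powr q / r powr (t * q)) \<partial>lborel))"
    proof (intro add_mono mult_left_mono)
      show "(\<integral>\<^sup>+ z. ennreal (\<sigma> powr (- p) * G p s z) \<partial>lborel)
          \<le> ennreal (C * Q) * (\<integral>\<^sup>+ x\<in>B. ennreal (w x powr p / r powr (s * p)) \<partial>lborel)"
        by (rule int[OF Cp _ _ _ _ _ Cp']) (use Cq pq st in auto)
      show "(\<integral>\<^sup>+ z. ennreal (\<sigma> powr (- q) * G q t z) \<partial>lborel)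
          \<le> ennreal (C * Q) * (\<integral>\<^sup>+ x\<in>B. ennreal (w x powr q / r powr (t * q)) \<partial>lborel)"
        by (rule int[OF Cq _ _ _ _ _ Cq']) (use Cp pq st in auto)
    qed auto
    also have "\<dots> = ennreal (C * Q) * (\<integral>\<^sup>+ x. ennreal (w x powr p / r powr (s * p)) * indicator B x
        + ennreal aplus * (ennreal (w x powr q / r powr (t * q)) * indicator B x) \<partial>lborel)"
      by (simp add: nn_integral_add nn_integral_cmult distrib_left mult.left_commute)
    also have "(\<integral>\<^sup>+ x. ennreal (w x powr p / r powr (s * p)) * indicator B x
        + ennreal aplus * (ennreal (w x powr q / r powr (t * q)) * indicator B x) \<partial>lborel)
      = (\<integral>\<^sup>+ x\<in>B. ennreal (w x powr p / r powr (s * p) + aplus * (w x powr q / r powr (t * q))) \<partial>lborel)"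
      using ap0 by (intro nn_integral_cong) (auto simp: indicator_def ennreal_mult[symmetric] ennreal_plus[symmetric] simp del: ennreal_plus)
    finally show "(\<integral>\<^sup>+ z. ennreal (cutoff_error_density p q s t a (ball x0 R) \<psi> w
          (fst z) (snd z)) \<partial>lborel)
    \<le> ennreal (C * (r / \<sigma>) powr (real CARD('n) + q))
      * (\<integral>\<^sup>+ x\<in>ball x0 R. ennreal (w x powr p / r powr (s * p) + aplus * (w x powr q / r powr (t * q))) \<partial>lborel)"
      by (simp add: B_def Q_def)
  qed
qed

text \<open>
  For \<open>x\<close> in the support of the cutoff and \<open>y\<close> outside the larger
  ball, \<open>norm (x - y)\<close> is at least \<open>\<sigma> / r\<close> times \<open>norm (y
  - x0)\<close>, which turns the inner integral into the tail centred at \<open>x0\<close>.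
\<close>

lemma tail_error_bound:
  fixes u w :: "real ^ 'n \<Rightarrow> real"
  assumes [measurable]: "u \<in> borel_measurable borel" "w \<in> borel_measurable borel" and w0: "\<And>x. 0 \<le> w x"
    and a: "\<And>x y. 0 \<le> a x y" "\<And>x y. a x y = a y x" "(\<lambda>(x, y). a x y) \<in> borel_measurable borel"
    and st: "0 < s" "s < 1" "0 < t" "t < 1" and pq: "1 \<le> p" "p \<le> q"
    and \<sigma>: "0 < \<sigma>" and R: "r / 2 \<le> \<rho> + 2 * \<sigma>" "\<rho> + 2 * \<sigma> \<le> r" and \<rho>: "0 < \<rho>"
  shows "(\<integral>\<^sup>+ z. ennreal (tail_error_density p q s t a (ball x0 (\<rho> + \<sigma>)) (ball x0 (\<rho> + 2 * \<sigma>)) u w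
          (fst z) (snd z)) \<partial>lborel)
    \<le> ennreal ((r / \<sigma>) powr (real CARD('n) + q)) *
      (nonlocal_tail p q s t a (\<lambda>x. max (u x) 0) x0 r (r / 2) * (\<integral>\<^sup>+ x\<in>ball x0 (\<rho> + 2 * \<sigma>). ennreal (w x) \<partial>lborel))"
proof -
  define B2 B3 where "B2 = ball x0 (\<rho> + \<sigma>)" and "B3 = ball x0 (\<rho> + 2 * \<sigma>)"
  have [measurable]: "B2 \<in> sets borel" "B3 \<in> sets borel" by (auto simp: B2_def B3_def)
  have r: "0 < r" "\<sigma> \<le> r" using \<sigma> R \<rho> by auto
  define T where "T = tail_error_density p q s t a B2 B3 u w"
  have "(\<lambda>z. T (fst z) (snd z)) \<in> borel_measurable (borel \<Otimes>\<^sub>M borel)"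
    unfolding T_def tail_error_density_def by (intro phase_density_product_measurable a(3); measurable)
  then have Tm: "(\<lambda>z. T (fst z) (snd z)) \<in> borel_measurable borel" by (simp add: borel_prod)
  define Q where "Q = (r / \<sigma>) powr (real CARD('n) + q)"
  define tail where "tail = nonlocal_tail p q s t a (\<lambda>x. max (u x) 0) x0 r (r / 2)"
  define tp where "tp y = max (u y) 0 powr (p - 1) / norm (y - x0) powr (real CARD('n) + s * p)" for y
  define tq where "tq x y = a y x * (max (u y) 0 powr (q - 1) / norm (y - x0) powr (real CARD('n) + t * q))" for x y
  have [measurable]: "tp \<in> borel_measurable borel" unfolding tp_def by measurable
  have am: "(\<lambda>y. a y x) \<in> borel_measurable borel" for x
    using measurable_compose[OF _ a(3), of "\<lambda>y. (y, x)" borel] by (simp add: borel_prod[symmetric])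
  have [measurable]: "(\<lambda>y. tq x y) \<in> borel_measurable borel" for x
    unfolding tq_def using am[of x] by measurable
  have t0: "0 \<le> tp y" "0 \<le> tq x y" for x y using a(1) by (auto simp: tp_def tq_def)
  have far: "1 / norm (x - y) powr (real CARD('n) + \<tau> * e) \<le> Q / norm (y - x0) powr (real CARD('n) + \<tau> * e)"
    if xy: "x \<in> B2" "y \<notin> B3" and e: "1 \<le> e" "e \<le> q" "0 < \<tau>" "\<tau> < 1" for x y e \<tau>
  proof -
    define d where "d = norm (y - x0)"
    have d: "\<rho> + 2 * \<sigma> \<le> d" using xy by (simp add: B3_def d_def dist_norm norm_minus_commute)
    have dx: "norm (x - x0) \<le> \<rho> + \<sigma>" using xy by (simp add: B2_def dist_norm norm_minus_commute)
    have "(\<rho> + 2 * \<sigma>) * (1 - \<sigma> / r) \<le> d * (1 - \<sigma> / r)"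
      using d r by (intro mult_right_mono) auto
    moreover have "(\<rho> + 2 * \<sigma>) * (\<sigma> / r) \<le> r * (\<sigma> / r)"
      using R r \<sigma> by (intro mult_right_mono) auto
    then have "(\<rho> + 2 * \<sigma>) * (\<sigma> / r) \<le> \<sigma>" using r by simp
    ultimately have "\<rho> + \<sigma> \<le> d - d * (\<sigma> / r)" by (simp add: algebra_simps)
    moreover have "d \<le> norm (x - y) + norm (x - x0)"
      unfolding d_def using norm_triangle_ineq4[of "x - x0" "x - y"] by simp
    ultimately have le: "d * (\<sigma> / r) \<le> norm (x - y)" using dx by linarith
    have dpos: "0 < d" using d \<rho> \<sigma> by linarith
    define c where "c = real CARD('n) + \<tau> * e"
    have c: "0 < c" "c \<le> real CARD('n) + q"
    proof -
      have "\<tau> * e \<le> 1 * e" using e by (intro mult_right_mono) auto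
      with e have "\<tau> * e \<le> q" by linarith
      then show "0 < c" "c \<le> real CARD('n) + q" using e by (auto simp: c_def add_pos_pos)
    qed
    have "(d * (\<sigma> / r)) powr c \<le> norm (x - y) powr c"
      using le dpos \<sigma> r c by (intro powr_mono2) auto
    then have "1 / norm (x - y) powr c \<le> 1 / (d * (\<sigma> / r)) powr c"
      using dpos \<sigma> r by (intro divide_left_mono) (auto simp: zero_less_mult_iff)
    also have "\<dots> = (r / \<sigma>) powr c / d powr c"
      using dpos \<sigma> r by (simp add: powr_mult powr_divide)
    also have "\<dots> \<le> Q / d powr c"
      unfolding Q_def using c r \<sigma> by (intro divide_right_mono powr_mono) auto
    finally show ?thesis by (simp add: c_def d_def)
  qed
  have pw: "ennreal (T x y) \<le> (ennreal Q * (ennreal (w x) * indicator B3 x)) *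
      (ennreal (tp y) * indicator (- ball x0 (r / 2)) y + ennreal (tq x y) * indicator (- ball x0 (r / 2)) y)" for x y
  proof (cases "x \<in> B2 \<and> y \<notin> B3")
    case True
    then have sub: "x \<in> B3" "y \<notin> ball x0 (r / 2)" using \<sigma> R by (auto simp: B2_def B3_def)
    have "T x y = w x * max (u y) 0 powr (p - 1) * (1 / norm (x - y) powr (real CARD('n) + s * p))
        + w x * (a y x * max (u y) 0 powr (q - 1)) * (1 / norm (x - y) powr (real CARD('n) + t * q))"
      using True by (simp add: T_def tail_error_density_def phase_density_def a(2)[of x y] mult_ac)
    also have "\<dots> \<le> w x * max (u y) 0 powr (p - 1) * (Q / norm (y - x0) powr (real CARD('n) + s * p))
        + w x * (a y x * max (u y) 0 powr (q - 1)) * (Q / norm (y - x0) powr (real CARD('n) + t * q))"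
      using True pq st w0 a(1) by (intro add_mono mult_left_mono far) auto
    also have "\<dots> = Q * w x * (tp y + tq x y)"
      by (simp add: tp_def tq_def algebra_simps)
    finally have "ennreal (T x y) \<le> ennreal (Q * w x * (tp y + tq x y))" by (rule ennreal_leI)
    also have "\<dots> = ennreal Q * ennreal (w x) * (ennreal (tp y) + ennreal (tq x y))"
      using w0[of x] t0(1)[of y] t0(2)[of x y] by (simp add: ennreal_mult Q_def)
    finally show ?thesis using sub by simp
  next
    case False
    then show ?thesis by (auto simp: T_def tail_error_density_def phase_density_def)
  qed
  have tl: "(\<integral>\<^sup>+ y. ennreal (tp y) * indicator (- ball x0 (r / 2)) y + ennreal (tq x y) * indicator (- ball x0 (r / 2)) y \<partial>lborel) \<le> tail"
    if "x \<in> ball x0 r" for x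
  proof -
    have "(\<integral>\<^sup>+ y. ennreal (tp y) * indicator (- ball x0 (r / 2)) y + ennreal (tq x y) * indicator (- ball x0 (r / 2)) y \<partial>lborel)
      = (\<integral>\<^sup>+ y. ennreal (tp y) \<partial>lebesgue_on (- ball x0 (r / 2))) + (\<integral>\<^sup>+ y. ennreal (tq x y) \<partial>lebesgue_on (- ball x0 (r / 2)))"
      by (subst (1 2) nn_integral_lebesgue_on) (auto intro!: nn_integral_add)
    also have "\<dots> \<le> tail"
      unfolding tail_def nonlocal_tail_def tp_def tq_def
      by (intro add_left_mono SUP_upper that)
    finally show ?thesis .
  qed
  have "(\<integral>\<^sup>+ z. ennreal (T (fst z) (snd z)) \<partial>lborel) = (\<integral>\<^sup>+ x. \<integral>\<^sup>+ y. ennreal (T x y) \<partial>lborel \<partial>lborel)"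
    using Tm by (subst nn_integral_lborel_iterated) auto
  also have "\<dots> \<le> (\<integral>\<^sup>+ x. (ennreal Q * (ennreal (w x) * indicator B3 x)) * tail \<partial>lborel)"
  proof (intro nn_integral_mono)
    fix x
    have "(\<integral>\<^sup>+ y. ennreal (T x y) \<partial>lborel) \<le> (\<integral>\<^sup>+ y. (ennreal Q * (ennreal (w x) * indicator B3 x)) *
      (ennreal (tp y) * indicator (- ball x0 (r / 2)) y + ennreal (tq x y) * indicator (- ball x0 (r / 2)) y) \<partial>lborel)"
      by (intro nn_integral_mono pw)
    also have "\<dots> = (ennreal Q * (ennreal (w x) * indicator B3 x)) *
      (\<integral>\<^sup>+ y. (ennreal (tp y) * indicator (- ball x0 (r / 2)) y + ennreal (tq x y) * indicator (- ball x0 (r / 2)) y) \<partial>lborel)"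
      by (intro nn_integral_cmult) measurable
    also have "\<dots> \<le> (ennreal Q * (ennreal (w x) * indicator B3 x)) * tail"
    proof (cases "x \<in> B3")
      case True
      then have "x \<in> ball x0 r" using R by (auto simp: B3_def)
      then show ?thesis by (intro mult_left_mono tl) auto
    qed simp
    finally show "(\<integral>\<^sup>+ y. ennreal (T x y) \<partial>lborel) \<le> (ennreal Q * (ennreal (w x) * indicator B3 x)) * tail" .
  qed
  also have "\<dots> = ennreal Q * (tail * (\<integral>\<^sup>+ x\<in>B3. ennreal (w x) \<partial>lborel))"
    by (simp add: nn_integral_multc nn_integral_cmult mult_ac)
  finally show ?thesis by (simp add: T_def B2_def B3_def Q_def tail_def)
qed

section \<open>Caccioppoli inequality\<close>

lemma gagliardo_power_indicator:
  fixes u :: "real ^ 'n \<Rightarrow> real"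
  assumes "D \<in> sets borel"
  shows "gagliardo_power p s D u = (\<integral>\<^sup>+ z. ennreal (indicator D (fst z) * indicator D (snd z)
      * \<bar>u (fst z) - u (snd z)\<bar> powr p / norm (fst z - snd z) powr (real CARD('n) + s * p)) \<partial>lborel)"
proof -
  have "D \<times> D \<in> sets (borel \<Otimes>\<^sub>M borel)" using assms by (rule pair_measureI[OF assms])
  then have "D \<times> D \<in> sets borel" by (simp only: borel_prod)
  then have "D \<times> D \<in> sets lebesgue" by simp
  then show ?thesis
    unfolding gagliardo_power_def
    by (subst nn_integral_lebesgue_on) (auto simp: indicator_def split: prod.splits intro!: nn_integral_cong)
qed

text \<open>
  Here \<open>am\<close> and \<open>ap\<close> are any lower and upper bounds of the coefficient
  on the ball.  In general they differ, so the inequality does not yet close in terms of one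
  growth function.
\<close>

lemma minimizer_caccioppoli:
  fixes p q s t \<Lambda> :: real
  assumes st: "0 < s" "s < 1" "0 < t" "t < 1" and pq: "1 \<le> p" "p \<le> q" and \<Lambda>: "1 \<le> \<Lambda>"
  shows "\<exists>C>0. \<forall>(\<Omega> :: (real ^ 'n) set) Ksp Ktq a x0 r u k \<rho> \<sigma> am ap.
    open \<Omega> \<and> comparable_kernel \<Lambda> (s * p) Ksp \<and> comparable_kernel \<Lambda> (t * q) Ktq \<and>
    (\<forall>x y. 0 \<le> a x y \<and> a x y = a y x) \<and> (\<lambda>(x, y). a x y) \<in> borel_measurable borel \<and>
    u \<in> borel_measurable borel \<and> minimizer p q s t a Ksp Ktq \<Omega> u \<and> 0 \<le> k \<and>
    ball x0 r \<subseteq> \<Omega> \<and> 0 < \<rho> \<and> 0 < \<sigma> \<and> r / 2 \<le> \<rho> + 2 * \<sigma> \<and> \<rho> + 2 * \<sigma> \<le> r \<and>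
    0 \<le> am \<and> (\<forall>x\<in>ball x0 r. \<forall>y\<in>ball x0 r. am \<le> a x y \<and> a x y \<le> ap) \<longrightarrow>
    gagliardo_power p s (ball x0 \<rho>) (\<lambda>x. max (u x - k) 0)
      + ennreal am * gagliardo_power q t (ball x0 \<rho>) (\<lambda>x. max (u x - k) 0)
    \<le> ennreal (C * (r / \<sigma>) powr (real CARD('n) + q)) *
      ((\<integral>\<^sup>+ x\<in>ball x0 (\<rho> + 2 * \<sigma>). ennreal (max (u x - k) 0 powr p / r powr (s * p)
          + ap * (max (u x - k) 0 powr q / r powr (t * q))) \<partial>lborel)
       + nonlocal_tail p q s t a (\<lambda>x. max (u x) 0) x0 r (r / 2)
         * (\<integral>\<^sup>+ x\<in>ball x0 (\<rho> + 2 * \<sigma>). ennreal (max (u x - k) 0) \<partial>lborel))"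
proof -
  obtain CE where CE: "0 < CE" and CE': "\<And>(w :: real ^ 'n \<Rightarrow> real) \<psi> a x0 r R \<sigma> aplus.
    w \<in> borel_measurable borel \<and> (\<forall>x. 0 \<le> w x) \<and> (\<forall>x y. 0 \<le> a x y) \<and>
    0 < R \<and> R \<le> r \<and> 0 < \<sigma> \<and> \<sigma> \<le> r \<and>
    (\<forall>x y. \<bar>\<psi> x - \<psi> y\<bar> \<le> norm (x - y) / \<sigma>) \<and> (\<forall>x\<in>ball x0 R. \<forall>y\<in>ball x0 R. a x y \<le> aplus) \<Longrightarrow>
    (\<integral>\<^sup>+ z. ennreal (cutoff_error_density p q s t a (ball x0 R) \<psi> w
          (fst z) (snd z)) \<partial>lborel)
    \<le> ennreal (CE * (r / \<sigma>) powr (real CARD('n) + q))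
      * (\<integral>\<^sup>+ x\<in>ball x0 R. ennreal (w x powr p / r powr (s * p) + aplus * (w x powr q / r powr (t * q))) \<partial>lborel)"
    using cutoff_error_bound[OF st pq, where 'n = 'n] by (elim exE conjE) blast
  define C where "C = \<Lambda> * (\<Lambda> * q powr q * CE + 2 * \<Lambda> * q)"
  have q: "0 < q" "0 < \<Lambda>" using pq \<Lambda> by auto
  have C0: "0 < C" using q CE by (simp add: C_def add_pos_pos)
  show ?thesis
  proof (rule exI[of _ C], intro conjI C0 allI impI; elim conjE)
    fix \<Omega> :: "(real ^ 'n) set" and Ksp Ktq a and x0 :: "real ^ 'n" and r :: real and u :: "real ^ 'n \<Rightarrow> real" and k \<rho> \<sigma> am ap :: real
    assume \<Omega>: "open \<Omega>" and ker: "comparable_kernel \<Lambda> (s * p) Ksp" "comparable_kernel \<Lambda> (t * q) Ktq"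
      and a: "\<forall>x y. 0 \<le> a x y \<and> a x y = a y x" "(\<lambda>(x, y). a x y) \<in> borel_measurable borel"
      and u [measurable]: "u \<in> borel_measurable borel" and min: "minimizer p q s t a Ksp Ktq \<Omega> u"
      and k: "0 \<le> k" and sub: "ball x0 r \<subseteq> \<Omega>" and \<rho>: "0 < \<rho>" and \<sigma>: "0 < \<sigma>"
      and r: "r / 2 \<le> \<rho> + 2 * \<sigma>" "\<rho> + 2 * \<sigma> \<le> r"
      and am: "0 \<le> am" "\<forall>x\<in>ball x0 r. \<forall>y\<in>ball x0 r. am \<le> a x y \<and> a x y \<le> ap"
    define w where "w = (\<lambda>x. max (u x - k) 0)"
    have wm [measurable]: "w \<in> borel_measurable borel" unfolding w_def by measurable
    have w0: "0 \<le> w x" for x by (simp add: w_def)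
    define B1 B2 B3 where "B1 = ball x0 \<rho>" and "B2 = ball x0 (\<rho> + \<sigma>)" and "B3 = ball x0 (\<rho> + 2 * \<sigma>)"
    have sets [measurable]: "B1 \<in> sets borel" "B2 \<in> sets borel" "B3 \<in> sets borel"
      by (auto simp: B1_def B2_def B3_def)
    have subs: "B1 \<subseteq> B3" "B2 \<subseteq> B3" "B3 \<subseteq> \<Omega>" "B3 \<subseteq> ball x0 r" "B1 \<subseteq> ball x0 r"
      using sub \<sigma> r unfolding B1_def B2_def B3_def by (auto intro: subset_ball[THEN subsetD] subset_trans[OF subset_ball sub, THEN subsetD])
    define \<psi> where "\<psi> = radial_cutoff x0 \<rho> \<sigma>"
    note \<psi> = radial_cutoff[OF \<sigma>, where ?x0.0 = x0 and \<rho> = \<rho>, folded \<psi>_def B1_def B2_def]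
    define Q where "Q = (r / \<sigma>) powr (real CARD('n) + q)"
    define I where "I = (\<integral>\<^sup>+ x\<in>B3. ennreal (w x powr p / r powr (s * p) + ap * (w x powr q / r powr (t * q))) \<partial>lborel)"
    define J where "J = nonlocal_tail p q s t a (\<lambda>x. max (u x) 0) x0 r (r / 2) * (\<integral>\<^sup>+ x\<in>B3. ennreal (w x) \<partial>lborel)"
    define S where "S = gain_density p q s t a B1 w"
    define SS where "SS = (\<integral>\<^sup>+ z. ennreal (S (fst z) (snd z)) \<partial>lborel)"
    define EE where "EE = (\<integral>\<^sup>+ z. ennreal (cutoff_error_density p q s t a B3 \<psi> w
          (fst z) (snd z)) \<partial>lborel)"
    define TT where "TT = (\<integral>\<^sup>+ z. ennreal (tail_error_density p q s t a B2 B3 u w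
          (fst z) (snd z)) \<partial>lborel)"
    have a0: "\<And>x y. 0 \<le> a x y" and asym: "\<And>x y. a x y = a y x" using a(1) by blast+
    have main: "ennreal (inverse \<Lambda>) * SS \<le> ennreal (\<Lambda> * q powr q) * EE + ennreal (2 * \<Lambda> * q) * TT"
      unfolding SS_def S_def EE_def TT_def w_def
      by (rule minimizer_cutoff_estimate[OF pq \<Lambda> ker a0 asym a(2) u min k \<psi>(1,2,6,3,4) subs(1,2,3) \<Omega> sets])
    have E: "EE \<le> ennreal (CE * Q) * I"
      unfolding EE_def I_def Q_def B3_def
      using wm w0 a(1) \<rho> \<sigma> r \<psi>(5) am(2) subs(4) unfolding B3_def by (intro CE') auto
    have T: "TT \<le> ennreal Q * J"
      unfolding TT_def Q_def J_def B2_def B3_def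
      by (rule tail_error_bound[OF u wm w0 a0 asym a(2) st pq \<sigma> r \<rho>])
    have "SS = ennreal \<Lambda> * (ennreal (inverse \<Lambda>) * SS)"
      using q by (simp add: mult.assoc[symmetric] ennreal_mult[symmetric])
    also have "\<dots> \<le> ennreal \<Lambda> * (ennreal (\<Lambda> * q powr q) * (ennreal (CE * Q) * I) + ennreal (2 * \<Lambda> * q) * (ennreal Q * J))"
      by (intro mult_left_mono order_trans[OF main] add_mono E T) auto
    also have "\<dots> \<le> ennreal \<Lambda> * (ennreal (\<Lambda> * q powr q * CE + 2 * \<Lambda> * q) * (ennreal Q * I)
        + ennreal (\<Lambda> * q powr q * CE + 2 * \<Lambda> * q) * (ennreal Q * J))"
    proof (intro mult_left_mono add_mono)
      have "ennreal (\<Lambda> * q powr q) * (ennreal (CE * Q) * I) = ennreal (\<Lambda> * q powr q * CE) * (ennreal Q * I)"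
        using q CE by (simp add: ennreal_mult mult.assoc Q_def)
      also have "\<dots> \<le> ennreal (\<Lambda> * q powr q * CE + 2 * \<Lambda> * q) * (ennreal Q * I)"
        using q by (intro mult_right_mono ennreal_leI) auto
      finally show "ennreal (\<Lambda> * q powr q) * (ennreal (CE * Q) * I)
        \<le> ennreal (\<Lambda> * q powr q * CE + 2 * \<Lambda> * q) * (ennreal Q * I)" .
      show "ennreal (2 * \<Lambda> * q) * (ennreal Q * J) \<le> ennreal (\<Lambda> * q powr q * CE + 2 * \<Lambda> * q) * (ennreal Q * J)"
        using q CE by (intro mult_right_mono ennreal_leI) auto
    qed auto
    also have "\<dots> = ennreal (C * Q) * (I + J)"
    proof -
      have "ennreal (C * Q) = ennreal \<Lambda> * (ennreal (\<Lambda> * q powr q * CE + 2 * \<Lambda> * q) * ennreal Q)"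
      proof -
        define D where "D = \<Lambda> * q powr q * CE + 2 * \<Lambda> * q"
        have "0 \<le> D" using q CE by (simp add: D_def)
        then have "ennreal (\<Lambda> * D * Q) = ennreal \<Lambda> * (ennreal D * ennreal Q)"
          using q by (simp add: Q_def ennreal_mult mult.assoc)
        then show ?thesis unfolding C_def D_def .
      qed
      then show ?thesis by (simp add: distrib_left mult.assoc)
    qed
    finally have SSle: "SS \<le> ennreal (C * Q) * (I + J)" .
    define A where "A e \<tau> z = indicator B1 (fst z) * indicator B1 (snd z)
      * \<bar>w (fst z) - w (snd z)\<bar> powr e / norm (fst z - snd z) powr (real CARD('n) + \<tau> * e)" for e \<tau> z
    have "(\<lambda>z. A e \<tau> z) \<in> borel_measurable (borel \<Otimes>\<^sub>M borel)" for e \<tau> unfolding A_def by measurable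
    then have [measurable]: "A e \<tau> \<in> borel_measurable borel" for e \<tau> by (simp add: borel_prod)
    have A0: "0 \<le> A e \<tau> z" for e \<tau> z by (simp add: A_def)
    have "gagliardo_power p s B1 w + ennreal am * gagliardo_power q t B1 w
      = (\<integral>\<^sup>+ z. ennreal (A p s z) + ennreal am * ennreal (A q t z) \<partial>lborel)"
      unfolding gagliardo_power_indicator[OF sets(1)] A_def[symmetric]
      by (simp add: nn_integral_add nn_integral_cmult)
    also have "\<dots> \<le> SS"
      unfolding SS_def
    proof (intro nn_integral_mono)
      fix z
      have "A p s z + am * A q t z \<le> S (fst z) (snd z)"
      proof (cases "fst z \<in> B1 \<and> snd z \<in> B1")
        case True
        then have "am \<le> a (fst z) (snd z)" using am(2) subs(5) by blast
        then have "am * A q t z \<le> a (fst z) (snd z) * A q t z" by (intro mult_right_mono A0)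
        then show ?thesis by (simp add: S_def gain_density_def phase_density_def A_def)
      next
        case False
        then show ?thesis by (auto simp: S_def gain_density_def phase_density_def A_def)
      qed
      then have "ennreal (A p s z + am * A q t z) \<le> ennreal (S (fst z) (snd z))" by (rule ennreal_leI)
      then show "ennreal (A p s z) + ennreal am * ennreal (A q t z) \<le> ennreal (S (fst z) (snd z))"
        using A0 am(1) by (simp add: ennreal_mult)
    qed
    also note SSle
    finally show "gagliardo_power p s (ball x0 \<rho>) (\<lambda>x. max (u x - k) 0)
      + ennreal am * gagliardo_power q t (ball x0 \<rho>) (\<lambda>x. max (u x - k) 0)
    \<le> ennreal (C * (r / \<sigma>) powr (real CARD('n) + q)) *
      ((\<integral>\<^sup>+ x\<in>ball x0 (\<rho> + 2 * \<sigma>). ennreal (max (u x - k) 0 powr p / r powr (s * p)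
          + ap * (max (u x - k) 0 powr q / r powr (t * q))) \<partial>lborel)
       + nonlocal_tail p q s t a (\<lambda>x. max (u x) 0) x0 r (r / 2)
         * (\<integral>\<^sup>+ x\<in>ball x0 (\<rho> + 2 * \<sigma>). ennreal (max (u x - k) 0) \<partial>lborel))"
      unfolding w_def B1_def B3_def Q_def I_def J_def .
  qed
qed

section \<open>The growth functions and the superlinear recursion\<close>

text \<open>
  Strictly increasing, continuous and onto the half line, hence the choice made by
  \<open>inv_into\<close> is the inverse function.
\<close>

lemma two_power_inverse:
  fixes A B e d y :: real
  assumes A: "0 < A" and B: "0 \<le> B" and e: "0 < e" "0 < d" and y: "0 \<le> y"
  defines "g \<equiv> \<lambda>k. A * k powr e + B * k powr d"
  shows "0 \<le> inv_into {0..} g y" "g (inv_into {0..} g y) = y"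
    and "\<And>z. 0 \<le> z \<Longrightarrow> g z \<le> y \<Longrightarrow> z \<le> inv_into {0..} g y"
proof -
  define X where "X = (y / A) powr (1 / e)"
  have X: "A * X powr e = y" using A e y by (simp add: X_def powr_powr)
  have "\<exists>k. 0 \<le> k \<and> k \<le> X \<and> g k = y"
  proof (rule IVT')
    show "g 0 \<le> y" using y by (simp add: g_def)
    show "y \<le> g X" using X B by (simp add: g_def)
    show "0 \<le> X" by (simp add: X_def)
    show "continuous_on {0..X} g"
      unfolding g_def using e by (intro continuous_intros continuous_on_powr') auto
  qed
  then have mem: "y \<in> g ` {0..}" by auto
  show 1: "0 \<le> inv_into {0..} g y" using inv_into_into[OF mem] by simp
  show 2: "g (inv_into {0..} g y) = y" using f_inv_into_f[OF mem] .
  fix z :: real assume z: "0 \<le> z" "g z \<le> y"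
  show "z \<le> inv_into {0..} g y"
  proof (rule ccontr)
    assume "\<not> ?thesis"
    then have lt: "inv_into {0..} g y < z" by simp
    have "A * inv_into {0..} g y powr e < A * z powr e"
      using lt 1 A e by (intro mult_strict_left_mono powr_less_mono2) auto
    moreover have "B * inv_into {0..} g y powr d \<le> B * z powr d"
      using lt 1 B e by (intro mult_left_mono powr_mono2) auto
    ultimately have "g (inv_into {0..} g y) < g z" by (simp add: g_def)
    with 2 z show False by simp
  qed
qed

lemma H_fun_inverse:
  assumes "0 < p" "0 < q" "0 \<le> m" "0 < r" "0 \<le> y"
  shows "0 \<le> inv_into {0..} (H_fun p q s t m r) y"
    and "H_fun p q s t m r (inv_into {0..} (H_fun p q s t m r) y) = y"
    and "0 \<le> z \<Longrightarrow> H_fun p q s t m r z \<le> y \<Longrightarrow> z \<le> inv_into {0..} (H_fun p q s t m r) y"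
proof -
  have eq: "H_fun p q s t m r = (\<lambda>k. 1 / r powr (s * p) * k powr p + m / r powr (t * q) * k powr q)"
    by (simp add: H_fun_def fun_eq_iff)
  have "0 < 1 / r powr (s * p)" "0 \<le> m / r powr (t * q)" using assms by auto
  note inv = two_power_inverse[OF this assms(1,2,5)]
  show "0 \<le> inv_into {0..} (H_fun p q s t m r) y"
    "H_fun p q s t m r (inv_into {0..} (H_fun p q s t m r) y) = y"
    "0 \<le> z \<Longrightarrow> H_fun p q s t m r z \<le> y \<Longrightarrow> z \<le> inv_into {0..} (H_fun p q s t m r) y"
    unfolding eq by (rule inv, assumption?)+
qed

lemma h_fun_inverse:
  assumes "1 < p" "1 < q" "0 \<le> m" "0 < r" "0 \<le> y"
  shows "0 \<le> inv_into {0..} (h_fun p q s t m r) y"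
    and "h_fun p q s t m r (inv_into {0..} (h_fun p q s t m r) y) = y"
proof -
  have eq: "h_fun p q s t m r = (\<lambda>k. 1 / r powr (s * p) * k powr (p - 1) + m / r powr (t * q) * k powr (q - 1))"
    by (simp add: h_fun_def fun_eq_iff)
  have "0 < 1 / r powr (s * p)" "0 \<le> m / r powr (t * q)" "0 < p - 1" "0 < q - 1" using assms by auto
  note inv = two_power_inverse[OF this assms(5)]
  show "0 \<le> inv_into {0..} (h_fun p q s t m r) y"
    "h_fun p q s t m r (inv_into {0..} (h_fun p q s t m r) y) = y"
    unfolding eq by (rule inv)+
qed

lemma H_fun_nonneg: "0 \<le> m \<Longrightarrow> 0 \<le> H_fun p q s t m r k"
  by (simp add: H_fun_def)

lemma H_fun_pos: "0 \<le> m \<Longrightarrow> 0 < r \<Longrightarrow> 0 < k \<Longrightarrow> 0 < H_fun p q s t m r k"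
  by (simp add: H_fun_def add_pos_nonneg)

lemma h_fun_nonneg: "0 \<le> m \<Longrightarrow> 0 \<le> h_fun p q s t m r k"
  by (simp add: h_fun_def)

lemma H_fun_mono:
  assumes "0 \<le> p" "0 \<le> q" "0 \<le> m" "0 \<le> x" "x \<le> y"
  shows "H_fun p q s t m r x \<le> H_fun p q s t m r y"
  using assms unfolding H_fun_def by (intro add_mono divide_right_mono mult_left_mono powr_mono2) auto

lemma h_fun_mono:
  assumes "1 \<le> p" "1 \<le> q" "0 \<le> m" "0 \<le> x" "x \<le> y"
  shows "h_fun p q s t m r x \<le> h_fun p q s t m r y"
  using assms unfolding h_fun_def by (intro add_mono divide_right_mono mult_left_mono powr_mono2) auto

lemma mult_h_fun: "0 \<le> k \<Longrightarrow> k * h_fun p q s t m r k = H_fun p q s t m r k"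
  by (simp add: h_fun_def H_fun_def distrib_left powr_mult_base mult.left_commute[of k m])

lemma H_fun_scale_up:
  assumes "p \<le> q" "0 \<le> m" "1 \<le> c"
  shows "H_fun p q s t m r (c * k) \<le> c powr q * H_fun p q s t m r k"
proof -
  have "c powr p * (k powr p / r powr (s * p)) \<le> c powr q * (k powr p / r powr (s * p))"
    using assms by (intro mult_right_mono powr_mono) auto
  then show ?thesis using assms by (simp add: H_fun_def powr_mult algebra_simps)
qed

lemma h_fun_scale_up:
  assumes "p \<le> q" "0 \<le> m" "1 \<le> c"
  shows "h_fun p q s t m r (c * k) \<le> c powr (q - 1) * h_fun p q s t m r k"
proof -
  have "c powr (p - 1) * (k powr (p - 1) / r powr (s * p)) \<le> c powr (q - 1) * (k powr (p - 1) / r powr (s * p))"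
    using assms by (intro mult_right_mono powr_mono) auto
  then show ?thesis using assms by (simp add: h_fun_def powr_mult algebra_simps)
qed

lemma H_fun_scale_down:
  assumes "p \<le> q" "0 \<le> m" "0 \<le> c" "c \<le> 1"
  shows "H_fun p q s t m r (c * k) \<le> c powr p * H_fun p q s t m r k"
proof -
  have "c powr q * (m * (k powr q / r powr (t * q))) \<le> c powr p * (m * (k powr q / r powr (t * q)))"
    using assms by (intro mult_right_mono powr_mono') auto
  then show ?thesis using assms by (simp add: H_fun_def powr_mult algebra_simps)
qed

text \<open>
  The starting bound \<open>\<kappa>\<close> is the one for which the geometric sequence
  \<open>\<kappa> (b powr (- 1 / \<beta>)) ^ j\<close> solves the recursion with equality.
\<close>

lemma superlinear_recursion_tendsto_zero:
  fixes Y :: "nat \<Rightarrow> real"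
  assumes Y0: "\<And>j. 0 \<le> Y j" and rec: "\<And>j. Y (Suc j) \<le> K * b ^ j * Y j powr (1 + \<beta>)"
    and K: "0 < K" and b: "1 < b" and \<beta>: "0 < \<beta>"
    and start: "Y 0 \<le> K powr (- 1 / \<beta>) * b powr (- 1 / \<beta>\<^sup>2)"
  shows "Y \<longlonglongrightarrow> 0"
proof -
  define \<kappa> where "\<kappa> = K powr (- 1 / \<beta>) * b powr (- 1 / \<beta>\<^sup>2)"
  have \<kappa>: "0 < \<kappa>" using K b by (simp add: \<kappa>_def)
  have \<kappa>\<beta>: "K * \<kappa> powr \<beta> = b powr (- 1 / \<beta>)"
  proof -
    have exps: "- 1 / \<beta> * \<beta> = - 1" "- 1 / \<beta>\<^sup>2 * \<beta> = - 1 / \<beta>"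
      using \<beta> by (simp_all add: power2_eq_square)
    have "\<kappa> powr \<beta> = K powr (- 1) * b powr (- 1 / \<beta>)"
      unfolding \<kappa>_def powr_mult powr_powr exps ..
    then show ?thesis using K by simp
  qed
  have bound: "Y j \<le> \<kappa> * (b powr (- 1 / \<beta>)) ^ j" for j
  proof (induction j)
    case 0
    show ?case using start by (simp add: \<kappa>_def)
  next
    case (Suc j)
    define z where "z = (b powr (- 1 / \<beta>)) ^ j"
    have z: "0 < z" using b by (simp add: z_def)
    have zb: "b ^ j * z powr \<beta> = 1"
      using b \<beta> by (simp add: z_def powr_realpow[symmetric] powr_powr powr_add[symmetric])
    have "Y (Suc j) \<le> K * b ^ j * (\<kappa> * z) powr (1 + \<beta>)"
      using rec[of j] Suc Y0[of j] K b \<beta>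
      by (smt (verit, ccfv_SIG) mult_left_mono powr_mono2 z_def zero_le_mult_iff zero_less_power)
    also have "\<dots> = (K * \<kappa> powr \<beta>) * \<kappa> * z * (b ^ j * z powr \<beta>)"
      using \<kappa> z by (simp add: powr_add powr_mult)
    also have "\<dots> = \<kappa> * (b powr (- 1 / \<beta>)) ^ Suc j"
      unfolding zb \<kappa>\<beta> by (simp add: z_def)
    finally show ?case .
  qed
  have "b powr (- 1 / \<beta>) < 1"
    using powr_less_mono[of "- 1 / \<beta>" 0 b] b \<beta> by simp
  then have "(\<lambda>j. (b powr (- 1 / \<beta>)) ^ j) \<longlonglongrightarrow> 0"
    by (intro LIMSEQ_power_zero) auto
  then have "(\<lambda>j. \<kappa> * (b powr (- 1 / \<beta>)) ^ j) \<longlonglongrightarrow> 0"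
    using tendsto_mult_right_zero by blast
  then show ?thesis
    by (rule tendsto_sandwich[rotated -1]) (use Y0 bound in auto)
qed

section \<open>De Giorgi iteration\<close>

text \<open>
  The Caccioppoli inequality at all nonnegative levels, with the growth function
  \<open>H\<close> on the right; \<open>m\<close> stands for the infimum of the coefficient and
  \<open>T\<close> for the tail.  Apart from finiteness of the first integral, this is all that
  the iteration knows about \<open>u\<close>.
\<close>

definition de_giorgi_class :: "real \<Rightarrow> real \<Rightarrow> real \<Rightarrow> real \<Rightarrow> real \<Rightarrow> real ^ 'n \<Rightarrow> real \<Rightarrow> real \<Rightarrow> real \<Rightarrow>
    (real ^ 'n \<Rightarrow> real) set" where
  "de_giorgi_class p q s t m x0 r L T = {u \<in> borel_measurable borel.
     \<forall>k \<rho> \<sigma>. 0 \<le> k \<and> 0 < \<rho> \<and> 0 < \<sigma> \<and> r / 2 \<le> \<rho> + 2 * \<sigma> \<and> \<rho> + 2 * \<sigma> \<le> r \<longrightarrow>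
       gagliardo_power p s (ball x0 \<rho>) (\<lambda>x. max (u x - k) 0)
         + ennreal m * gagliardo_power q t (ball x0 \<rho>) (\<lambda>x. max (u x - k) 0)
       \<le> ennreal (L * (r / \<sigma>) powr (real CARD('n) + q)) *
         ((\<integral>\<^sup>+ x\<in>ball x0 (\<rho> + 2 * \<sigma>). ennreal (H_fun p q s t m r (max (u x - k) 0)) \<partial>lborel)
          + ennreal T * (\<integral>\<^sup>+ x\<in>ball x0 (\<rho> + 2 * \<sigma>). ennreal (max (u x - k) 0) \<partial>lborel))}"

lemma gagliardo_power_mono:
  fixes u :: "real ^ 'n \<Rightarrow> real"
  assumes "D \<subseteq> D'" "D \<in> sets borel" "D' \<in> sets borel"
  shows "gagliardo_power p s D u \<le> gagliardo_power p s D' u"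
  unfolding gagliardo_power_indicator[OF assms(2)] gagliardo_power_indicator[OF assms(3)]
  using assms(1) by (intro nn_integral_mono ennreal_leI) (auto simp: indicator_def)

lemma measurable_H_fun [measurable]: "H_fun p q s t m r \<in> borel_measurable borel"
  unfolding H_fun_def[abs_def] by measurable

text \<open>
  Faber--Krahn for both phases at once.  As \<open>\<epsilon> \<le> r\<close> and \<open>s p
  \<le> t q\<close>, the factor of the \<open>p\<close>-phase dominates.
\<close>

lemma small_support_estimate:
  fixes w :: "real ^ 'n \<Rightarrow> real"
  assumes wm [measurable]: "w \<in> borel_measurable borel" and w0: "\<And>x. 0 \<le> w x"
    and st: "0 < s" "s \<le> t" and pq: "1 < p" "p \<le> q" and m: "0 \<le> m"
    and r: "0 < r" and \<epsilon>: "0 < \<epsilon>" "\<epsilon> \<le> \<sigma>" "\<epsilon> \<le> r"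
    and small: "2 * emeasure lborel {y \<in> ball x0 (\<rho> + \<sigma>). 0 < w y}
      \<le> ennreal (unit_ball_vol (real CARD('n)) * \<epsilon> ^ CARD('n))"
  shows "(\<integral>\<^sup>+ x\<in>ball x0 \<rho>. ennreal (H_fun p q s t m r (w x)) \<partial>lborel)
    \<le> ennreal (2 / unit_ball_vol (real CARD('n)) * (\<epsilon> / r) powr (s * p)) *
      (gagliardo_power p s (ball x0 (\<rho> + \<sigma>)) w + ennreal m * gagliardo_power q t (ball x0 (\<rho> + \<sigma>)) w)"
proof -
  define \<omega> where "\<omega> = unit_ball_vol (real CARD('n))"
  have \<omega>: "0 < \<omega>" by (simp add: \<omega>_def)
  define c where "c = 2 / \<omega> * (\<epsilon> / r) powr (s * p)"
  have sub: "ball x0 (\<rho> + \<epsilon>) \<subseteq> ball x0 (\<rho> + \<sigma>)" using \<epsilon> by (intro subset_ball) simp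
  have "2 * emeasure lborel {y \<in> ball x0 (\<rho> + \<epsilon>). 0 < w y} \<le> 2 * emeasure lborel {y \<in> ball x0 (\<rho> + \<sigma>). 0 < w y}"
    using sub by (intro mult_left_mono emeasure_mono) auto
  then have small': "2 * emeasure lborel {y \<in> ball x0 (\<rho> + \<epsilon>). 0 < w y} \<le> ennreal (unit_ball_vol (real CARD('n)) * \<epsilon> ^ CARD('n))"
    using small by (rule order_trans)
  have fk: "ennreal (1 / r powr (\<tau> * e)) * (\<integral>\<^sup>+ x\<in>ball x0 \<rho>. ennreal (w x powr e) \<partial>lborel)
      \<le> ennreal c * gagliardo_power e \<tau> (ball x0 (\<rho> + \<sigma>)) w"
    if e: "0 < e" "0 < \<tau>" "s * p \<le> \<tau> * e" for e \<tau>
  proof -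
    have "(\<integral>\<^sup>+ x\<in>ball x0 \<rho>. ennreal (w x powr e) \<partial>lborel)
        \<le> ennreal (2 / \<omega> * \<epsilon> powr (\<tau> * e)) * gagliardo_power e \<tau> (ball x0 (\<rho> + \<epsilon>)) w"
      unfolding \<omega>_def by (rule fractional_faber_krahn[OF wm w0 e(1,2) \<epsilon>(1) small'])
    also have "\<dots> \<le> ennreal (2 / \<omega> * \<epsilon> powr (\<tau> * e)) * gagliardo_power e \<tau> (ball x0 (\<rho> + \<sigma>)) w"
      using sub by (intro mult_left_mono gagliardo_power_mono) auto
    finally have "ennreal (1 / r powr (\<tau> * e)) * (\<integral>\<^sup>+ x\<in>ball x0 \<rho>. ennreal (w x powr e) \<partial>lborel)
        \<le> ennreal (1 / r powr (\<tau> * e)) * (ennreal (2 / \<omega> * \<epsilon> powr (\<tau> * e)) * gagliardo_power e \<tau> (ball x0 (\<rho> + \<sigma>)) w)"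
      by (intro mult_left_mono) auto
    also have "\<dots> = ennreal (1 / r powr (\<tau> * e) * (2 / \<omega> * \<epsilon> powr (\<tau> * e))) * gagliardo_power e \<tau> (ball x0 (\<rho> + \<sigma>)) w"
      using \<omega> by (subst ennreal_mult) (auto simp: mult.assoc)
    also have "1 / r powr (\<tau> * e) * (2 / \<omega> * \<epsilon> powr (\<tau> * e)) = 2 / \<omega> * (\<epsilon> / r) powr (\<tau> * e)"
      by (simp add: powr_divide)
    also have "ennreal (2 / \<omega> * (\<epsilon> / r) powr (\<tau> * e)) * gagliardo_power e \<tau> (ball x0 (\<rho> + \<sigma>)) w
        \<le> ennreal c * gagliardo_power e \<tau> (ball x0 (\<rho> + \<sigma>)) w"
      unfolding c_def using \<omega> \<epsilon> r e by (intro mult_right_mono ennreal_leI mult_left_mono powr_mono') auto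
    finally show ?thesis .
  qed
  have sp: "s * p \<le> t * q" using st pq by (intro mult_mono) auto
  define B where "B = ball x0 \<rho>"
  have [measurable]: "B \<in> sets borel" by (simp add: B_def)
  have Hsplit: "ennreal (H_fun p q s t m r z) = ennreal (1 / r powr (s * p)) * ennreal (z powr p)
      + ennreal m * (ennreal (1 / r powr (t * q)) * ennreal (z powr q))" for z
  proof -
    have "ennreal (H_fun p q s t m r z)
        = ennreal (1 / r powr (s * p) * z powr p + m * (1 / r powr (t * q) * z powr q))"
      by (simp add: H_fun_def)
    also have "\<dots> = ennreal (1 / r powr (s * p) * z powr p) + ennreal (m * (1 / r powr (t * q) * z powr q))"
      using m by (intro ennreal_plus) auto
    also have "ennreal (m * (1 / r powr (t * q) * z powr q)) = ennreal m * ennreal (1 / r powr (t * q) * z powr q)"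
      using m by (intro ennreal_mult) auto
    also have "ennreal (1 / r powr (t * q) * z powr q) = ennreal (1 / r powr (t * q)) * ennreal (z powr q)"
      by (intro ennreal_mult) auto
    also have "ennreal (1 / r powr (s * p) * z powr p) = ennreal (1 / r powr (s * p)) * ennreal (z powr p)"
      by (intro ennreal_mult) auto
    finally show ?thesis .
  qed
  have lin: "(\<integral>\<^sup>+ x. a * F x + b * (d * G x) \<partial>lborel) = a * (\<integral>\<^sup>+ x. F x \<partial>lborel) + b * (d * (\<integral>\<^sup>+ x. G x \<partial>lborel))"
    if "F \<in> borel_measurable lborel" "G \<in> borel_measurable lborel" for a b d and F G :: "real ^ 'n \<Rightarrow> ennreal"
    using that by (simp add: nn_integral_add nn_integral_cmult)
  have "(\<integral>\<^sup>+ x\<in>B. ennreal (H_fun p q s t m r (w x)) \<partial>lborel)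
    = (\<integral>\<^sup>+ x. ennreal (1 / r powr (s * p)) * (ennreal (w x powr p) * indicator B x)
        + ennreal m * (ennreal (1 / r powr (t * q)) * (ennreal (w x powr q) * indicator B x)) \<partial>lborel)"
    unfolding Hsplit by (simp only: distrib_right mult.assoc)
  also have "\<dots> = ennreal (1 / r powr (s * p)) * (\<integral>\<^sup>+ x\<in>B. ennreal (w x powr p) \<partial>lborel)
        + ennreal m * (ennreal (1 / r powr (t * q)) * (\<integral>\<^sup>+ x\<in>B. ennreal (w x powr q) \<partial>lborel))"
    by (rule lin) measurable
  also have "\<dots> \<le> ennreal c * gagliardo_power p s (ball x0 (\<rho> + \<sigma>)) w
        + ennreal m * (ennreal c * gagliardo_power q t (ball x0 (\<rho> + \<sigma>)) w)"
    unfolding B_def using pq st sp by (intro add_mono mult_left_mono fk[of p s] fk[of q t]) auto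
  also have "\<dots> = ennreal c * (gagliardo_power p s (ball x0 (\<rho> + \<sigma>)) w
        + ennreal m * gagliardo_power q t (ball x0 (\<rho> + \<sigma>)) w)"
    by (simp only: distrib_left mult.left_commute)
  finally show ?thesis by (simp only: c_def \<omega>_def B_def)
qed

text \<open>
  One step from level \<open>l\<close> to level \<open>l + \<eta> k0\<close>.  Where the higher
  truncation \<open>w\<close> is positive, the lower one is at least \<open>\<eta> k0\<close>.
  This is used twice: to bound the tail term \<open>T w\<close> by \<open>H\<close> of the lower
  truncation, and to bound the measure of \<open>{w > 0}\<close>.
\<close>

lemma de_giorgi_step:
  fixes u :: "real ^ 'n \<Rightarrow> real"
  assumes st: "0 < s" "s \<le> t" "t < 1" and pq: "1 < p" "p \<le> q" and m: "0 \<le> m" and L: "0 < L"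
    and u: "u \<in> de_giorgi_class p q s t m x0 r L T" and T: "0 \<le> T" "T \<le> \<Theta> * h_fun p q s t m r k0" and \<Theta>: "0 \<le> \<Theta>"
    and r: "0 < r" "r / 2 \<le> \<rho>" "\<rho> + 3 * \<sigma> \<le> r" and \<sigma>: "0 < \<sigma>"
    and lev: "0 \<le> l" "0 < k0" "0 < \<eta>" "\<eta> \<le> 1"
    and I: "(\<integral>\<^sup>+ x\<in>ball x0 (\<rho> + 3 * \<sigma>). ennreal (H_fun p q s t m r (max (u x - l) 0)) \<partial>lborel) \<le> ennreal I" "0 \<le> I"
  defines "\<omega> \<equiv> unit_ball_vol (real CARD('n))" and "\<beta> \<equiv> s * p / real CARD('n)"
  shows "(\<integral>\<^sup>+ x\<in>ball x0 \<rho>. ennreal (H_fun p q s t m r (max (u x - (l + \<eta> * k0)) 0)) \<partial>lborel)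
    \<le> ennreal ((1 + 2 / \<omega> * L * (1 + \<Theta>)) * 2 powr \<beta> * (r / \<sigma>) powr (real CARD('n) + q)
        * \<eta> powr (1 - q - q * \<beta>) * (I / (\<omega> * r ^ CARD('n) * H_fun p q s t m r k0)) powr \<beta> * I)"
proof -
  have um [measurable]: "u \<in> borel_measurable borel" using u by (simp add: de_giorgi_class_def)
  define H where "H = H_fun p q s t m r"
  have Hm [measurable]: "H \<in> borel_measurable borel" unfolding H_def by measurable
  define k where "k = l + \<eta> * k0"
  have k0: "0 \<le> k" using lev by (simp add: k_def)
  define w wl where "w = (\<lambda>x. max (u x - k) 0)" and "wl = (\<lambda>x. max (u x - l) 0)"
  have wm [measurable]: "w \<in> borel_measurable borel" "wl \<in> borel_measurable borel" unfolding w_def wl_def by measurable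
  define d where "d = \<eta> * k0"
  have d0: "0 \<le> d" and kd: "k = l + d" using lev by (simp_all add: d_def k_def)
  have w0: "0 \<le> w x" "0 \<le> wl x" "w x \<le> wl x" for x
    using d0 by (auto simp: w_def wl_def kd)
  have wl_ge: "\<eta> * k0 \<le> wl x" if "0 < w x" for x
    using that unfolding w_def wl_def kd d_def[symmetric] by (simp add: max_def split: if_splits)
  have \<omega>: "0 < \<omega>" by (simp add: \<omega>_def)
  have \<beta>: "0 < \<beta>" using st pq by (simp add: \<beta>_def)
  have H0: "0 \<le> H z" for z using m by (simp add: H_def H_fun_nonneg)
  have Hmono: "H x \<le> H y" if "0 \<le> x" "x \<le> y" for x y
    unfolding H_def using that pq m by (intro H_fun_mono) auto
  define B1 B3 where "B1 = ball x0 (\<rho> + \<sigma>)" and "B3 = ball x0 (\<rho> + 3 * \<sigma>)"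
  have [measurable]: "B1 \<in> sets borel" "B3 \<in> sets borel" by (auto simp: B1_def B3_def)
  have subs: "ball x0 \<rho> \<subseteq> B1" "B1 \<subseteq> B3" "ball x0 \<rho> \<subseteq> B3"
    using \<sigma> by (auto simp: B1_def B3_def)
  have Ile: "(\<integral>\<^sup>+ x\<in>B3. ennreal (H (wl x)) \<partial>lborel) \<le> ennreal I"
    using I unfolding H_def wl_def B3_def by simp
  define Q where "Q = (r / \<sigma>) powr (real CARD('n) + q)"
  define Z where "Z = \<eta> powr (1 - q)"
  have Q1: "1 \<le> Q" unfolding Q_def using r \<sigma> pq by (intro ge_one_powr_ge_zero) auto
  have Z1: "1 \<le> Z"
    using powr_mono'[of "1 - q" 0 \<eta>] lev pq by (simp add: Z_def)
  have tail_pw: "T * w x \<le> \<Theta> * Z * H (wl x)" for x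
  proof (cases "0 < w x")
    case True
    have "h_fun p q s t m r k0 \<le> h_fun p q s t m r (1 / \<eta> * wl x)"
      using wl_ge[OF True] lev pq m by (intro h_fun_mono) (auto simp: field_simps)
    also have "\<dots> \<le> (1 / \<eta>) powr (q - 1) * h_fun p q s t m r (wl x)"
      using lev pq m by (intro h_fun_scale_up) auto
    also have "(1 / \<eta>) powr (q - 1) = Z"
      unfolding Z_def using lev by (simp add: powr_divide powr_diff)
    finally have 1: "h_fun p q s t m r k0 \<le> Z * h_fun p q s t m r (wl x)" .
    have "T * w x \<le> (\<Theta> * h_fun p q s t m r k0) * wl x"
      using T w0 \<Theta> m by (intro mult_mono mult_nonneg_nonneg h_fun_nonneg) auto
    also have "\<dots> \<le> (\<Theta> * (Z * h_fun p q s t m r (wl x))) * wl x"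
      using 1 \<Theta> w0 by (intro mult_right_mono mult_left_mono) auto
    also have "\<dots> = \<Theta> * Z * H (wl x)"
      using mult_h_fun[OF w0(2)[of x], of p q s t m r] by (simp add: H_def mult_ac)
    finally show ?thesis .
  next
    case False
    then have "w x = 0" using w0[of x] by simp
    then show ?thesis using \<Theta> Z1 H0 by simp
  qed
  define E where "E = gagliardo_power p s B1 w + ennreal m * gagliardo_power q t B1 w"
  have E: "E \<le> ennreal (L * Q * (1 + \<Theta>) * Z * I)"
  proof -
    have sum: "\<rho> + \<sigma> + 2 * \<sigma> = \<rho> + 3 * \<sigma>" by simp
    have "E \<le> ennreal (L * Q) * ((\<integral>\<^sup>+ x\<in>B3. ennreal (H (w x)) \<partial>lborel) + ennreal T * (\<integral>\<^sup>+ x\<in>B3. ennreal (w x) \<partial>lborel))"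
    proof -
      have "0 \<le> k \<and> 0 < \<rho> + \<sigma> \<and> 0 < \<sigma> \<and> r / 2 \<le> (\<rho> + \<sigma>) + 2 * \<sigma> \<and> (\<rho> + \<sigma>) + 2 * \<sigma> \<le> r"
        using k0 r \<sigma> by auto
      with u show ?thesis
        unfolding de_giorgi_class_def mem_Collect_eq E_def B1_def B3_def w_def Q_def H_def sum[symmetric] by blast
    qed
    also have "\<dots> \<le> ennreal (L * Q) * (ennreal I + ennreal (\<Theta> * Z) * ennreal I)"
    proof (intro mult_left_mono add_mono)
      have "(\<integral>\<^sup>+ x\<in>B3. ennreal (H (w x)) \<partial>lborel) \<le> (\<integral>\<^sup>+ x\<in>B3. ennreal (H (wl x)) \<partial>lborel)"
        using w0 Hmono by (intro nn_integral_mono mult_right_mono ennreal_leI) auto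
      with Ile show "(\<integral>\<^sup>+ x\<in>B3. ennreal (H (w x)) \<partial>lborel) \<le> ennreal I" by (rule order_trans[rotated])
      have "ennreal T * (\<integral>\<^sup>+ x\<in>B3. ennreal (w x) \<partial>lborel) = (\<integral>\<^sup>+ x\<in>B3. ennreal (T * w x) \<partial>lborel)"
        using T w0 by (simp add: nn_integral_cmult[symmetric] ennreal_mult mult.assoc)
      also have "\<dots> \<le> (\<integral>\<^sup>+ x\<in>B3. ennreal (\<Theta> * Z * H (wl x)) \<partial>lborel)"
        using tail_pw by (intro nn_integral_mono mult_right_mono ennreal_leI) auto
      also have "\<dots> = ennreal (\<Theta> * Z) * (\<integral>\<^sup>+ x\<in>B3. ennreal (H (wl x)) \<partial>lborel)"
      proof -
        have "ennreal (\<Theta> * Z * H (wl x)) = ennreal (\<Theta> * Z) * ennreal (H (wl x))" for x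
          using \<Theta> Z1 H0 by (intro ennreal_mult) auto
        then show ?thesis by (simp add: nn_integral_cmult mult.assoc)
      qed
      also have "\<dots> \<le> ennreal (\<Theta> * Z) * ennreal I" using Ile by (intro mult_left_mono) auto
      finally show "ennreal T * (\<integral>\<^sup>+ x\<in>B3. ennreal (w x) \<partial>lborel) \<le> ennreal (\<Theta> * Z) * ennreal I" .
    qed auto
    also have "\<dots> = ennreal (L * Q * (I + \<Theta> * Z * I))"
    proof -
      have "0 \<le> \<Theta> * Z" "0 \<le> L * Q" using \<Theta> Z1 L Q1 by auto
      then show ?thesis
        using I by (simp only: ennreal_mult[symmetric] ennreal_plus[symmetric] mult_nonneg_nonneg add_nonneg_nonneg)
    qed
    also have "\<dots> \<le> ennreal (L * Q * (1 + \<Theta>) * Z * I)"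
    proof (intro ennreal_leI)
      have "I + \<Theta> * Z * I \<le> Z * I + \<Theta> * Z * I" using Z1 I mult_right_mono[of 1 Z I] by simp
      then have "L * Q * (I + \<Theta> * Z * I) \<le> L * Q * (Z * I + \<Theta> * Z * I)"
        using L Q1 by (intro mult_left_mono) auto
      then show "L * Q * (I + \<Theta> * Z * I) \<le> L * Q * (1 + \<Theta>) * Z * I" by (simp add: algebra_simps)
    qed
    finally show ?thesis .
  qed
  define P where "P = {x \<in> B1. 0 < w x}"
  have [measurable]: "P \<in> sets borel" unfolding P_def by measurable
  define \<mu> where "\<mu> = measure lborel P"
  define V where "V = \<omega> * r ^ CARD('n)"
  have V: "0 < V" using \<omega> r by (simp add: V_def)
  have eP: "emeasure lborel P = ennreal \<mu>"
  proof -
    have "emeasure lborel P \<le> emeasure lborel B1" by (intro emeasure_mono) (auto simp: P_def)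
    then show ?thesis unfolding \<mu>_def using r \<sigma>
      by (intro emeasure_eq_ennreal_measure) (auto simp: B1_def emeasure_lborel_ball_cart top_unique)
  qed
  have \<mu>0: "0 \<le> \<mu>" by (simp add: \<mu>_def)
  have Hk: "0 < H k0" "0 < H (\<eta> * k0)" using m r lev by (auto simp: H_def H_fun_pos)
  have cheb: "\<mu> * H (\<eta> * k0) \<le> I"
  proof -
    have "ennreal (H (\<eta> * k0)) * ennreal \<mu> = (\<integral>\<^sup>+ x. ennreal (H (\<eta> * k0)) * indicator P x \<partial>lborel)"
      by (simp add: nn_integral_cmult_indicator eP)
    also have "\<dots> \<le> (\<integral>\<^sup>+ x\<in>B3. ennreal (H (wl x)) \<partial>lborel)"
    proof (intro nn_integral_mono)
      fix x
      show "ennreal (H (\<eta> * k0)) * indicator P x \<le> ennreal (H (wl x)) * indicator B3 x"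
      proof (cases "x \<in> P")
        case True
        then have "H (\<eta> * k0) \<le> H (wl x)" "x \<in> B3"
          using wl_ge subs lev by (auto simp: P_def intro!: Hmono)
        then show ?thesis using True by (simp add: ennreal_leI)
      qed simp
    qed
    also note Ile
    finally have "ennreal (H (\<eta> * k0) * \<mu>) \<le> ennreal I"
      using Hk \<mu>0 by (simp add: ennreal_mult)
    then show ?thesis using I by (simp add: mult.commute)
  qed
  define \<theta> where "\<theta> = \<mu> / V"
  have \<theta>0: "0 \<le> \<theta>" using \<mu>0 V by (simp add: \<theta>_def)
  have \<theta>le: "\<theta> \<le> \<eta> powr (- q) * (I / (V * H k0))"
  proof -
    have "H k0 \<le> (1 / \<eta>) powr q * H (\<eta> * k0)"
      using H_fun_scale_up[of p q m "1 / \<eta>" s t r "\<eta> * k0"] lev pq m by (simp add: H_def)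
    then have "\<mu> * H k0 \<le> \<mu> * ((1 / \<eta>) powr q * H (\<eta> * k0))" using \<mu>0 by (intro mult_left_mono)
    also have "\<dots> = \<eta> powr (- q) * (\<mu> * H (\<eta> * k0))"
      using lev by (simp add: powr_divide powr_minus divide_inverse inverse_powr)
    also have "\<dots> \<le> \<eta> powr (- q) * I" using cheb by (intro mult_left_mono) auto
    finally show ?thesis using V Hk by (simp add: \<theta>_def field_simps)
  qed
  define K where "K = 1 + 2 / \<omega> * L * (1 + \<Theta>)"
  have K: "1 \<le> K" "2 / \<omega> * L * (1 + \<Theta>) \<le> K" using \<omega> L \<Theta> by (auto simp: K_def)
  have main: "(\<integral>\<^sup>+ x\<in>ball x0 \<rho>. ennreal (H (w x)) \<partial>lborel) \<le> ennreal ((2 * \<theta>) powr \<beta> * (Q * K * Z * I))"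
  proof -
    \<comment> \<open>The ball of radius \<open>\<epsilon>\<close> has exactly twice the measure of \<open>P\<close>.\<close>
    define \<epsilon> where "\<epsilon> = r * (2 * \<theta>) powr (1 / real CARD('n))"
    have er: "(\<epsilon> / r) powr (real CARD('n) * c) = (2 * \<theta>) powr c" for c
      using r by (simp add: \<epsilon>_def powr_powr)
    consider "\<theta> = 0" | "0 < \<theta>" "\<epsilon> \<le> \<sigma>" | "0 < \<theta>" "\<sigma> < \<epsilon>" using \<theta>0 by linarith
    then show ?thesis
    proof cases
      case 1
      then have "\<mu> = 0" using V by (simp add: \<theta>_def)
      then have "AE x in lborel. x \<notin> P" using eP by (intro AE_not_in null_setsI) auto
      then have "AE x in lborel. ennreal (H (w x)) * indicator (ball x0 \<rho>) x = 0"
      proof eventually_elim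
        fix x assume "x \<notin> P"
        then have "x \<in> ball x0 \<rho> \<Longrightarrow> w x = 0" using subs w0[of x] by (auto simp: P_def)
        then show "ennreal (H (w x)) * indicator (ball x0 \<rho>) x = 0"
          by (auto simp: indicator_def H_def H_fun_def)
      qed
      then have "(\<integral>\<^sup>+ x\<in>ball x0 \<rho>. ennreal (H (w x)) \<partial>lborel) = 0"
        by (subst nn_integral_cong_AE[where v = "\<lambda>_. 0"]) simp_all
      then show ?thesis by simp
    next
      case 2
      have "0 < \<epsilon>" using 2(1) r by (simp add: \<epsilon>_def)
      moreover have "\<epsilon> \<le> r" using 2(2) r \<sigma> by linarith
      ultimately have \<epsilon>: "0 < \<epsilon>" "\<epsilon> \<le> r" by auto
      have "\<epsilon> ^ CARD('n) = r ^ CARD('n) * (2 * \<theta>)"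
        using 2 r by (simp add: \<epsilon>_def power_mult_distrib powr_realpow[symmetric] powr_powr)
      then have vol: "\<omega> * \<epsilon> ^ CARD('n) = 2 * \<mu>" using V \<omega> r by (simp add: \<theta>_def V_def field_simps)
      have "(\<integral>\<^sup>+ x\<in>ball x0 \<rho>. ennreal (H (w x)) \<partial>lborel) \<le> ennreal (2 / \<omega> * (\<epsilon> / r) powr (s * p)) * E"
        unfolding H_def E_def B1_def \<omega>_def
      proof (intro small_support_estimate[OF wm(1)])
        show "2 * emeasure lborel {y \<in> ball x0 (\<rho> + \<sigma>). 0 < w y} \<le> ennreal (unit_ball_vol (real CARD('n)) * \<epsilon> ^ CARD('n))"
          using eP \<mu>0 unfolding P_def B1_def \<omega>_def[symmetric] vol by (simp add: ennreal_mult)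
      qed (use st pq m r \<epsilon> 2 w0 in auto)
      also have "s * p = real CARD('n) * \<beta>" by (simp add: \<beta>_def)
      also have "ennreal (2 / \<omega> * (\<epsilon> / r) powr (real CARD('n) * \<beta>)) * E
          \<le> ennreal (2 / \<omega> * (2 * \<theta>) powr \<beta>) * ennreal (L * Q * (1 + \<Theta>) * Z * I)"
        unfolding er by (intro mult_left_mono E) auto
      also have "\<dots> = ennreal ((2 * \<theta>) powr \<beta> * (Q * (2 / \<omega> * L * (1 + \<Theta>)) * Z * I))"
        using \<omega> L Q1 \<Theta> Z1 I by (subst ennreal_mult[symmetric]) (auto simp: mult_ac)
      also have "\<dots> \<le> ennreal ((2 * \<theta>) powr \<beta> * (Q * K * Z * I))"
        using K Q1 Z1 I by (intro ennreal_leI mult_left_mono mult_right_mono) auto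
      finally show ?thesis .
    next
      case 3
      \<comment> \<open>Here \<open>P\<close> is too large for the averaging argument, but then the factor that is to be gained is bounded below.\<close>
      have big: "1 \<le> (2 * \<theta>) powr \<beta> * Q"
      proof -
        have n\<beta>: "0 < real CARD('n) * \<beta>" using \<beta> by simp
        have "(\<sigma> / r) powr (real CARD('n) * \<beta>) \<le> (\<epsilon> / r) powr (real CARD('n) * \<beta>)"
          using 3 r \<sigma> n\<beta> by (intro powr_mono2) (auto simp: divide_right_mono)
        then have 1: "(\<sigma> / r) powr (real CARD('n) * \<beta>) \<le> (2 * \<theta>) powr \<beta>" by (simp only: er)
        have "real CARD('n) * \<beta> \<le> real CARD('n) + q"
        proof -
          have "s * p \<le> 1 * q" using st pq by (intro mult_mono) auto
          then show ?thesis by (simp add: \<beta>_def)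
        qed
        then have "(r / \<sigma>) powr (real CARD('n) * \<beta>) \<le> Q"
          unfolding Q_def using r \<sigma> by (intro powr_mono) auto
        then have "(\<sigma> / r) powr (real CARD('n) * \<beta>) * (r / \<sigma>) powr (real CARD('n) * \<beta>) \<le> (2 * \<theta>) powr \<beta> * Q"
          using 1 by (intro mult_mono) auto
        then show ?thesis using r \<sigma> by (simp add: powr_mult[symmetric])
      qed
      have "(\<integral>\<^sup>+ x\<in>ball x0 \<rho>. ennreal (H (w x)) \<partial>lborel) \<le> (\<integral>\<^sup>+ x\<in>B3. ennreal (H (wl x)) \<partial>lborel)"
        using w0 subs by (intro nn_integral_mono mult_mono ennreal_leI Hmono) (auto simp: indicator_def)
      also note Ile
      also have "ennreal I \<le> ennreal ((2 * \<theta>) powr \<beta> * (Q * K * Z * I))"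
      proof (intro ennreal_leI)
        have "1 * (1 * 1) \<le> ((2 * \<theta>) powr \<beta> * Q) * (K * Z)"
          using big K Z1 by (intro mult_mono) auto
        then have "1 * I \<le> ((2 * \<theta>) powr \<beta> * Q) * (K * Z) * I" using I by (intro mult_right_mono) auto
        then show "I \<le> (2 * \<theta>) powr \<beta> * (Q * K * Z * I)" by (simp add: mult_ac)
      qed
      finally show ?thesis .
    qed
  qed
  also have "\<dots> \<le> ennreal (K * 2 powr \<beta> * Q * \<eta> powr (1 - q - q * \<beta>) * (I / (V * H k0)) powr \<beta> * I)"
  proof (intro ennreal_leI)
    have "(2 * \<theta>) powr \<beta> \<le> (2 * (\<eta> powr (- q) * (I / (V * H k0)))) powr \<beta>"
      using \<theta>le \<theta>0 \<beta> by (intro powr_mono2) auto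
    also have "\<dots> = 2 powr \<beta> * \<eta> powr (- q * \<beta>) * (I / (V * H k0)) powr \<beta>"
      by (simp only: powr_mult powr_powr mult.assoc)
    finally have "(2 * \<theta>) powr \<beta> * (Q * K * Z * I)
        \<le> 2 powr \<beta> * \<eta> powr (- q * \<beta>) * (I / (V * H k0)) powr \<beta> * (Q * K * Z * I)"
      using Q1 K Z1 I by (intro mult_right_mono) auto
    also have "\<dots> = K * 2 powr \<beta> * Q * (Z * \<eta> powr (- q * \<beta>)) * (I / (V * H k0)) powr \<beta> * I"
      by (simp add: mult_ac)
    also have "Z * \<eta> powr (- q * \<beta>) = \<eta> powr (1 - q - q * \<beta>)"
      by (simp add: Z_def powr_add[symmetric])
    finally show "(2 * \<theta>) powr \<beta> * (Q * K * Z * I)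
        \<le> K * 2 powr \<beta> * Q * \<eta> powr (1 - q - q * \<beta>) * (I / (V * H k0)) powr \<beta> * I" .
  qed
  finally show ?thesis
    by (simp add: H_def w_def k_def K_def Q_def V_def)
qed

text \<open>
  Levels \<open>k j\<close> increase from \<open>0\<close> to \<open>k0\<close> and radii
  \<open>\<rho> j\<close> decrease from \<open>r\<close> to \<open>r / 2\<close>, both with gaps
  proportional to \<open>1 / 2 ^ j\<close>.  The normalized integrals \<open>Y j\<close> then
  satisfy the recursion with \<open>K\<close> and \<open>b\<close>.
\<close>

lemma de_giorgi_level_bound:
  fixes u :: "real ^ 'n \<Rightarrow> real"
  assumes st: "0 < s" "s \<le> t" "t < 1" and pq: "1 < p" "p \<le> q" and m: "0 \<le> m" and L: "0 < L"
    and u: "u \<in> de_giorgi_class p q s t m x0 r L T" and r: "0 < r"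
    and T: "0 \<le> T" "T \<le> \<Theta> * h_fun p q s t m r k0" and \<Theta>: "0 \<le> \<Theta>" and k0: "0 < k0"
    and I0: "(\<integral>\<^sup>+ x\<in>ball x0 r. ennreal (H_fun p q s t m r (max (u x) 0)) \<partial>lborel) \<le> ennreal I0" "0 \<le> I0"
  defines "\<omega> \<equiv> unit_ball_vol (real CARD('n))" and "\<beta> \<equiv> s * p / real CARD('n)"
  defines "K \<equiv> (1 + 2 / \<omega> * L * (1 + \<Theta>)) * 2 powr \<beta> * 12 powr (real CARD('n) + q) * 2 powr (q - 1 + q * \<beta>)"
    and "b \<equiv> 2 powr (real CARD('n) + q + (q - 1 + q * \<beta>))"
  assumes start: "I0 \<le> \<omega> * r ^ CARD('n) * H_fun p q s t m r k0 * (K powr (- 1 / \<beta>) * b powr (- 1 / \<beta>\<^sup>2))"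
  shows "AE x in lborel. x \<in> ball x0 (r / 2) \<longrightarrow> u x \<le> k0"
proof -
  have um [measurable]: "u \<in> borel_measurable borel" using u by (simp add: de_giorgi_class_def)
  define H where "H = H_fun p q s t m r"
  have Hm [measurable]: "H \<in> borel_measurable borel" unfolding H_def by measurable
  have H0: "0 \<le> H z" for z using m by (simp add: H_def H_fun_nonneg)
  have Hmono: "H x \<le> H y" if "0 \<le> x" "x \<le> y" for x y
    unfolding H_def using that pq m by (intro H_fun_mono) auto
  have Hk0: "0 < H k0" unfolding H_def using m r k0 by (intro H_fun_pos)
  have \<omega>: "0 < \<omega>" by (simp add: \<omega>_def)
  have \<beta>: "0 < \<beta>" using st pq by (simp add: \<beta>_def)
  define V where "V = \<omega> * r ^ CARD('n)"
  have V: "0 < V" using \<omega> r by (simp add: V_def)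
  define K1 where "K1 = (1 + 2 / \<omega> * L * (1 + \<Theta>)) * 2 powr \<beta>"
  have K1: "0 < K1" using \<omega> L \<Theta> by (simp add: K1_def add_pos_nonneg)
  have K: "0 < K" "K = K1 * 12 powr (real CARD('n) + q) * 2 powr (q - 1 + q * \<beta>)"
    using K1 by (auto simp: K_def K1_def)
  have b: "1 < b"
  proof -
    have "0 < q * \<beta>" "0 \<le> real CARD('n)" using pq \<beta> by auto
    then have "0 < real CARD('n) + q + (q - 1 + q * \<beta>)" using pq by linarith
    then show ?thesis unfolding b_def by (intro gr_one_powr) auto
  qed
  define \<theta> :: "nat \<Rightarrow> real" where "\<theta> j = (1/2) ^ j" for j
  have \<theta>: "0 < \<theta> j" "\<theta> j \<le> 1" "\<theta> (Suc j) = \<theta> j / 2" for j by (auto simp: \<theta>_def power_le_one)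
  define \<rho> where "\<rho> j = r / 2 * (1 + \<theta> j)" for j
  define k where "k j = (1 - \<theta> j) * k0" for j
  have k: "0 \<le> k j" "k j \<le> k0" for j
    using \<theta>[of j] k0 by (auto simp: k_def intro: mult_left_le_one_le)
  have \<rho>: "r / 2 \<le> \<rho> j" "\<rho> j \<le> r" for j
    using \<theta>[of j] r mult_left_mono[of "\<theta> j" 1 r] by (auto simp: \<rho>_def algebra_simps)
  define J where "J j = (\<integral>\<^sup>+ x\<in>ball x0 (\<rho> j). ennreal (H (max (u x - k j) 0)) \<partial>lborel)" for j
  have J_le: "J j \<le> ennreal I0" for j
  proof -
    have "J j \<le> (\<integral>\<^sup>+ x\<in>ball x0 r. ennreal (H (max (u x) 0)) \<partial>lborel)"
      unfolding J_def using k[of j] \<rho>[of j]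
      by (intro nn_integral_mono mult_mono ennreal_leI Hmono) (auto simp: indicator_def)
    also have "\<dots> \<le> ennreal I0" using I0 by (simp add: H_def)
    finally show ?thesis .
  qed
  define I where "I j = enn2real (J j)" for j
  have JI: "J j = ennreal (I j)" for j
    using J_le[of j] unfolding I_def by (intro ennreal_enn2real[symmetric]) (auto intro: le_less_trans)
  have I_nonneg: "0 \<le> I j" for j by (simp add: I_def)
  define Y where "Y j = I j / (V * H k0)" for j
  have Y0: "0 \<le> Y j" for j using V Hk0 I_nonneg by (simp add: Y_def)
  have "Y \<longlonglongrightarrow> 0"
  proof (rule superlinear_recursion_tendsto_zero[OF Y0 _ K(1) b \<beta>])
    show "Y 0 \<le> K powr (- 1 / \<beta>) * b powr (- 1 / \<beta>\<^sup>2)"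
    proof -
      have "I 0 \<le> I0" using J_le[of 0] I0 JI[of 0] by simp
      also have "I0 \<le> (V * H k0) * (K powr (- 1 / \<beta>) * b powr (- 1 / \<beta>\<^sup>2))"
        using start by (simp add: V_def H_def)
      finally show ?thesis using V Hk0 by (simp add: Y_def divide_le_eq mult.commute)
    qed
    fix j
    \<comment> \<open>A third of the gap between consecutive radii.\<close>
    define \<sigma> where "\<sigma> = r * \<theta> j / 12"
    have \<sigma>: "0 < \<sigma>" "\<rho> (Suc j) + 3 * \<sigma> = \<rho> j" "r / \<sigma> = 12 / \<theta> j"
      using r \<theta>[of j] by (auto simp: \<sigma>_def \<rho>_def \<theta>(3) algebra_simps)
    have lev: "k (Suc j) = k j + \<theta> (Suc j) * k0"
      by (simp add: k_def \<theta>(3) algebra_simps)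
    have "J (Suc j) \<le> ennreal ((1 + 2 / \<omega> * L * (1 + \<Theta>)) * 2 powr \<beta> * (r / \<sigma>) powr (real CARD('n) + q)
        * \<theta> (Suc j) powr (1 - q - q * \<beta>) * (I j / (\<omega> * r ^ CARD('n) * H_fun p q s t m r k0)) powr \<beta> * I j)"
      unfolding J_def lev H_def \<omega>_def \<beta>_def
    proof (rule de_giorgi_step[OF st pq m L u T \<Theta> r])
      show "(\<integral>\<^sup>+ x\<in>ball x0 (\<rho> (Suc j) + 3 * \<sigma>). ennreal (H_fun p q s t m r (max (u x - k j) 0)) \<partial>lborel) \<le> ennreal (I j)"
        using JI[of j] unfolding J_def H_def \<sigma>(2) by simp
    qed (use \<rho> \<sigma> k k0 \<theta> I_nonneg in auto)
    then have "ennreal (I (Suc j)) \<le> ennreal (K1 * (r / \<sigma>) powr (real CARD('n) + q) * \<theta> (Suc j) powr (1 - q - q * \<beta>) * Y j powr \<beta> * I j)"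
      unfolding JI K1_def Y_def V_def H_def by simp
    then have "I (Suc j) \<le> K1 * (r / \<sigma>) powr (real CARD('n) + q) * \<theta> (Suc j) powr (1 - q - q * \<beta>) * Y j powr \<beta> * I j"
      using K1 I_nonneg by (subst (asm) ennreal_le_iff) auto
    then have Ystep: "Y (Suc j) \<le> K1 * (r / \<sigma>) powr (real CARD('n) + q) * \<theta> (Suc j) powr (1 - q - q * \<beta>) * Y j powr \<beta> * Y j"
      unfolding Y_def[of "Suc j"] Y_def[of j] times_divide_eq_right
      using V Hk0 by (intro divide_right_mono) (auto simp: Y_def)
    define D where "D = (2::real) ^ j"
    have D: "\<theta> j = 1 / D" "0 < D" by (auto simp: \<theta>_def D_def power_one_over)
    define e1 e2 where "e1 = real CARD('n) + q" and "e2 = q - 1 + q * \<beta>"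
    have f1: "(r / \<sigma>) powr e1 = 12 powr e1 * D powr e1"
      unfolding \<sigma>(3) D(1) by (simp add: powr_mult)
    have f2: "\<theta> (Suc j) powr (1 - q - q * \<beta>) = 2 powr e2 * D powr e2"
    proof -
      have "1 - q - q * \<beta> = - e2" by (simp add: e2_def)
      then have "\<theta> (Suc j) powr (1 - q - q * \<beta>) = (1 / \<theta> (Suc j)) powr e2"
        by (simp only: powr_divide powr_one_eq_one powr_minus_divide)
      also have "1 / \<theta> (Suc j) = 2 * D" using \<theta>(3)[of j] D by simp
      finally show ?thesis by (simp only: powr_mult)
    qed
    have f3: "D powr e1 * D powr e2 = b ^ j"
    proof -
      have "b ^ j = (2 powr (e1 + e2)) powr real j"
        unfolding b_def e1_def e2_def by (rule powr_realpow[symmetric]) simp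
      also have "\<dots> = (2 powr real j) powr (e1 + e2)" by (rule powr_powr_swap)
      also have "2 powr real j = D" unfolding D_def by (rule powr_realpow) simp
      finally show ?thesis by (simp only: powr_add)
    qed
    have f4: "Y j powr \<beta> * Y j = Y j powr (1 + \<beta>)"
      using powr_mult_base[OF Y0[of j], of \<beta>] by (simp only: mult.commute)
    have "K1 * (12 powr e1 * D powr e1) * (2 powr e2 * D powr e2) * Y j powr \<beta> * Y j
        = (K1 * 12 powr e1 * 2 powr e2) * (D powr e1 * D powr e2) * (Y j powr \<beta> * Y j)"
      by (simp only: mult_ac)
    then show "Y (Suc j) \<le> K * b ^ j * Y j powr (1 + \<beta>)"
      using Ystep unfolding f3 f4 K(2) e1_def[symmetric] e2_def[symmetric] f1 f2 by (simp only:)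
  qed
  then have "(\<lambda>j. Y j * (V * H k0)) \<longlonglongrightarrow> 0 * (V * H k0)" by (intro tendsto_mult tendsto_const)
  then have lim: "I \<longlonglongrightarrow> 0" using V Hk0 by (simp add: Y_def)
  define X where "X = (\<integral>\<^sup>+ x\<in>ball x0 (r / 2). ennreal (H (max (u x - k0) 0)) \<partial>lborel)"
  have XI: "X \<le> ennreal (I j)" for j
    unfolding X_def JI[symmetric] J_def using k[of j] \<rho>[of j]
    by (intro nn_integral_mono mult_mono ennreal_leI Hmono) (auto simp: indicator_def)
  have "X = 0"
  proof -
    obtain X' where X': "X = ennreal X'" "0 \<le> X'" using XI[of 0] by (cases X) (auto simp: top_unique)
    have "X' \<le> I j" for j using XI[of j] X' I_nonneg by simp
    then have "X' \<le> 0" by (intro LIMSEQ_le_const[OF lim]) auto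
    then show ?thesis using X' by simp
  qed
  moreover have [measurable]: "ball x0 (r / 2) \<in> sets borel" by simp
  have "(\<lambda>x. ennreal (H (max (u x - k0) 0)) * indicator (ball x0 (r / 2)) x) \<in> borel_measurable lborel"
    by (intro borel_measurable_times_ennreal borel_measurable_indicator) auto
  ultimately have "AE x in lborel. ennreal (H (max (u x - k0) 0)) * indicator (ball x0 (r / 2)) x = 0"
    unfolding X_def by (subst (asm) nn_integral_0_iff_AE)
  then show ?thesis
  proof eventually_elim
    fix x assume z: "ennreal (H (max (u x - k0) 0)) * indicator (ball x0 (r / 2)) x = 0"
    show "x \<in> ball x0 (r / 2) \<longrightarrow> u x \<le> k0"
    proof (intro impI, rule ccontr)
      assume "x \<in> ball x0 (r / 2)" and n: "\<not> u x \<le> k0"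
      with z H0 have "H (max (u x - k0) 0) \<le> 0" by (simp add: ennreal_eq_0_iff)
      moreover have "0 < H (max (u x - k0) 0)" unfolding H_def using m r n by (intro H_fun_pos) auto
      ultimately show False by simp
    qed
  qed
qed

text \<open>
  Any level above the right-hand side satisfies both requirements of the iteration: the part
  with \<open>C\<close> makes the starting integral small, and the part with
  \<open>\<delta>\<close> bounds the tail by a multiple of \<open>h k0\<close>.  Working with
  strictly larger levels covers the case in which the right-hand side is zero.
\<close>

lemma de_giorgi_class_locally_bounded:
  fixes p q s t L \<delta> :: real
  assumes st: "0 < s" "s \<le> t" "t < 1" and pq: "1 < p" "p \<le> q" and L: "0 < L" and \<delta>: "0 < \<delta>" "\<delta> \<le> 1"
  shows "\<exists>C>0. \<forall>(x0 :: real ^ 'n) r m T I u. 0 < r \<and> 0 \<le> m \<and> 0 \<le> T \<and> 0 \<le> I \<and>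
    u \<in> de_giorgi_class p q s t m x0 r L T \<and>
    (\<integral>\<^sup>+ x\<in>ball x0 r. ennreal (H_fun p q s t m r (max (u x) 0)) \<partial>lborel) \<le> ennreal I \<longrightarrow>
    (AE x in lborel. x \<in> ball x0 (r / 2) \<longrightarrow>
       u x \<le> C * inv_into {0..} (H_fun p q s t m r) (I / (unit_ball_vol (real CARD('n)) * r ^ CARD('n)))
         + \<delta> * inv_into {0..} (h_fun p q s t m r) T)"
proof -
  define \<omega> where "\<omega> = unit_ball_vol (real CARD('n))"
  define \<beta> where "\<beta> = s * p / real CARD('n)"
  define \<Theta> where "\<Theta> = (1 / \<delta>) powr (q - 1)"
  define K where "K = (1 + 2 / \<omega> * L * (1 + \<Theta>)) * 2 powr \<beta> * 12 powr (real CARD('n) + q) * 2 powr (q - 1 + q * \<beta>)"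
  define b where "b = 2 powr (real CARD('n) + q + (q - 1 + q * \<beta>))"
  define \<kappa> where "\<kappa> = K powr (- 1 / \<beta>) * b powr (- 1 / \<beta>\<^sup>2)"
  have \<omega>: "0 < \<omega>" by (simp add: \<omega>_def)
  have \<Theta>: "0 \<le> \<Theta>" by (simp add: \<Theta>_def)
  have "0 < K" using \<omega> L \<Theta> by (simp add: K_def add_pos_nonneg)
  then have \<kappa>: "0 < \<kappa>" by (simp add: \<kappa>_def b_def)
  \<comment> \<open>Dividing the level by \<open>C\<close> lowers \<open>H\<close> at least by the factor \<open>\<kappa>\<close> that starts the recursion.\<close>
  define C where "C = max 1 (\<kappa> powr (- 1 / p))"
  have C1: "1 \<le> C" by (simp add: C_def)
  have C\<kappa>: "(1 / C) powr p \<le> \<kappa>"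
  proof -
    have "\<kappa> powr (- 1 / p) \<le> C" by (simp add: C_def)
    then have "(\<kappa> powr (- 1 / p)) powr p \<le> C powr p" using pq by (intro powr_mono2) auto
    moreover have "(\<kappa> powr (- 1 / p)) powr p = \<kappa> powr (- 1)"
      unfolding powr_powr using pq by simp
    ultimately have "1 / \<kappa> \<le> C powr p" using \<kappa> by simp
    then show ?thesis using \<kappa> C1 by (simp add: powr_divide field_simps)
  qed
  show ?thesis
  proof (rule exI[of _ C], intro conjI allI impI; (elim conjE)?)
    show "0 < C" using C1 by simp
    fix x0 :: "real ^ 'n" and r m T I :: real and u :: "real ^ 'n \<Rightarrow> real"
    assume r: "0 < r" and m: "0 \<le> m" and T: "0 \<le> T" and I: "0 \<le> I"
      and u: "u \<in> de_giorgi_class p q s t m x0 r L T"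
      and int: "(\<integral>\<^sup>+ x\<in>ball x0 r. ennreal (H_fun p q s t m r (max (u x) 0)) \<partial>lborel) \<le> ennreal I"
    define V where "V = \<omega> * r ^ CARD('n)"
    have V: "0 < V" using \<omega> r by (simp add: V_def)
    define z where "z = inv_into {0..} (H_fun p q s t m r) (I / V)"
    define \<tau> where "\<tau> = inv_into {0..} (h_fun p q s t m r) T"
    have IV: "0 \<le> I / V" "0 < p" "0 < q" "1 < q" using I V pq by auto
    have z: "0 \<le> z" "H_fun p q s t m r z = I / V"
      unfolding z_def using H_fun_inverse(1,2)[OF IV(2,3) m r IV(1)] by auto
    have \<tau>: "0 \<le> \<tau>" "h_fun p q s t m r \<tau> = T"
      unfolding \<tau>_def using h_fun_inverse[OF pq(1) IV(4) m r T] by auto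
    define B where "B = C * z + \<delta> * \<tau>"
    have B0: "0 \<le> B" "C * z \<le> B" "\<delta> * \<tau> \<le> B" using C1 z \<tau> \<delta> by (auto simp: B_def)
    have above: "AE x in lborel. x \<in> ball x0 (r / 2) \<longrightarrow> u x \<le> k0" if k0: "B < k0" for k0
    proof (rule de_giorgi_level_bound[OF st pq m L u r T _ \<Theta> _ int I])
      show "0 < k0" using k0 B0 by simp
      have "\<tau> \<le> 1 / \<delta> * k0" using B0 k0 \<delta> by (simp add: field_simps)
      then have "T \<le> h_fun p q s t m r (1 / \<delta> * k0)"
        unfolding \<tau>(2)[symmetric] using \<tau> pq m by (intro h_fun_mono) auto
      also have "\<dots> \<le> \<Theta> * h_fun p q s t m r k0"
        unfolding \<Theta>_def using pq m \<delta> by (intro h_fun_scale_up) auto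
      finally show "T \<le> \<Theta> * h_fun p q s t m r k0" .
      have "z \<le> 1 / C * k0" using B0 k0 C1 by (simp add: field_simps)
      then have "I / V \<le> H_fun p q s t m r (1 / C * k0)"
        unfolding z(2)[symmetric] using z pq m by (intro H_fun_mono) auto
      also have "\<dots> \<le> (1 / C) powr p * H_fun p q s t m r k0"
        using pq m C1 by (intro H_fun_scale_down) auto
      also have "\<dots> \<le> \<kappa> * H_fun p q s t m r k0"
        using C\<kappa> m by (intro mult_right_mono H_fun_nonneg)
      finally have "I \<le> V * H_fun p q s t m r k0 * \<kappa>"
        using V by (simp add: divide_le_eq mult_ac)
      then show "I \<le> unit_ball_vol (real CARD('n)) * r ^ CARD('n) * H_fun p q s t m r k0 *
         (((1 + 2 / unit_ball_vol (real CARD('n)) * L * (1 + \<Theta>)) * 2 powr (s * p / real CARD('n)) *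
           12 powr (real CARD('n) + q) * 2 powr (q - 1 + q * (s * p / real CARD('n)))) powr (- 1 / (s * p / real CARD('n))) *
          (2 powr (real CARD('n) + q + (q - 1 + q * (s * p / real CARD('n))))) powr (- 1 / (s * p / real CARD('n))\<^sup>2))"
        unfolding V_def \<kappa>_def K_def b_def \<beta>_def \<omega>_def .
    qed
    have "\<forall>i. AE x in lborel. x \<in> ball x0 (r / 2) \<longrightarrow> u x \<le> B + 1 / real (Suc i)"
      by (intro allI above) simp
    then have "AE x in lborel. \<forall>i. x \<in> ball x0 (r / 2) \<longrightarrow> u x \<le> B + 1 / real (Suc i)"
      by (rule iffD2[OF AE_all_countable])
    then have "AE x in lborel. x \<in> ball x0 (r / 2) \<longrightarrow> u x \<le> B"
    proof (rule AE_mp, intro AE_I2 impI)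
      fix x assume h: "\<forall>i. x \<in> ball x0 (r / 2) \<longrightarrow> u x \<le> B + 1 / real (Suc i)"
        and x: "x \<in> ball x0 (r / 2)"
      show "u x \<le> B"
      proof (rule field_le_epsilon)
        fix e :: real assume "0 < e"
        then obtain i where "1 / real (Suc i) < e" by (rule nat_approx_posE)
        moreover have "u x \<le> B + 1 / real (Suc i)" using h x by blast
        ultimately show "u x \<le> B + e" by linarith
      qed
    qed
    then show "AE x in lborel. x \<in> ball x0 (r / 2) \<longrightarrow>
       u x \<le> C * inv_into {0..} (H_fun p q s t m r) (I / (unit_ball_vol (real CARD('n)) * r ^ CARD('n)))
         + \<delta> * inv_into {0..} (h_fun p q s t m r) T"
      by (simp only: B_def z_def \<tau>_def V_def \<omega>_def)
  qed
qed

section \<open>Minimizers and the De Giorgi class\<close>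

text \<open>
  Being continuous, the coefficient is Borel, and the integrands below can be integrated
  iteratively.
\<close>

lemma hoelder_coefficient_borel:
  fixes a :: "real ^ 'n \<Rightarrow> real ^ 'n \<Rightarrow> real"
  assumes "hoelder_coefficient \<alpha> A a" "0 < \<alpha>"
  shows "(\<lambda>(x, y). a x y) \<in> borel_measurable borel"
proof -
  have "isCont (\<lambda>z. a (fst z) (snd z)) z0" for z0
  proof -
    have lim: "((\<lambda>z. A * (norm (fst z - fst z0) + norm (snd z - snd z0)) powr \<alpha>) \<longlongrightarrow> 0) (at z0)"
    proof -
      have "((\<lambda>z. norm (fst z - fst z0) + norm (snd z - snd z0)) \<longlongrightarrow> norm (fst z0 - fst z0) + norm (snd z0 - snd z0)) (at z0)"
        by (intro tendsto_intros)
      then have "((\<lambda>z. norm (fst z - fst z0) + norm (snd z - snd z0)) \<longlongrightarrow> 0) (at z0)" by simp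
      then have "((\<lambda>z. (norm (fst z - fst z0) + norm (snd z - snd z0)) powr \<alpha>) \<longlongrightarrow> 0) (at z0)"
        using assms(2) by (intro tendsto_zero_powrI[where b = \<alpha>]) (auto intro: always_eventually)
      then show ?thesis by (rule tendsto_mult_right_zero)
    qed
    have "((\<lambda>z. a (fst z) (snd z) - a (fst z0) (snd z0)) \<longlongrightarrow> 0) (at z0)"
      using assms(1) by (intro tendsto_0_le[OF lim, of _ 1] always_eventually)
        (auto simp: hoelder_coefficient_def intro: order_trans[OF _ abs_ge_self])
    then show ?thesis by (simp add: isCont_def LIM_zero_iff)
  qed
  then have "continuous_on UNIV (\<lambda>z. a (fst z) (snd z))"
    by (simp add: continuous_at_imp_continuous_on)
  then show ?thesis
    by (simp add: case_prod_beta' borel_measurable_continuous_onI)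
qed

lemma a_minus_bounds:
  fixes a :: "real ^ 'n \<Rightarrow> real ^ 'n \<Rightarrow> real"
  assumes a: "\<And>x y. 0 \<le> a x y" and hol: "hoelder_coefficient \<alpha> A a" "0 < \<alpha>" "0 \<le> A" and r: "0 < r"
  shows "0 \<le> a_minus a x0 r"
    and "x \<in> ball x0 r \<Longrightarrow> y \<in> ball x0 r \<Longrightarrow> a_minus a x0 r \<le> a x y"
    and "x \<in> ball x0 r \<Longrightarrow> y \<in> ball x0 r \<Longrightarrow> a x y \<le> a_minus a x0 r + A * (4 * r) powr \<alpha>"
proof -
  have ne: "ball x0 r \<times> ball x0 r \<noteq> {}" using r by auto
  show "0 \<le> a_minus a x0 r"
    unfolding a_minus_def using a by (intro cINF_greatest[OF ne]) auto
  show "x \<in> ball x0 r \<Longrightarrow> y \<in> ball x0 r \<Longrightarrow> a_minus a x0 r \<le> a x y"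
  proof -
    assume xy: "x \<in> ball x0 r" "y \<in> ball x0 r"
    have "bdd_below ((\<lambda>(x, y). a x y) ` (ball x0 r \<times> ball x0 r))"
      using a by (intro bdd_belowI[of _ 0]) auto
    then have "a_minus a x0 r \<le> (\<lambda>(x, y). a x y) (x, y)"
      unfolding a_minus_def using xy by (intro cINF_lower) auto
    then show "a_minus a x0 r \<le> a x y" by simp
  qed
  assume x: "x \<in> ball x0 r" and y: "y \<in> ball x0 r"
  have "a x y - A * (4 * r) powr \<alpha> \<le> a_minus a x0 r"
    unfolding a_minus_def
  proof (intro cINF_greatest[OF ne])
    fix z assume "z \<in> ball x0 r \<times> ball x0 r"
    then obtain x' y' where z: "z = (x', y')" "x' \<in> ball x0 r" "y' \<in> ball x0 r" by auto
    have "norm (x - x') \<le> 2 * r" "norm (y - y') \<le> 2 * r"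
      using dist_triangle3[of x x' x0] dist_triangle3[of y y' x0] x y z by (auto simp: dist_norm)
    then have "A * (norm (x - x') + norm (y - y')) powr \<alpha> \<le> A * (4 * r) powr \<alpha>"
      using hol by (intro mult_left_mono powr_mono2) auto
    moreover have "\<bar>a x y - a x' y'\<bar> \<le> A * (norm (x - x') + norm (y - y')) powr \<alpha>"
      using hol(1) by (simp add: hoelder_coefficient_def)
    ultimately show "a x y - A * (4 * r) powr \<alpha> \<le> (case z of (x, y) \<Rightarrow> a x y)"
      unfolding z(1) prod.case by linarith
  qed
  then show "a x y \<le> a_minus a x0 r + A * (4 * r) powr \<alpha>" by simp
qed

text \<open>
  The gap condition enters here and only here: \<open>r powr (\<alpha> - t q) \<le> r powr (- s
  p)\<close>, and \<open>z powr q\<close> is at most \<open>M powr (q - p)\<close> times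
  \<open>z powr p\<close>.
\<close>

lemma coefficient_oscillation_absorbed:
  fixes p q s t \<alpha> A M r m z :: real
  assumes pq: "0 < p" "p \<le> q" and gap: "t * q \<le> s * p + \<alpha>" and A: "0 \<le> A" and r: "0 < r" "r \<le> 1"
    and m: "0 \<le> m" and z: "0 \<le> z" "z \<le> M"
  shows "z powr p / r powr (s * p) + (m + A * (4 * r) powr \<alpha>) * (z powr q / r powr (t * q))
    \<le> (1 + A * 4 powr \<alpha> * M powr (q - p)) * H_fun p q s t m r z"
proof (cases "z = 0")
  case False
  then have z0: "0 < z" using z by simp
  have zq: "z powr q \<le> z powr p * M powr (q - p)"
  proof -
    have "z powr q = z powr p * z powr (q - p)" using z0 by (simp add: powr_add[symmetric])
    also have "\<dots> \<le> z powr p * M powr (q - p)"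
      using pq z by (intro mult_left_mono powr_mono2) auto
    finally show ?thesis .
  qed
  have rr: "r powr \<alpha> / r powr (t * q) \<le> 1 / r powr (s * p)"
  proof -
    have "r powr \<alpha> / r powr (t * q) = r powr (\<alpha> - t * q)" using r by (simp add: powr_diff)
    also have "\<dots> \<le> r powr (- (s * p))" using r gap by (intro powr_mono') auto
    finally show ?thesis by (simp add: powr_minus_divide)
  qed
  have "A * 4 powr \<alpha> * (z powr q * (r powr \<alpha> / r powr (t * q)))
      \<le> A * 4 powr \<alpha> * ((z powr p * M powr (q - p)) * (1 / r powr (s * p)))"
    using zq rr A by (intro mult_left_mono mult_mono) auto
  then have "A * (4 * r) powr \<alpha> * (z powr q / r powr (t * q)) \<le> A * 4 powr \<alpha> * M powr (q - p) * (z powr p / r powr (s * p))"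
    by (simp add: powr_mult mult_ac)
  also have "\<dots> \<le> A * 4 powr \<alpha> * M powr (q - p) * H_fun p q s t m r z"
    unfolding H_fun_def using A m by (intro mult_left_mono) auto
  finally have absorbed: "A * (4 * r) powr \<alpha> * (z powr q / r powr (t * q))
      \<le> A * 4 powr \<alpha> * M powr (q - p) * H_fun p q s t m r z" .
  have "z powr p / r powr (s * p) + (m + A * (4 * r) powr \<alpha>) * (z powr q / r powr (t * q))
      = H_fun p q s t m r z + A * (4 * r) powr \<alpha> * (z powr q / r powr (t * q))"
    by (simp add: H_fun_def algebra_simps)
  also have "\<dots> \<le> H_fun p q s t m r z + A * 4 powr \<alpha> * M powr (q - p) * H_fun p q s t m r z"
    using absorbed by (rule add_left_mono)
  also have "\<dots> = (1 + A * 4 powr \<alpha> * M powr (q - p)) * H_fun p q s t m r z"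
    by (simp only: distrib_right mult_1_left)
  finally show ?thesis .
qed (use pq in \<open>simp add: H_fun_def\<close>)

lemma minimizer_in_de_giorgi_class:
  fixes p q s t \<Lambda> \<alpha> A M :: real
  assumes st: "0 < s" "s < 1" "0 < t" "t < 1" and pq: "1 < p" "p \<le> q" and \<Lambda>: "1 \<le> \<Lambda>"
    and \<alpha>: "0 < \<alpha>" and A: "0 \<le> A" and gap: "t * q \<le> s * p + \<alpha>" and M: "0 \<le> M"
  shows "\<exists>L>0. \<forall>(\<Omega> :: (real ^ 'n) set) Ksp Ktq a x0 r u.
    open \<Omega> \<and> comparable_kernel \<Lambda> (s * p) Ksp \<and> comparable_kernel \<Lambda> (t * q) Ktq \<and>
    coefficient a \<and> hoelder_coefficient \<alpha> A a \<and> 0 < r \<and> r \<le> 1 \<and> ball x0 r \<subseteq> \<Omega> \<and>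
    u \<in> borel_measurable borel \<and> minimizer p q s t a Ksp Ktq \<Omega> u \<and>
    nonlocal_tail p q s t a (\<lambda>x. max (u x) 0) x0 r (r / 2) < \<infinity> \<and>
    (AE x in lborel. x \<in> ball x0 r \<longrightarrow> u x \<le> M) \<longrightarrow>
    u \<in> de_giorgi_class p q s t (a_minus a x0 r) x0 r L
      (enn2real (nonlocal_tail p q s t a (\<lambda>x. max (u x) 0) x0 r (r / 2)))"
proof -
  have p1: "1 \<le> p" using pq by simp
  obtain C where C: "0 < C" and cacc: "\<And>(\<Omega> :: (real ^ 'n) set) Ksp Ktq a x0 r u k \<rho> \<sigma> am ap.
    open \<Omega> \<and> comparable_kernel \<Lambda> (s * p) Ksp \<and> comparable_kernel \<Lambda> (t * q) Ktq \<and>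
    (\<forall>x y. 0 \<le> a x y \<and> a x y = a y x) \<and> (\<lambda>(x, y). a x y) \<in> borel_measurable borel \<and>
    u \<in> borel_measurable borel \<and> minimizer p q s t a Ksp Ktq \<Omega> u \<and> 0 \<le> k \<and>
    ball x0 r \<subseteq> \<Omega> \<and> 0 < \<rho> \<and> 0 < \<sigma> \<and> r / 2 \<le> \<rho> + 2 * \<sigma> \<and> \<rho> + 2 * \<sigma> \<le> r \<and>
    0 \<le> am \<and> (\<forall>x\<in>ball x0 r. \<forall>y\<in>ball x0 r. am \<le> a x y \<and> a x y \<le> ap) \<Longrightarrow>
    gagliardo_power p s (ball x0 \<rho>) (\<lambda>x. max (u x - k) 0)
      + ennreal am * gagliardo_power q t (ball x0 \<rho>) (\<lambda>x. max (u x - k) 0)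
    \<le> ennreal (C * (r / \<sigma>) powr (real CARD('n) + q)) *
      ((\<integral>\<^sup>+ x\<in>ball x0 (\<rho> + 2 * \<sigma>). ennreal (max (u x - k) 0 powr p / r powr (s * p)
          + ap * (max (u x - k) 0 powr q / r powr (t * q))) \<partial>lborel)
       + nonlocal_tail p q s t a (\<lambda>x. max (u x) 0) x0 r (r / 2)
         * (\<integral>\<^sup>+ x\<in>ball x0 (\<rho> + 2 * \<sigma>). ennreal (max (u x - k) 0) \<partial>lborel))"
    using minimizer_caccioppoli[OF st p1 pq(2) \<Lambda>, where 'n = 'n] by (elim exE conjE) blast
  define c where "c = 1 + A * 4 powr \<alpha> * M powr (q - p)"
  have c: "1 \<le> c" using A by (simp add: c_def)
  show ?thesis
  proof (rule exI[of _ "C * c"], intro conjI allI impI; (elim conjE)?)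
    show "0 < C * c" using C c by simp
    fix \<Omega> :: "(real ^ 'n) set" and Ksp Ktq a and x0 :: "real ^ 'n" and r :: real and u :: "real ^ 'n \<Rightarrow> real"
    assume \<Omega>: "open \<Omega>" and ker: "comparable_kernel \<Lambda> (s * p) Ksp" "comparable_kernel \<Lambda> (t * q) Ktq"
      and coef: "coefficient a" and hol: "hoelder_coefficient \<alpha> A a" and r: "0 < r" "r \<le> 1" and sub: "ball x0 r \<subseteq> \<Omega>"
      and u: "u \<in> borel_measurable borel" and min: "minimizer p q s t a Ksp Ktq \<Omega> u"
      and tail: "nonlocal_tail p q s t a (\<lambda>x. max (u x) 0) x0 r (r / 2) < \<infinity>"
      and bd: "AE x in lborel. x \<in> ball x0 r \<longrightarrow> u x \<le> M"
    note [measurable] = u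
    have a0: "\<And>x y. 0 \<le> a x y" "\<forall>x y. 0 \<le> a x y \<and> a x y = a y x" using coef by (auto simp: coefficient_def)
    define m where "m = a_minus a x0 r"
    define T where "T = enn2real (nonlocal_tail p q s t a (\<lambda>x. max (u x) 0) x0 r (r / 2))"
    have T: "nonlocal_tail p q s t a (\<lambda>x. max (u x) 0) x0 r (r / 2) = ennreal T"
      unfolding T_def using tail by (intro ennreal_enn2real[symmetric]) auto
    note am = a_minus_bounds[OF a0(1) hol \<alpha> A r(1), where ?x0.0 = x0, folded m_def]
    have "gagliardo_power p s (ball x0 \<rho>) (\<lambda>x. max (u x - k) 0)
         + ennreal m * gagliardo_power q t (ball x0 \<rho>) (\<lambda>x. max (u x - k) 0)
       \<le> ennreal (C * c * (r / \<sigma>) powr (real CARD('n) + q)) *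
         ((\<integral>\<^sup>+ x\<in>ball x0 (\<rho> + 2 * \<sigma>). ennreal (H_fun p q s t m r (max (u x - k) 0)) \<partial>lborel)
          + ennreal T * (\<integral>\<^sup>+ x\<in>ball x0 (\<rho> + 2 * \<sigma>). ennreal (max (u x - k) 0) \<partial>lborel))"
      if k: "0 \<le> k" and \<rho>: "0 < \<rho>" "0 < \<sigma>" "r / 2 \<le> \<rho> + 2 * \<sigma>" "\<rho> + 2 * \<sigma> \<le> r" for k \<rho> \<sigma>
    proof -
      define Q where "Q = (r / \<sigma>) powr (real CARD('n) + q)"
      define B where "B = ball x0 (\<rho> + 2 * \<sigma>)"
      have [measurable]: "B \<in> sets borel" by (simp add: B_def)
      have Br: "B \<subseteq> ball x0 r" using \<rho> unfolding B_def by (intro subset_ball)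
      define I J where "I = (\<integral>\<^sup>+ x\<in>B. ennreal (H_fun p q s t m r (max (u x - k) 0)) \<partial>lborel)"
        and "J = (\<integral>\<^sup>+ x\<in>B. ennreal (max (u x - k) 0) \<partial>lborel)"
      have "(\<integral>\<^sup>+ x\<in>B. ennreal (max (u x - k) 0 powr p / r powr (s * p)
          + (m + A * (4 * r) powr \<alpha>) * (max (u x - k) 0 powr q / r powr (t * q))) \<partial>lborel)
        \<le> (\<integral>\<^sup>+ x. ennreal c * (ennreal (H_fun p q s t m r (max (u x - k) 0)) * indicator B x) \<partial>lborel)"
      proof (intro nn_integral_mono_AE, use bd in eventually_elim)
        fix x assume x: "x \<in> ball x0 r \<longrightarrow> u x \<le> M"
        show "ennreal (max (u x - k) 0 powr p / r powr (s * p)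
          + (m + A * (4 * r) powr \<alpha>) * (max (u x - k) 0 powr q / r powr (t * q))) * indicator B x
          \<le> ennreal c * (ennreal (H_fun p q s t m r (max (u x - k) 0)) * indicator B x)"
        proof (cases "x \<in> B")
          case True
          then have "max (u x - k) 0 \<le> M" using x Br k M by auto
          then have "ennreal (max (u x - k) 0 powr p / r powr (s * p)
            + (m + A * (4 * r) powr \<alpha>) * (max (u x - k) 0 powr q / r powr (t * q)))
            \<le> ennreal (c * H_fun p q s t m r (max (u x - k) 0))"
            unfolding c_def using pq gap A r am(1) by (intro ennreal_leI coefficient_oscillation_absorbed) auto
          also have "\<dots> = ennreal c * ennreal (H_fun p q s t m r (max (u x - k) 0))"
            using c H_fun_nonneg[OF am(1)] by (intro ennreal_mult) auto
          finally show ?thesis using True by simp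
        qed simp
      qed
      also have "\<dots> = ennreal c * I"
        unfolding I_def by (intro nn_integral_cmult) measurable
      finally have Ile: "(\<integral>\<^sup>+ x\<in>B. ennreal (max (u x - k) 0 powr p / r powr (s * p)
          + (m + A * (4 * r) powr \<alpha>) * (max (u x - k) 0 powr q / r powr (t * q))) \<partial>lborel) \<le> ennreal c * I" .
      have "gagliardo_power p s (ball x0 \<rho>) (\<lambda>x. max (u x - k) 0)
         + ennreal m * gagliardo_power q t (ball x0 \<rho>) (\<lambda>x. max (u x - k) 0)
        \<le> ennreal (C * Q) * ((\<integral>\<^sup>+ x\<in>B. ennreal (max (u x - k) 0 powr p / r powr (s * p)
          + (m + A * (4 * r) powr \<alpha>) * (max (u x - k) 0 powr q / r powr (t * q))) \<partial>lborel) + ennreal T * J)"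
        unfolding Q_def B_def J_def T[symmetric]
        by (rule cacc[where \<Omega> = \<Omega> and Ksp = Ksp and Ktq = Ktq])
           (intro conjI \<Omega> ker a0(2) hoelder_coefficient_borel[OF hol \<alpha>] u min k sub \<rho> am(1) ballI am(2,3))
      also have "\<dots> \<le> ennreal (C * Q) * (ennreal c * I + ennreal c * (ennreal T * J))"
      proof (intro mult_left_mono add_mono Ile)
        have "1 * (ennreal T * J) \<le> ennreal c * (ennreal T * J)"
          using c by (intro mult_right_mono) auto
        then show "ennreal T * J \<le> ennreal c * (ennreal T * J)" by simp
      qed auto
      also have "\<dots> = ennreal (C * c * Q) * (I + ennreal T * J)"
      proof -
        have "ennreal (C * c * Q) = ennreal (C * Q) * ennreal c"
          using C c by (subst ennreal_mult[symmetric]) (auto simp: Q_def mult_ac)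
        then show ?thesis by (simp only: distrib_left mult.assoc)
      qed
      finally show ?thesis by (simp only: Q_def I_def J_def B_def)
    qed
    then have "u \<in> de_giorgi_class p q s t m x0 r (C * c) T"
      using u unfolding de_giorgi_class_def by blast
    then show "u \<in> de_giorgi_class p q s t (a_minus a x0 r) x0 r (C * c)
      (enn2real (nonlocal_tail p q s t a (\<lambda>x. max (u x) 0) x0 r (r / 2)))"
      by (simp only: m_def T_def)
  qed
qed

text \<open>
  Outside \<open>ball x0 (r / 2)\<close> the weights \<open>norm (x - x0)\<close> and \<open>1 +
  norm x\<close> are comparable, with a constant depending on \<open>x0\<close> and
  \<open>r\<close>.  Only finiteness matters: it makes the real number in the statement equal to
  the tail.
\<close>

lemma nonlocal_tail_finite:
  fixes u :: "real ^ 'n \<Rightarrow> real"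
  assumes [measurable]: "u \<in> borel_measurable borel" and a: "(\<lambda>(x, y). a x y) \<in> borel_measurable borel" "coefficient a"
    and tails: "u \<in> tail_space p s" "u \<in> weighted_tail_space q t a \<Omega>"
    and sub: "ball x0 r \<subseteq> \<Omega>" and r: "0 < r" and pos: "0 \<le> s * p" "0 \<le> t * q" "1 \<le> p" "1 \<le> q"
  shows "nonlocal_tail p q s t a (\<lambda>x. max (u x) 0) x0 r (r / 2) < \<infinity>"
proof -
  define \<kappa> where "\<kappa> = 1 + 2 * (1 + norm x0) / r"
  have \<kappa>: "1 \<le> \<kappa>" using r by (simp add: \<kappa>_def)
  have a0: "0 \<le> a x y" "a x y = a y x" for x y using a(2) by (auto simp: coefficient_def)
  have far: "1 / norm (x - x0) powr c \<le> \<kappa> powr c * (1 / (1 + norm x) powr c)"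
    if x: "x \<notin> ball x0 (r / 2)" and c: "0 \<le> c" for x c
  proof -
    have d: "r / 2 \<le> norm (x - x0)" using x by (simp add: dist_norm norm_minus_commute)
    have "(1 + norm x0) * (r / 2) \<le> (1 + norm x0) * norm (x - x0)"
      using d by (intro mult_left_mono) auto
    then have "1 + norm x0 \<le> 2 * (1 + norm x0) / r * norm (x - x0)" using r by (simp add: field_simps)
    moreover have "norm x \<le> norm x0 + norm (x - x0)" using norm_triangle_sub[of x x0] .
    ultimately have "1 + norm x \<le> \<kappa> * norm (x - x0)" by (simp add: \<kappa>_def algebra_simps)
    then have "(1 + norm x) powr c \<le> (\<kappa> * norm (x - x0)) powr c"
      using c by (intro powr_mono2) auto
    moreover have "0 < norm (x - x0)" using d r by linarith
    moreover have "0 < 1 + norm x" by (rule add_pos_nonneg) auto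
    then have "0 < (1 + norm x) powr c" by simp
    ultimately show ?thesis by (simp add: powr_mult divide_simps)
  qed
  have am: "(\<lambda>x. a x y) \<in> borel_measurable borel" for y
    using measurable_compose[OF _ a(1), of "\<lambda>x. (x, y)" borel] by (simp add: borel_prod[symmetric])
  have compare: "(\<integral>\<^sup>+ x. ennreal (g x * (max (u x) 0 powr e / norm (x - x0) powr c)) \<partial>lebesgue_on (- ball x0 (r / 2)))
      \<le> ennreal (\<kappa> powr c) * (\<integral>\<^sup>+ x. ennreal (g x * (\<bar>u x\<bar> powr e / (1 + norm x) powr c)) \<partial>lebesgue)"
    if [measurable]: "g \<in> borel_measurable borel" and g0: "\<And>x. 0 \<le> g x" and e: "0 \<le> e" and c: "0 \<le> c" for g :: "real ^ 'n \<Rightarrow> real" and e c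
  proof -
    have "(\<integral>\<^sup>+ x. ennreal (g x * (max (u x) 0 powr e / norm (x - x0) powr c)) \<partial>lebesgue_on (- ball x0 (r / 2)))
        = (\<integral>\<^sup>+ x\<in>- ball x0 (r / 2). ennreal (g x * (max (u x) 0 powr e / norm (x - x0) powr c)) \<partial>lborel)"
      by (rule nn_integral_lebesgue_on) auto
    also have "\<dots> \<le> (\<integral>\<^sup>+ x. ennreal (\<kappa> powr c) * ennreal (g x * (\<bar>u x\<bar> powr e / (1 + norm x) powr c)) \<partial>lborel)"
    proof (intro nn_integral_mono)
      fix x
      show "ennreal (g x * (max (u x) 0 powr e / norm (x - x0) powr c)) * indicator (- ball x0 (r / 2)) x
        \<le> ennreal (\<kappa> powr c) * ennreal (g x * (\<bar>u x\<bar> powr e / (1 + norm x) powr c))"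
      proof (cases "x \<in> ball x0 (r / 2)")
        case False
        have "g x * max (u x) 0 powr e * (1 / norm (x - x0) powr c)
            \<le> g x * \<bar>u x\<bar> powr e * (\<kappa> powr c * (1 / (1 + norm x) powr c))"
          using g0 e far[OF False c] by (intro mult_mono mult_left_mono powr_mono2 mult_nonneg_nonneg) auto
        then have "ennreal (g x * (max (u x) 0 powr e / norm (x - x0) powr c))
            \<le> ennreal (\<kappa> powr c * (g x * (\<bar>u x\<bar> powr e / (1 + norm x) powr c)))"
          by (intro ennreal_leI) (simp add: mult_ac)
        also have "\<dots> = ennreal (\<kappa> powr c) * ennreal (g x * (\<bar>u x\<bar> powr e / (1 + norm x) powr c))"
          using g0[of x] by (intro ennreal_mult) auto
        finally show ?thesis using False by simp
      qed simp
    qed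
    also have "\<dots> = ennreal (\<kappa> powr c) * (\<integral>\<^sup>+ x. ennreal (g x * (\<bar>u x\<bar> powr e / (1 + norm x) powr c)) \<partial>lborel)"
      by (intro nn_integral_cmult) measurable
    finally show ?thesis by (simp add: nn_integral_completion)
  qed
  define cp cq where "cp = real CARD('n) + s * p" and "cq = real CARD('n) + t * q"
  have c0: "0 \<le> cp" "0 \<le> cq" using pos by (auto simp: cp_def cq_def)
  have "(\<integral>\<^sup>+ x. ennreal (max (u x) 0 powr (p - 1) / norm (x - x0) powr cp) \<partial>lebesgue_on (- ball x0 (r / 2)))
      \<le> ennreal (\<kappa> powr cp) * (\<integral>\<^sup>+ x. ennreal (\<bar>u x\<bar> powr (p - 1) / (1 + norm x) powr cp) \<partial>lebesgue)"
    using compare[of "\<lambda>_. 1" "p - 1" cp] pos c0 by simp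
  also have "\<dots> < \<infinity>"
    using tails(1) by (simp add: tail_space_def cp_def ennreal_mult_less_top)
  finally have fin1: "(\<integral>\<^sup>+ x. ennreal (max (u x) 0 powr (p - 1) / norm (x - x0) powr cp) \<partial>lebesgue_on (- ball x0 (r / 2))) < \<infinity>" .
  define S where "S = (SUP x\<in>\<Omega>. \<integral>\<^sup>+ y. ennreal (a x y * (\<bar>u y\<bar> powr (q - 1) / (1 + norm y) powr cq)) \<partial>lebesgue)"
  have S: "S < \<infinity>" using tails(2) by (simp add: weighted_tail_space_def S_def cq_def)
  have "(SUP y\<in>ball x0 r. \<integral>\<^sup>+ x. ennreal (a x y * (max (u x) 0 powr (q - 1) / norm (x - x0) powr cq)) \<partial>lebesgue_on (- ball x0 (r / 2)))
      \<le> ennreal (\<kappa> powr cq) * S"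
  proof (rule SUP_least)
    fix y assume y: "y \<in> ball x0 r"
    have "(\<integral>\<^sup>+ x. ennreal (a x y * (max (u x) 0 powr (q - 1) / norm (x - x0) powr cq)) \<partial>lebesgue_on (- ball x0 (r / 2)))
      \<le> ennreal (\<kappa> powr cq) * (\<integral>\<^sup>+ x. ennreal (a x y * (\<bar>u x\<bar> powr (q - 1) / (1 + norm x) powr cq)) \<partial>lebesgue)"
      using am a0(1) pos c0 by (intro compare) auto
    also have "\<dots> \<le> ennreal (\<kappa> powr cq) * S"
      unfolding S_def a0(2)[of _ y] using y sub by (intro mult_left_mono SUP_upper) auto
    finally show "(\<integral>\<^sup>+ x. ennreal (a x y * (max (u x) 0 powr (q - 1) / norm (x - x0) powr cq)) \<partial>lebesgue_on (- ball x0 (r / 2)))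
      \<le> ennreal (\<kappa> powr cq) * S" .
  qed
  also have "\<dots> < \<infinity>" using S by (simp add: ennreal_mult_less_top)
  finally show ?thesis
    unfolding nonlocal_tail_def cp_def[symmetric] cq_def[symmetric] using fin1 by simp
qed

section \<open>The supremum bound\<close>

text \<open>
  Both forms of the data norm control the oscillation of \<open>u\<close> about some number;
  only in the first form is that number known.
\<close>

lemma data_norm_oscillation:
  fixes p s M :: real
  assumes s: "0 < s" and p: "1 < p"
  shows "\<exists>N\<ge>0. \<forall>(x0 :: real ^ 'n) r u. 0 < r \<and> r \<le> 1 \<and> u \<in> borel_measurable borel \<and> has_data_norm p s (ball x0 r) u M
    \<longrightarrow> (\<exists>c. AE x in lborel. x \<in> ball x0 r \<longrightarrow> \<bar>u x - c\<bar> \<le> N)"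
proof (cases "s * p \<le> real CARD('n)")
  case True
  show ?thesis
  proof (rule exI[of _ "\<bar>M\<bar>"], intro conjI allI impI; (elim conjE)?)
    fix x0 :: "real ^ 'n" and r :: real and u
    assume "has_data_norm p s (ball x0 r) u M"
    then have M: "esssup (lebesgue_on (ball x0 r)) (\<lambda>x. ereal \<bar>u x\<bar>) = ereal M"
      using True by (simp add: has_data_norm_def)
    have "AE x in lebesgue_on (ball x0 r). ereal \<bar>u x\<bar> \<le> ereal M"
      using esssup_AE[where M = "lebesgue_on (ball x0 r)" and f = "\<lambda>x. ereal \<bar>u x\<bar>"] unfolding M .
    then have "AE x in lebesgue. x \<in> ball x0 r \<longrightarrow> \<bar>u x\<bar> \<le> M"
      by (subst (asm) AE_restrict_space_iff) auto
    then have "AE x in lborel. x \<in> ball x0 r \<longrightarrow> \<bar>u x\<bar> \<le> M" by (simp add: AE_completion_iff)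
    then show "\<exists>c. AE x in lborel. x \<in> ball x0 r \<longrightarrow> \<bar>u x - c\<bar> \<le> \<bar>M\<bar>"
      by (intro exI[of _ 0]) (auto elim!: eventually_mono)
  qed simp
next
  case False
  then have sp: "real CARD('n) < s * p" by simp
  have p1: "1 \<le> p" and Q: "0 \<le> M powr p" using p by auto
  obtain N where N: "0 \<le> N" and morrey: "\<And>(x0 :: real ^ 'n) r u. 0 < r \<and> r \<le> 1 \<and> u \<in> borel_measurable borel \<and>
      gagliardo_power p s (ball x0 r) u \<le> ennreal (M powr p)
    \<Longrightarrow> (\<exists>c. AE x in lborel. x \<in> ball x0 r \<longrightarrow> \<bar>u x - c\<bar> \<le> N)"
    using morrey_oscillation_bound[OF s p1 sp Q] by (elim exE conjE) blast
  show ?thesis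
  proof (rule exI[of _ N], intro conjI N allI impI; elim conjE)
    fix x0 :: "real ^ 'n" and r :: real and u
    assume r: "0 < r" "r \<le> 1" and u: "u \<in> borel_measurable borel" and d: "has_data_norm p s (ball x0 r) u M"
    define g where "g = gagliardo_power p s (ball x0 r) u"
    have g: "g < \<infinity>" "M = enn2real g powr (1 / p)" using d False by (auto simp: has_data_norm_def g_def)
    then have "M powr p = enn2real g" using p by (simp add: powr_powr)
    then have "g \<le> ennreal (M powr p)" using g by (simp add: ennreal_enn2real)
    then show "\<exists>c. AE x in lborel. x \<in> ball x0 r \<longrightarrow> \<bar>u x - c\<bar> \<le> N"
      using r u by (intro morrey) (auto simp: g_def)
  qed
qed

text \<open>
  The two cases are distinguished by the size of \<open>c\<close>, the approximate value of
  \<open>u\<close> on the ball.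
\<close>

lemma minimizer_sup_bound_borel:
  fixes p q s t \<Lambda> \<alpha> A M \<delta> :: real
  assumes st: "0 < s" "s \<le> t" "t < 1" and pq: "1 < p" "p \<le> q" and \<Lambda>: "\<Lambda> \<ge> 1"
    and \<alpha>: "0 < \<alpha>" and A: "A \<ge> 0" and gap: "t * q \<le> s * p + \<alpha>" and \<delta>: "0 < \<delta>" "\<delta> \<le> 1"
  shows "\<exists>C>0. \<forall>(\<Omega> :: (real ^ 'n) set) Ksp Ktq a x0 r u.
    open \<Omega> \<and> comparable_kernel \<Lambda> (s * p) Ksp \<and> comparable_kernel \<Lambda> (t * q) Ktq \<and>
    coefficient a \<and> hoelder_coefficient \<alpha> A a \<and> 0 < r \<and> r \<le> 1 \<and> ball x0 r \<subseteq> \<Omega> \<and>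
    u \<in> borel_measurable borel \<and> u \<in> tail_space p s \<and> u \<in> weighted_tail_space q t a \<Omega> \<and>
    minimizer p q s t a Ksp Ktq \<Omega> u \<and> has_data_norm p s (ball x0 r) u M \<longrightarrow>
    (AE x in lborel. x \<in> ball x0 (r / 2) \<longrightarrow>
      u x \<le> C * inv_into {0..} (H_fun p q s t (a_minus a x0 r) r)
               (enn2real (\<integral>\<^sup>+ x\<in>ball x0 r. ennreal (H_fun p q s t (a_minus a x0 r) r (max (u x) 0)) \<partial>lborel)
                 / (unit_ball_vol (real CARD('n)) * r ^ CARD('n)))
             + \<delta> * inv_into {0..} (h_fun p q s t (a_minus a x0 r) r)
               (enn2real (nonlocal_tail p q s t a (\<lambda>x. max (u x) 0) x0 r (r / 2))))"
proof -
  have st': "s < 1" "0 < t" and q1: "1 < q" using st pq by auto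
  obtain N where N: "0 \<le> N" and osc: "\<And>(x0 :: real ^ 'n) r u. 0 < r \<and> r \<le> 1 \<and> u \<in> borel_measurable borel \<and> has_data_norm p s (ball x0 r) u M
    \<Longrightarrow> (\<exists>c. AE x in lborel. x \<in> ball x0 r \<longrightarrow> \<bar>u x - c\<bar> \<le> N)"
    using data_norm_oscillation[OF st(1) pq(1), where 'n = 'n and M = M] by (elim exE conjE) blast
  have N3: "0 \<le> 3 * N" using N by simp
  obtain L where L: "0 < L" and dgc: "\<And>(\<Omega> :: (real ^ 'n) set) Ksp Ktq a x0 r u.
    open \<Omega> \<and> comparable_kernel \<Lambda> (s * p) Ksp \<and> comparable_kernel \<Lambda> (t * q) Ktq \<and>
    coefficient a \<and> hoelder_coefficient \<alpha> A a \<and> 0 < r \<and> r \<le> 1 \<and> ball x0 r \<subseteq> \<Omega> \<and>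
    u \<in> borel_measurable borel \<and> minimizer p q s t a Ksp Ktq \<Omega> u \<and>
    nonlocal_tail p q s t a (\<lambda>x. max (u x) 0) x0 r (r / 2) < \<infinity> \<and>
    (AE x in lborel. x \<in> ball x0 r \<longrightarrow> u x \<le> 3 * N) \<Longrightarrow>
    u \<in> de_giorgi_class p q s t (a_minus a x0 r) x0 r L
      (enn2real (nonlocal_tail p q s t a (\<lambda>x. max (u x) 0) x0 r (r / 2)))"
    using minimizer_in_de_giorgi_class[OF st(1) st'(1) st'(2) st(3) pq \<Lambda> \<alpha> A gap N3, where 'n = 'n]
    by (elim exE conjE) blast
  obtain D where D: "0 < D" and bound: "\<And>(x0 :: real ^ 'n) r m T I u. 0 < r \<and> 0 \<le> m \<and> 0 \<le> T \<and> 0 \<le> I \<and>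
    u \<in> de_giorgi_class p q s t m x0 r L T \<and>
    (\<integral>\<^sup>+ x\<in>ball x0 r. ennreal (H_fun p q s t m r (max (u x) 0)) \<partial>lborel) \<le> ennreal I \<Longrightarrow>
    (AE x in lborel. x \<in> ball x0 (r / 2) \<longrightarrow>
       u x \<le> D * inv_into {0..} (H_fun p q s t m r) (I / (unit_ball_vol (real CARD('n)) * r ^ CARD('n)))
         + \<delta> * inv_into {0..} (h_fun p q s t m r) T)"
    using de_giorgi_class_locally_bounded[OF st pq L \<delta>, where 'n = 'n] by (elim exE conjE) blast
  show ?thesis
  \<comment> \<open>The constant \<open>3\<close> serves the case of a large value \<open>c\<close>, where \<open>u \<le> 3 c / 2\<close>.\<close>
  proof (rule exI[of _ "max D 3"], intro conjI allI impI; (elim conjE)?)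
    show "0 < max D 3" by simp
    fix \<Omega> :: "(real ^ 'n) set" and Ksp Ktq a and x0 :: "real ^ 'n" and r :: real and u :: "real ^ 'n \<Rightarrow> real"
    assume \<Omega>: "open \<Omega>" and ker: "comparable_kernel \<Lambda> (s * p) Ksp" "comparable_kernel \<Lambda> (t * q) Ktq"
      and coef: "coefficient a" and hol: "hoelder_coefficient \<alpha> A a" and r: "0 < r" "r \<le> 1" and sub: "ball x0 r \<subseteq> \<Omega>"
      and u: "u \<in> borel_measurable borel" and tails: "u \<in> tail_space p s" "u \<in> weighted_tail_space q t a \<Omega>"
      and min: "minimizer p q s t a Ksp Ktq \<Omega> u" and data: "has_data_norm p s (ball x0 r) u M"
    note [measurable] = u
    have a0: "\<And>x y. 0 \<le> a x y" using coef by (auto simp: coefficient_def)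
    define m where "m = a_minus a x0 r"
    have m: "0 \<le> m" unfolding m_def by (rule a_minus_bounds[OF a0 hol \<alpha> A r(1)])
    define T where "T = enn2real (nonlocal_tail p q s t a (\<lambda>x. max (u x) 0) x0 r (r / 2))"
    have T0: "0 \<le> T" by (simp add: T_def)
    have tail: "nonlocal_tail p q s t a (\<lambda>x. max (u x) 0) x0 r (r / 2) < \<infinity>"
      using st st' pq q1
      by (intro nonlocal_tail_finite[OF u hoelder_coefficient_borel[OF hol \<alpha>] coef tails sub r(1)]) auto
    define V where "V = unit_ball_vol (real CARD('n)) * r ^ CARD('n)"
    have V: "0 < V" using r by (simp add: V_def)
    have eV: "emeasure lborel (ball x0 r) = ennreal V"
      using r by (simp add: V_def emeasure_lborel_ball_cart)
    define H where "H = H_fun p q s t m r"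
    have [measurable]: "H \<in> borel_measurable borel" unfolding H_def by measurable
    have H0: "0 \<le> H z" for z using m by (simp add: H_def H_fun_nonneg)
    have Hmono: "H x \<le> H y" if "0 \<le> x" "x \<le> y" for x y
      unfolding H_def using that pq m by (intro H_fun_mono) auto
    define I where "I = (\<integral>\<^sup>+ x\<in>ball x0 r. ennreal (H (max (u x) 0)) \<partial>lborel)"
    obtain c where c: "AE x in lborel. x \<in> ball x0 r \<longrightarrow> \<bar>u x - c\<bar> \<le> N"
      using osc[of r u x0] r u data by auto
    have "I \<le> (\<integral>\<^sup>+ x. ennreal (H (\<bar>c\<bar> + N)) * indicator (ball x0 r) x \<partial>lborel)"
      unfolding I_def
    proof (intro nn_integral_mono_AE, use c in eventually_elim)
      fix x assume "x \<in> ball x0 r \<longrightarrow> \<bar>u x - c\<bar> \<le> N"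
      then show "ennreal (H (max (u x) 0)) * indicator (ball x0 r) x \<le> ennreal (H (\<bar>c\<bar> + N)) * indicator (ball x0 r) x"
        by (auto simp: indicator_def intro!: ennreal_leI Hmono)
    qed
    also have "\<dots> < \<infinity>" using eV by (simp add: nn_integral_cmult_indicator ennreal_mult_less_top)
    finally have fin: "I < \<infinity>" .
    define I' where "I' = enn2real I"
    have I': "I = ennreal I'" "0 \<le> I'" using fin by (auto simp: I'_def ennreal_enn2real)
    define z where "z = inv_into {0..} H (I' / V)"
    define \<tau> where "\<tau> = inv_into {0..} (h_fun p q s t m r) T"
    have pq0: "0 < p" "0 < q" "0 \<le> I' / V" using pq I' V by auto
    note Hinv = H_fun_inverse[OF pq0(1,2) m r(1) pq0(3), where s = s and t = t, folded H_def, folded z_def]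
    have \<tau>: "0 \<le> \<tau>" unfolding \<tau>_def by (rule h_fun_inverse(1)[OF pq(1) q1 m r(1) T0])
    have "AE x in lborel. x \<in> ball x0 (r / 2) \<longrightarrow> u x \<le> max D 3 * z + \<delta> * \<tau>"
    proof (cases "c \<le> 2 * N")
      case True
      have "AE x in lborel. x \<in> ball x0 r \<longrightarrow> u x \<le> 3 * N"
        using c by eventually_elim (use True in auto)
      then have "u \<in> de_giorgi_class p q s t m x0 r L T"
        unfolding m_def T_def using \<Omega> ker coef hol r sub u min tail by (intro dgc) blast
      then have "AE x in lborel. x \<in> ball x0 (r / 2) \<longrightarrow> u x \<le> D * z + \<delta> * \<tau>"
        unfolding z_def \<tau>_def V_def H_def using r m T0 I' unfolding I_def H_def by (intro bound) auto
      moreover have "D * z \<le> max D 3 * z" using Hinv(1) by (intro mult_right_mono) auto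
      ultimately show ?thesis by (auto elim!: eventually_mono)
    next
      case False
      have "ennreal (H (c / 2)) * ennreal V = (\<integral>\<^sup>+ x. ennreal (H (c / 2)) * indicator (ball x0 r) x \<partial>lborel)"
        by (simp add: nn_integral_cmult_indicator eV)
      also have "\<dots> \<le> I"
        unfolding I_def
      proof (intro nn_integral_mono_AE, use c in eventually_elim)
        fix x assume "x \<in> ball x0 r \<longrightarrow> \<bar>u x - c\<bar> \<le> N"
        then show "ennreal (H (c / 2)) * indicator (ball x0 r) x \<le> ennreal (H (max (u x) 0)) * indicator (ball x0 r) x"
          using False N by (auto simp: indicator_def intro!: ennreal_leI Hmono)
      qed
      finally have "H (c / 2) * V \<le> I'"
        using I' H0[of "c / 2"] V by (simp add: ennreal_mult[symmetric])
      then have "H (c / 2) \<le> I' / V" using V by (simp add: field_simps)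
      then have "c / 2 \<le> z" using False N by (intro Hinv(3)) auto
      moreover have "3 * z \<le> max D 3 * z" using Hinv(1) by (intro mult_right_mono) auto
      moreover have "0 \<le> \<delta> * \<tau>" using \<delta> \<tau> by simp
      ultimately have cN: "c + N \<le> max D 3 * z + \<delta> * \<tau>" using False by linarith
      show ?thesis
      proof (rule AE_mp[OF c], intro AE_I2 impI)
        fix x assume 1: "x \<in> ball x0 r \<longrightarrow> \<bar>u x - c\<bar> \<le> N" and "x \<in> ball x0 (r / 2)"
        then have "x \<in> ball x0 r" using r by simp
        with 1 have "\<bar>u x - c\<bar> \<le> N" by blast
        with cN show "u x \<le> max D 3 * z + \<delta> * \<tau>" by linarith
      qed
    qed
    then show "AE x in lborel. x \<in> ball x0 (r / 2) \<longrightarrow>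
      u x \<le> max D 3 * inv_into {0..} (H_fun p q s t (a_minus a x0 r) r)
               (enn2real (\<integral>\<^sup>+ x\<in>ball x0 r. ennreal (H_fun p q s t (a_minus a x0 r) r (max (u x) 0)) \<partial>lborel)
                 / (unit_ball_vol (real CARD('n)) * r ^ CARD('n)))
             + \<delta> * inv_into {0..} (h_fun p q s t (a_minus a x0 r) r)
               (enn2real (nonlocal_tail p q s t a (\<lambda>x. max (u x) 0) x0 r (r / 2)))"
      unfolding z_def \<tau>_def V_def H_def m_def T_def I'_def I_def .
  qed
qed

lemma nn_integral_lebesgue_on_cong_AE:
  assumes "S \<in> sets lebesgue" "AE x in lborel. x \<in> S \<longrightarrow> f x = g x"
  shows "(\<integral>\<^sup>+ x. f x \<partial>lebesgue_on S) = (\<integral>\<^sup>+ x. g x \<partial>lebesgue_on S)"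
  unfolding nn_integral_lebesgue_on[OF assms(1)]
proof (rule nn_integral_cong_AE, rule AE_mp[OF assms(2)], intro AE_I2 impI)
  fix x assume "x \<in> S \<longrightarrow> f x = g x"
  then show "f x * indicator S x = g x * indicator S x" by (cases "x \<in> S") auto
qed

text \<open>
  The set where \<open>P\<close> fails for one of the coordinates is covered by two null strips.
\<close>

lemma AE_lborel_product:
  fixes P :: "'a::euclidean_space \<Rightarrow> bool"
  assumes "AE x in lborel. P x"
  shows "AE z in lborel. P (fst z) \<and> P (snd z)"
proof -
  obtain N where "N \<in> null_sets lborel" and "{x \<in> space lborel. \<not> P x} \<subseteq> N"
    using assms unfolding eventually_ae_filter by blast
  then have N: "P x \<or> x \<in> N" "N \<in> null_sets lborel" for x by auto
  have [measurable]: "N \<in> sets borel" and N0: "emeasure lborel N = 0" using N by auto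
  have "N \<times> UNIV \<in> null_sets (lborel \<Otimes>\<^sub>M (lborel :: 'a measure))"
    using N0 by (intro null_setsI) (simp_all add: lborel.emeasure_pair_measure_Times)
  moreover have "UNIV \<times> N \<in> null_sets ((lborel :: 'a measure) \<Otimes>\<^sub>M lborel)"
    using N0 by (intro null_setsI) (simp_all add: lborel.emeasure_pair_measure_Times)
  ultimately have "N \<times> UNIV \<union> UNIV \<times> N \<in> null_sets (lborel :: ('a \<times> 'a) measure)"
    unfolding lborel_prod by (rule null_sets.Un)
  moreover have "{z \<in> space lborel. \<not> (P (fst z) \<and> P (snd z))} \<subseteq> N \<times> UNIV \<union> UNIV \<times> N"
  proof
    fix z assume "z \<in> {z \<in> space lborel. \<not> (P (fst z) \<and> P (snd z))}"
    then have "fst z \<in> N \<or> snd z \<in> N" using N(1)[of "fst z"] N(1)[of "snd z"] by auto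
    then show "z \<in> N \<times> UNIV \<union> UNIV \<times> N" by (cases z) auto
  qed
  ultimately show ?thesis by (intro AE_I')
qed

lemma energy_cong_AE:
  fixes u v :: "real ^ 'n \<Rightarrow> real"
  assumes "open \<Omega>" "AE x in lborel. u x = v x"
  shows "energy p q a Ksp Ktq \<Omega> u = energy p q a Ksp Ktq \<Omega> v"
  unfolding energy_def
proof (rule nn_integral_lebesgue_on_cong_AE[OF open_cross_domain[OF assms(1)]],
    rule AE_mp[OF AE_lborel_product[OF assms(2)]], intro AE_I2 impI)
  fix z :: "(real ^ 'n) \<times> (real ^ 'n)"
  assume "u (fst z) = v (fst z) \<and> u (snd z) = v (snd z)"
  then show "(case z of (x, y) \<Rightarrow> ennreal (\<bar>u x - u y\<bar> powr p * Ksp x y + a x y * \<bar>u x - u y\<bar> powr q * Ktq x y))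
    = (case z of (x, y) \<Rightarrow> ennreal (\<bar>v x - v y\<bar> powr p * Ksp x y + a x y * \<bar>v x - v y\<bar> powr q * Ktq x y))"
    by (cases z) simp
qed

text \<open>
  Together with the next lemmas this allows a minimizer to be replaced by a Borel
  representative.
\<close>

lemma minimizer_cong_AE:
  fixes u v :: "real ^ 'n \<Rightarrow> real"
  assumes \<Omega>: "open \<Omega>" and eq: "AE x in lborel. u x = v x" and v: "v \<in> borel_measurable lebesgue"
    and min: "minimizer p q s t a Ksp Ktq \<Omega> u"
  shows "minimizer p q s t a Ksp Ktq \<Omega> v"
proof -
  have \<Omega>': "\<Omega> \<in> sets lebesgue" using \<Omega> by simp
  have "(\<integral>\<^sup>+ x. ennreal (\<bar>u x\<bar> powr p) \<partial>lebesgue_on \<Omega>) = (\<integral>\<^sup>+ x. ennreal (\<bar>v x\<bar> powr p) \<partial>lebesgue_on \<Omega>)"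
    using eq by (intro nn_integral_lebesgue_on_cong_AE \<Omega>') (auto elim!: eventually_mono)
  then have adm: "v \<in> admissible p q s t a \<Omega>"
    using min v unfolding minimizer_def admissible_energy energy_cong_AE[OF \<Omega> eq] by auto
  have eq': "AE x in lebesgue. u x = v x" using eq by (simp add: AE_completion_iff)
  show ?thesis
    unfolding minimizer_def
  proof (intro conjI adm ballI impI)
    fix f assume f: "f \<in> admissible p q s t a \<Omega>" "AE x in lebesgue. x \<notin> \<Omega> \<longrightarrow> f x = v x"
    have "AE x in lebesgue. x \<notin> \<Omega> \<longrightarrow> f x = u x"
      using f(2) eq' by eventually_elim auto
    then show "energy p q a Ksp Ktq \<Omega> v \<le> energy p q a Ksp Ktq \<Omega> f"
      using min f(1) unfolding minimizer_def energy_cong_AE[OF \<Omega> eq, symmetric] by blast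
  qed
qed

lemma has_data_norm_cong_AE:
  fixes u v :: "real ^ 'n \<Rightarrow> real"
  assumes eq: "AE x in lborel. u x = v x" and D: "D \<in> sets borel" and d: "has_data_norm p s D u M"
    and uv: "u \<in> borel_measurable lebesgue" "v \<in> borel_measurable lebesgue"
  shows "has_data_norm p s D v M"
proof -
  have "AE x in lebesgue_on D. ereal \<bar>u x\<bar> = ereal \<bar>v x\<bar>"
    using eq D by (subst AE_restrict_space_iff) (auto simp: AE_completion_iff elim!: eventually_mono)
  moreover have "(\<lambda>x. ereal \<bar>u x\<bar>) \<in> borel_measurable (lebesgue_on D)"
    "(\<lambda>x. ereal \<bar>v x\<bar>) \<in> borel_measurable (lebesgue_on D)"
    using uv by (auto intro!: measurable_restrict_space1)
  ultimately have "esssup (lebesgue_on D) (\<lambda>x. ereal \<bar>u x\<bar>) = esssup (lebesgue_on D) (\<lambda>x. ereal \<bar>v x\<bar>)"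
    by (intro esssup_AE_cong)
  moreover have "gagliardo_power p s D u = gagliardo_power p s D v"
    unfolding gagliardo_power_def
  proof (rule nn_integral_lebesgue_on_cong_AE)
    have "D \<times> D \<in> sets (borel \<Otimes>\<^sub>M borel)" by (rule pair_measureI[OF D D])
    then have "D \<times> D \<in> sets borel" by (simp only: borel_prod)
    then show "D \<times> D \<in> sets lebesgue" by simp
    show "AE z in lborel. z \<in> D \<times> D \<longrightarrow>
        (case z of (x, y) \<Rightarrow> ennreal (\<bar>u x - u y\<bar> powr p / norm (x - y) powr (real CARD('n) + s * p)))
      = (case z of (x, y) \<Rightarrow> ennreal (\<bar>v x - v y\<bar> powr p / norm (x - y) powr (real CARD('n) + s * p)))"
      using AE_lborel_product[OF eq] by eventually_elim (auto simp: split_beta)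
  qed
  ultimately show ?thesis
    using d unfolding has_data_norm_def by (cases "s * p \<le> real CARD('n)") simp_all
qed

lemma tail_spaces_cong_AE:
  fixes u v :: "real ^ 'n \<Rightarrow> real"
  assumes eq: "AE x in lborel. u x = v x" and v: "v \<in> borel_measurable lebesgue"
  shows "u \<in> tail_space p s \<Longrightarrow> v \<in> tail_space p s"
    and "u \<in> weighted_tail_space q t a \<Omega> \<Longrightarrow> v \<in> weighted_tail_space q t a \<Omega>"
    and "nonlocal_tail p q s t a (\<lambda>x. max (u x) 0) x0 r \<rho> = nonlocal_tail p q s t a (\<lambda>x. max (v x) 0) x0 r \<rho>"
proof -
  have eq': "AE x in lebesgue. u x = v x" using eq by (simp add: AE_completion_iff)
  have cong: "(\<integral>\<^sup>+ x. f x (u x) \<partial>lebesgue) = (\<integral>\<^sup>+ x. f x (v x) \<partial>lebesgue)" for f :: "real ^ 'n \<Rightarrow> real \<Rightarrow> ennreal"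
    by (rule nn_integral_cong_AE, rule AE_mp[OF eq'], intro AE_I2 impI) simp
  have cong': "(\<integral>\<^sup>+ x. f x (u x) \<partial>lebesgue_on (- ball x0 \<rho>)) = (\<integral>\<^sup>+ x. f x (v x) \<partial>lebesgue_on (- ball x0 \<rho>))"
    for f :: "real ^ 'n \<Rightarrow> real \<Rightarrow> ennreal"
  proof (rule nn_integral_lebesgue_on_cong_AE)
    show "- ball x0 \<rho> \<in> sets lebesgue" by simp
    show "AE x in lborel. x \<in> - ball x0 \<rho> \<longrightarrow> f x (u x) = f x (v x)"
      by (rule AE_mp[OF eq], intro AE_I2 impI) simp
  qed
  show "u \<in> tail_space p s \<Longrightarrow> v \<in> tail_space p s"
    using v cong[of "\<lambda>x z. ennreal (\<bar>z\<bar> powr (p - 1) / (1 + norm x) powr (real CARD('n) + s * p))"]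
    by (simp add: tail_space_def)
  show "u \<in> weighted_tail_space q t a \<Omega> \<Longrightarrow> v \<in> weighted_tail_space q t a \<Omega>"
    using v cong[of "\<lambda>y z. ennreal (a x y * (\<bar>z\<bar> powr (q - 1) / (1 + norm y) powr (real CARD('n) + t * q)))" for x]
    by (simp add: weighted_tail_space_def)
  show "nonlocal_tail p q s t a (\<lambda>x. max (u x) 0) x0 r \<rho> = nonlocal_tail p q s t a (\<lambda>x. max (v x) 0) x0 r \<rho>"
    using cong'[of "\<lambda>x z. ennreal (max z 0 powr (p - 1) / norm (x - x0) powr (real CARD('n) + s * p))"]
      cong'[of "\<lambda>x z. ennreal (a x y * (max z 0 powr (q - 1) / norm (x - x0) powr (real CARD('n) + t * q)))" for y]
    by (simp add: nonlocal_tail_def)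
qed

theorem theorem1p6:
  fixes p q s t \<Lambda> \<alpha> A M \<delta> :: real
  assumes "CARD('n::finite) \<ge> 2"
    and "0 < s" "s \<le> t" "t < 1"
    and "1 < p" "p \<le> q"
    and "\<Lambda> \<ge> 1"
    and "0 < \<alpha>" "\<alpha> \<le> 1" "A \<ge> 0"
    and "t * q \<le> s * p + \<alpha>"
    and "0 < \<delta>" "\<delta> \<le> 1"
  shows "\<exists>C > 0. \<forall>(\<Omega> :: (real ^ 'n) set) Ksp Ktq a x0 r u.
    open \<Omega> \<and> bounded \<Omega> \<and>
    comparable_kernel \<Lambda> (s * p) Ksp \<and> comparable_kernel \<Lambda> (t * q) Ktq \<and>
    coefficient a \<and> hoelder_coefficient \<alpha> A a \<and>
    0 < r \<and> r \<le> 1 \<and> ball x0 r \<subseteq> \<Omega> \<and>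
    u \<in> admissible p q s t a \<Omega> \<inter> tail_space p s \<inter> weighted_tail_space q t a \<Omega> \<and>
    locally_bounded_in \<Omega> u \<and>
    minimizer p q s t a Ksp Ktq \<Omega> u \<and>
    has_data_norm p s (ball x0 r) u M
    \<longrightarrow>
    esssup (lebesgue_on (ball x0 (r / 2))) (\<lambda>x. ereal (u x)) \<le>
      ereal (C * inv_into {0..} (H_fun p q s t (a_minus a x0 r) r)
               (1 / measure lebesgue (ball x0 r) *
                (LINT x|lebesgue_on (ball x0 r). H_fun p q s t (a_minus a x0 r) r (max (u x) 0)))
             + \<delta> * inv_into {0..} (h_fun p q s t (a_minus a x0 r) r)
               (enn2real (nonlocal_tail p q s t a (\<lambda>x. max (u x) 0) x0 r (r / 2))))"
proof -
  obtain C where C: "0 < C" and bound: "\<And>(\<Omega> :: (real ^ 'n) set) Ksp Ktq a x0 r u.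
    open \<Omega> \<and> comparable_kernel \<Lambda> (s * p) Ksp \<and> comparable_kernel \<Lambda> (t * q) Ktq \<and>
    coefficient a \<and> hoelder_coefficient \<alpha> A a \<and> 0 < r \<and> r \<le> 1 \<and> ball x0 r \<subseteq> \<Omega> \<and>
    u \<in> borel_measurable borel \<and> u \<in> tail_space p s \<and> u \<in> weighted_tail_space q t a \<Omega> \<and>
    minimizer p q s t a Ksp Ktq \<Omega> u \<and> has_data_norm p s (ball x0 r) u M \<Longrightarrow>
    (AE x in lborel. x \<in> ball x0 (r / 2) \<longrightarrow>
      u x \<le> C * inv_into {0..} (H_fun p q s t (a_minus a x0 r) r)
               (enn2real (\<integral>\<^sup>+ x\<in>ball x0 r. ennreal (H_fun p q s t (a_minus a x0 r) r (max (u x) 0)) \<partial>lborel)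
                 / (unit_ball_vol (real CARD('n)) * r ^ CARD('n)))
             + \<delta> * inv_into {0..} (h_fun p q s t (a_minus a x0 r) r)
               (enn2real (nonlocal_tail p q s t a (\<lambda>x. max (u x) 0) x0 r (r / 2))))"
    using minimizer_sup_bound_borel[OF assms(2-8,10-13), where 'n = 'n and M = M] by (elim exE conjE) blast
  show ?thesis
  proof (rule exI[of _ C], intro conjI C allI impI; elim conjE)
    fix \<Omega> :: "(real ^ 'n) set" and Ksp Ktq a and x0 :: "real ^ 'n" and r :: real and u :: "real ^ 'n \<Rightarrow> real"
    assume \<Omega>: "open \<Omega>" and ker: "comparable_kernel \<Lambda> (s * p) Ksp" "comparable_kernel \<Lambda> (t * q) Ktq"
      and coef: "coefficient a" "hoelder_coefficient \<alpha> A a" and r: "0 < r" "r \<le> 1" "ball x0 r \<subseteq> \<Omega>"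
      and u: "u \<in> admissible p q s t a \<Omega> \<inter> tail_space p s \<inter> weighted_tail_space q t a \<Omega>"
      and min: "minimizer p q s t a Ksp Ktq \<Omega> u" and data: "has_data_norm p s (ball x0 r) u M"
    have um [measurable]: "u \<in> borel_measurable lebesgue" using u by (simp add: admissible_def)
    obtain v where "v \<in> borel_measurable lborel" and eq: "AE x in lborel. u x = v x"
      using completion_ex_borel_measurable_real[OF um] by blast
    then have v: "v \<in> borel_measurable borel" by simp
    have vl: "v \<in> borel_measurable lebesgue" using v by (rule borel_measurable_lebesgueI)
    define m where "m = a_minus a x0 r"
    have a0: "\<And>x y. 0 \<le> a x y" using coef by (auto simp: coefficient_def)
    have m: "0 \<le> m" unfolding m_def by (rule a_minus_bounds[OF a0 coef(2) assms(8,10) r(1)])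
    have tails: "v \<in> tail_space p s" "v \<in> weighted_tail_space q t a \<Omega>"
      using tail_spaces_cong_AE(1,2)[OF eq vl] u by auto
    define T where "T = enn2real (nonlocal_tail p q s t a (\<lambda>x. max (u x) 0) x0 r (r / 2))"
    define Z where "Z = 1 / measure lebesgue (ball x0 r) * (LINT x|lebesgue_on (ball x0 r). H_fun p q s t m r (max (u x) 0))"
    have ballm: "ball x0 r \<in> sets lebesgue" by simp
    have Z: "Z = enn2real (\<integral>\<^sup>+ x\<in>ball x0 r. ennreal (H_fun p q s t m r (max (v x) 0)) \<partial>lborel)
        / (unit_ball_vol (real CARD('n)) * r ^ CARD('n))"
    proof -
      have "(\<lambda>x. H_fun p q s t m r (max (u x) 0)) \<in> borel_measurable lebesgue" by measurable
      then have "(LINT x|lebesgue_on (ball x0 r). H_fun p q s t m r (max (u x) 0))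
          = enn2real (\<integral>\<^sup>+ x. ennreal (H_fun p q s t m r (max (u x) 0)) \<partial>lebesgue_on (ball x0 r))"
        using H_fun_nonneg[OF m] by (intro integral_eq_nn_integral measurable_restrict_space1) auto
      also have "(\<integral>\<^sup>+ x. ennreal (H_fun p q s t m r (max (u x) 0)) \<partial>lebesgue_on (ball x0 r))
          = (\<integral>\<^sup>+ x. ennreal (H_fun p q s t m r (max (v x) 0)) \<partial>lebesgue_on (ball x0 r))"
        by (rule nn_integral_lebesgue_on_cong_AE[OF ballm], rule AE_mp[OF eq], intro AE_I2 impI) simp
      also have "\<dots> = (\<integral>\<^sup>+ x\<in>ball x0 r. ennreal (H_fun p q s t m r (max (v x) 0)) \<partial>lborel)"
        by (rule nn_integral_lebesgue_on[OF ballm])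
      moreover have "measure lebesgue (ball x0 r) = unit_ball_vol (real CARD('n)) * r ^ CARD('n)"
        using content_ball[of r x0] r by simp
      ultimately show ?thesis by (simp add: Z_def)
    qed
    have "AE x in lborel. x \<in> ball x0 (r / 2) \<longrightarrow>
      v x \<le> C * inv_into {0..} (H_fun p q s t m r) Z + \<delta> * inv_into {0..} (h_fun p q s t m r) T"
      unfolding m_def Z[unfolded m_def] T_def tail_spaces_cong_AE(3)[OF eq vl]
      using \<Omega> ker coef r v tails minimizer_cong_AE[OF \<Omega> eq vl min] has_data_norm_cong_AE[OF eq _ data um vl]
      by (intro bound) auto
    then have "AE x in lborel. x \<in> ball x0 (r / 2) \<longrightarrow>
      u x \<le> C * inv_into {0..} (H_fun p q s t m r) Z + \<delta> * inv_into {0..} (h_fun p q s t m r) T"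
      using eq by eventually_elim simp
    then have "AE x in lebesgue. x \<in> ball x0 (r / 2) \<longrightarrow>
      ereal (u x) \<le> ereal (C * inv_into {0..} (H_fun p q s t m r) Z + \<delta> * inv_into {0..} (h_fun p q s t m r) T)"
      by (simp add: AE_completion_iff)
    then have "AE x in lebesgue_on (ball x0 (r / 2)).
      ereal (u x) \<le> ereal (C * inv_into {0..} (H_fun p q s t m r) Z + \<delta> * inv_into {0..} (h_fun p q s t m r) T)"
      by (subst AE_restrict_space_iff) auto
    moreover have "(\<lambda>x. ereal (u x)) \<in> borel_measurable (lebesgue_on (ball x0 (r / 2)))"
      by (intro measurable_restrict_space1) measurable
    ultimately have "esssup (lebesgue_on (ball x0 (r / 2))) (\<lambda>x. ereal (u x))
      \<le> ereal (C * inv_into {0..} (H_fun p q s t m r) Z + \<delta> * inv_into {0..} (h_fun p q s t m r) T)"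
      by (rule esssup_I[rotated])
    then show "esssup (lebesgue_on (ball x0 (r / 2))) (\<lambda>x. ereal (u x)) \<le>
      ereal (C * inv_into {0..} (H_fun p q s t (a_minus a x0 r) r)
               (1 / measure lebesgue (ball x0 r) *
                (LINT x|lebesgue_on (ball x0 r). H_fun p q s t (a_minus a x0 r) r (max (u x) 0)))
             + \<delta> * inv_into {0..} (h_fun p q s t (a_minus a x0 r) r)
               (enn2real (nonlocal_tail p q s t a (\<lambda>x. max (u x) 0) x0 r (r / 2))))"
      unfolding Z_def T_def m_def .
  qed
qed

end
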